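(* Let $1\le n\le m$ and $\mathfrak g=\mathfrak{sl}_{m|n}$. Let $\lambda$ be an integral dominant weight and let $V_\lambda$ be the finite-dimensional Kac module with highest weight $\lambda$. Then $$H^1(\mathfrak g,V_\lambda)\cong\begin{cases}\mathbb C&\text{if }\lambda=2\rho_1+\alpha_{\max},\\ \mathbb C&\text{if }\lambda=2\rho_1,\\ 0&\text{otherwise.}\end{cases}$$
   Context: The ground field is $\mathbb C$, and $1\le n\le m$. Put $\mathbf I_1=\{1,\dots,m\}$, $\mathbf I_2=\{\dot1,\dots,\dot n\}$ with $\dot\nu=m+\nu$, $\mathbf I=\mathbf I_1\cup\mathbf I_2$, and $[a]=\bar0$ for $a\in\mathbf I_1$, $[a]=\bar1$ for $a\in\mathbf I_2$. $E_{ab}$ are matrix units of $\mathfrak{gl}_{m|n}$, of parity $[a]+[b]$, with the supercommutator as bracket; $\mathfrak g=\mathfrak{sl}_{m|n}$ is the subalgebra of supertraceless matrices. It is graded, $\mathfrak g=\mathfrak g_{-1}\oplus\mathfrak g_0\oplus\mathfrak g_{+1}$, with $\mathfrak g_0$ the even (block diagonal) part, $\mathfrak g_{+1}$ spanned by the $E_{i\nu}$ and $\mathfrak g_{-1}$ by the $E_{\nu i}$ ($i\in\mathbf I_1,\nu\in\mathbf I_2$). $\mathfrak h$ is the subalgebra of diagonal matrices of $\mathfrak g$; $\epsilon_a(E_{bb})=\delta_{ab}$; $\mathfrak h^*$ is identified with the span of the $\epsilon_a-\epsilon_b$. A weight is written $\lambda=(\lambda_1,\dots,\lambda_m\,|\,\lambda_{\dot1},\dots,\lambda_{\dot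 n})=\sum_{a\in\mathbf I}\lambda_a\epsilon_a$ with $\sum_a\lambda_a=0$. The bilinear form is $(\epsilon_a,\epsilon_b)=(-1)^{[a]}\delta_{ab}$. Positive even roots: $\epsilon_i-\epsilon_j$ ($1\le i<j\le m$), $\epsilon_\nu-\epsilon_\eta$ ($\dot1\le\nu<\eta\le\dot n$); positive odd roots: $\alpha_{i,\nu}=\epsilon_i-\epsilon_\nu$ ($i\in\mathbf I_1,\nu\in\mathbf I_2$). $\lambda$ is integral if $(\lambda,\alpha)\in\mathbb Z$ for all roots $\alpha$, and dominant if $2(\lambda,\alpha)/(\alpha,\alpha)\ge0$ for all positive even roots $\alpha$. $\alpha_{\max}=\epsilon_1-\epsilon_{\dot n}$ and $2\rho_1=(n,\dots,n\,|\,-m,\dots,-m)$ is the sum of the positive odd roots. For $\lambda$ integral dominant, $L^{(0)}_\lambda$ is the finite-dimensional irreducible $\mathfrak g_0$-module of highest weight $\lambda$, made a $\mathfrak g_0\oplus\mathfrak g_{+1}$-module by $\mathfrak g_{+1}L^{(0)}_\lambda=0$, and $V_\lambda=\mathrm{Ind}_{\mathfrak g_0\oplus\mathfrak g_{+1}}^{\mathfrak g}L^{(0)}_\lambda$ is the Kac module. Cohomology: for a $\mathfrak g$-module $V$, $C^0(\mathfrak g,V)=V$ and $C^p(\mathfrak g,V)$ is the $\mathbb Z_2$-graded space of all $p$-linear maps $\varphi:\mathfrak g^p\to V$ with $\varphi(\dots,x_i,x_{i+1},\dots)=-(-1)^{[x_i][x_{i+1}]}\varphi(\dots,x_{i+1},x_i,\dots)$.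 The differential is $$(d\varphi)(x_0,\dots,x_p)=\sum_{i=0}^p(-1)^{i+[x_i]([\varphi]+[x_0]+\cdots+[x_{i-1}])}x_i\varphi(x_0,\dots,\hat x_i,\dots,x_p)+\sum_{i<j}(-1)^{j+[x_j]([x_{i+1}]+\cdots+[x_{j-1}])}\varphi(x_0,\dots,x_{i-1},[x_i,x_j],x_{i+1},\dots,\hat x_j,\dots,x_p),$$ and $H^p(\mathfrak g,V)=\ker(d|_{C^p})/\mathrm{Im}(d|_{C^{p-1}})$.
   Formalization: The case m = n = 1 is excluded: for sl_{1|1} every such Kac module has H^1 of dimension 2, so the stated formula fails there; equality of weights is taken as equality of functionals on h, which matters only when m = n. *)

theory Defs
  imports
    Complex_Main
    "Jordan_Normal_Form.Matrix"
    "HOL-Library.Poly_Mapping"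
    "HOL-Library.Nonpos_Ints"
begin

section \<open>The Lie superalgebra \<open>sl\<^sub>m\<^sub>|\<^sub>n\<close>\<close>

text \<open>
  Indices are 0-based: \<open>I\<^sub>1 = {0..<m}\<close> and \<open>I\<^sub>2 = {m..<m+n}\<close>. Parities are natural numbers
  that are only relevant modulo 2.
\<close>

definition ipar :: "nat \<Rightarrow> nat \<Rightarrow> nat" where
  "ipar m a = (if a < m then 0 else 1)"

definition mat_part :: "nat \<Rightarrow> nat \<Rightarrow> complex mat \<Rightarrow> complex mat" where
  "mat_part m b A = mat (dim_row A) (dim_col A)
     (\<lambda>(i, j). if even (ipar m i + ipar m j + b) then A $$ (i, j) else 0)"

definition mat_homog :: "nat \<Rightarrow> nat \<Rightarrow> complex mat \<Rightarrow> bool" where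
  "mat_homog m b A \<longleftrightarrow> mat_part m b A = A"

text \<open>
  The bilinear extension of \<open>[A, B] = AB - (-1)\<^bsup>[A][B]\<^esup> BA\<close> from homogeneous to all matrices.
\<close>

definition sbracket :: "nat \<Rightarrow> complex mat \<Rightarrow> complex mat \<Rightarrow> complex mat" where
  "sbracket m A B =
     (let A0 = mat_part m 0 A; A1 = mat_part m 1 A; B0 = mat_part m 0 B; B1 = mat_part m 1 B
      in (A0 * B0 - B0 * A0) + (A0 * B1 - B1 * A0) + (A1 * B0 - B0 * A1) + (A1 * B1 + B1 * A1))"

definition supertrace :: "nat \<Rightarrow> nat \<Rightarrow> complex mat \<Rightarrow> complex" where
  "supertrace m n A = (\<Sum>a<m+n. (-1) ^ ipar m a * A $$ (a, a))"

definition sl :: "nat \<Rightarrow> nat \<Rightarrow> complex mat set" where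
  "sl m n = {A \<in> carrier_mat (m + n) (m + n). supertrace m n A = 0}"

definition sl_zero :: "nat \<Rightarrow> nat \<Rightarrow> complex mat set" where
  "sl_zero m n = {A \<in> sl m n. mat_homog m 0 A}"

definition sl_plus :: "nat \<Rightarrow> nat \<Rightarrow> complex mat set" where
  "sl_plus m n = {A \<in> sl m n. \<forall>i<m+n. \<forall>j<m+n. A $$ (i, j) \<noteq> 0 \<longrightarrow> i < m \<and> m \<le> j}"

definition sl_para :: "nat \<Rightarrow> nat \<Rightarrow> complex mat set" where
  "sl_para m n = {A + B | A B. A \<in> sl_zero m n \<and> B \<in> sl_plus m n}"

definition cartan :: "nat \<Rightarrow> nat \<Rightarrow> complex mat set" where
  "cartan m n = {A \<in> sl m n. diagonal_mat A}"

definition mat_unit :: "nat \<Rightarrow> nat \<Rightarrow> nat \<Rightarrow> nat \<Rightarrow> complex mat" where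
  "mat_unit m n a b = mat (m + n) (m + n) (\<lambda>(i, j). if i = a \<and> j = b then 1 else 0)"

section \<open>Weights\<close>

text \<open>
  A weight \<open>(\<Lambda>\<^sub>1, \<dots>, \<Lambda>\<^sub>m | \<Lambda>\<^sub>m\<^sub>+\<^sub>1, \<dots>, \<Lambda>\<^sub>m\<^sub>+\<^sub>n)\<close> is a function on indices of which only the
  arguments below \<open>m + n\<close> matter.
\<close>

type_synonym weight = "nat \<Rightarrow> complex"

definition is_weight :: "nat \<Rightarrow> nat \<Rightarrow> weight \<Rightarrow> bool" where
  "is_weight m n \<Lambda> \<longleftrightarrow> (\<Sum>a<m+n. \<Lambda> a) = 0"

definition weight_eval :: "nat \<Rightarrow> nat \<Rightarrow> weight \<Rightarrow> complex mat \<Rightarrow> complex" where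
  "weight_eval m n \<Lambda> H = (\<Sum>a<m+n. \<Lambda> a * H $$ (a, a))"

text \<open>
  Equality of weights as elements of \<open>h\<^sup>*\<close>. If \<open>m \<noteq> n\<close>, this is equality of the tuples (of
  total sum 0). If \<open>m = n\<close>, the tuple \<open>(1, \<dots>, 1 | -1, \<dots>, -1)\<close> has sum 0 but vanishes
  on \<open>h\<close>, so distinct tuples can be the same weight.
\<close>

definition weight_eq :: "nat \<Rightarrow> nat \<Rightarrow> weight \<Rightarrow> weight \<Rightarrow> bool" where
  "weight_eq m n \<Lambda> \<mu> \<longleftrightarrow> (\<forall>H\<in>cartan m n. weight_eval m n \<Lambda> H = weight_eval m n \<mu> H)"

definition eps :: "nat \<Rightarrow> weight" where
  "eps a = (\<lambda>b. if a = b then 1 else 0)"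

definition wroot :: "nat \<Rightarrow> nat \<Rightarrow> weight" where
  "wroot a b = (\<lambda>c. eps a c - eps b c)"

definition weight_form :: "nat \<Rightarrow> nat \<Rightarrow> weight \<Rightarrow> weight \<Rightarrow> complex" where
  "weight_form m n \<Lambda> \<mu> = (\<Sum>a<m+n. (-1) ^ ipar m a * \<Lambda> a * \<mu> a)"

definition pos_even_pairs :: "nat \<Rightarrow> nat \<Rightarrow> (nat \<times> nat) set" where
  "pos_even_pairs m n = {(a, b). a < b \<and> b < m + n \<and> (b < m \<or> m \<le> a)}"

definition integral_weight :: "nat \<Rightarrow> nat \<Rightarrow> weight \<Rightarrow> bool" where
  "integral_weight m n \<Lambda> \<longleftrightarrow>
     (\<forall>a<m+n. \<forall>b<m+n. a \<noteq> b \<longrightarrow> weight_form m n \<Lambda> (wroot a b) \<in> \<int>)"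

definition dominant_weight :: "nat \<Rightarrow> nat \<Rightarrow> weight \<Rightarrow> bool" where
  "dominant_weight m n \<Lambda> \<longleftrightarrow>
     (\<forall>(a, b)\<in>pos_even_pairs m n.
        2 * weight_form m n \<Lambda> (wroot a b) / weight_form m n (wroot a b) (wroot a b) \<in> \<real>\<^sub>\<ge>\<^sub>0)"

definition alpha_max :: "nat \<Rightarrow> nat \<Rightarrow> weight" where
  "alpha_max m n = wroot 0 (m + n - 1)"

definition two_rho1 :: "nat \<Rightarrow> nat \<Rightarrow> weight" where
  "two_rho1 m n = (\<lambda>c. \<Sum>i<m. \<Sum>\<nu>\<in>{m..<m+n}. wroot i \<nu> c)"

section \<open>Supermodules\<close>

text \<open>
  A \<open>\<int>\<^sub>2\<close>-graded complex vector space on a whole type with an action of matrices. The grading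
  is given by the projection \<^term>\<open>evp\<close> onto the even part along the odd part.
\<close>

record 'v smodule =
  scl :: "complex \<Rightarrow> 'v \<Rightarrow> 'v"
  evp :: "'v \<Rightarrow> 'v"
  act :: "complex mat \<Rightarrow> 'v \<Rightarrow> 'v"

definition vpart :: "('v::ab_group_add) smodule \<Rightarrow> nat \<Rightarrow> 'v \<Rightarrow> 'v" where
  "vpart V b v = (if even b then evp V v else v - evp V v)"

definition supermodule :: "nat \<Rightarrow> complex mat set \<Rightarrow> ('v::ab_group_add) smodule \<Rightarrow> bool" where
  "supermodule m S V \<longleftrightarrow>
     vector_space (scl V) \<and>
     (\<forall>u v. evp V (u + v) = evp V u + evp V v) \<and>
     (\<forall>c v. evp V (scl V c v) = scl V c (evp V v)) \<and>
     (\<forall>v. evp V (evp V v) = evp V v) \<and>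
     (\<forall>x\<in>S. \<forall>u v. act V x (u + v) = act V x u + act V x v) \<and>
     (\<forall>x\<in>S. \<forall>c v. act V x (scl V c v) = scl V c (act V x v)) \<and>
     (\<forall>x\<in>S. \<forall>y\<in>S. \<forall>v. act V (x + y) v = act V x v + act V y v) \<and>
     (\<forall>x\<in>S. \<forall>c v. act V (c \<cdot>\<^sub>m x) v = scl V c (act V x v)) \<and>
     (\<forall>a b. \<forall>x\<in>S. \<forall>v. mat_homog m a x \<and> vpart V b v = v \<longrightarrow>
        vpart V (a + b) (act V x v) = act V x v) \<and>
     (\<forall>a b. \<forall>x\<in>S. \<forall>y\<in>S. \<forall>v. mat_homog m a x \<and> mat_homog m b y \<longrightarrow>
        act V (sbracket m x y) v =
          act V x (act V y v) - scl V ((-1) ^ (a * b)) (act V y (act V x v)))"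

definition finite_dim :: "('v::ab_group_add) smodule \<Rightarrow> bool" where
  "finite_dim V \<longleftrightarrow> (\<exists>B. finite B \<and> module.span (scl V) B = UNIV)"

definition irreducible_under :: "complex mat set \<Rightarrow> ('v::ab_group_add) smodule \<Rightarrow> bool" where
  "irreducible_under S V \<longleftrightarrow>
     (UNIV :: 'v set) \<noteq> {0} \<and>
     (\<forall>W. module.subspace (scl V) W \<and> (\<forall>x\<in>S. \<forall>w\<in>W. act V x w \<in> W) \<longrightarrow> W = {0} \<or> W = UNIV)"

definition has_highest_weight ::
  "nat \<Rightarrow> nat \<Rightarrow> weight \<Rightarrow> ('v::ab_group_add) smodule \<Rightarrow> bool" where
  "has_highest_weight m n \<Lambda> V \<longleftrightarrow>
     (\<exists>v. v \<noteq> 0 \<and>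
        (\<forall>H\<in>cartan m n. act V H v = scl V (weight_eval m n \<Lambda> H) v) \<and>
        (\<forall>(a, b)\<in>pos_even_pairs m n. act V (mat_unit m n a b) v = 0))"

text \<open>
  \<open>L\<^sub>\<Lambda>\<^sup>(\<^sup>0\<^sup>)\<close> as a module over \<open>g\<^sub>0 \<oplus> g\<^sub>+\<^sub>1\<close>. The parity of the highest weight vector is left open;
  irreducibility over the even algebra \<open>g\<^sub>0\<close> makes the module purely even or purely odd.
\<close>

definition level0_module ::
  "nat \<Rightarrow> nat \<Rightarrow> weight \<Rightarrow> ('l::ab_group_add) smodule \<Rightarrow> bool" where
  "level0_module m n \<Lambda> L \<longleftrightarrow>
     supermodule m (sl_para m n) L \<and>
     finite_dim L \<and>
     irreducible_under (sl_zero m n) L \<and>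
     has_highest_weight m n \<Lambda> L \<and>
     (\<forall>x\<in>sl_plus m n. \<forall>l. act L x l = 0)"

section \<open>The induced module\<close>

text \<open>
  \<open>U(g) \<otimes>\<^bsub>U(p)\<^esub> L\<close> for \<open>p = g\<^sub>0 \<oplus> g\<^sub>+\<^sub>1\<close> is presented as the free vector space on the pairs
  \<open>([x\<^sub>1, \<dots>, x\<^sub>k], l)\<close>, standing for \<open>x\<^sub>1 \<cdots> x\<^sub>k \<otimes> l\<close>, modulo the multilinearity of \<open>T(g) \<otimes> L\<close>,
  the defining relations of \<open>U(g)\<close>, and the balancing over \<open>p\<close> (which generates \<open>U(p)\<close>).
\<close>

type_synonym 'l free_ind = "(complex mat list \<times> 'l) \<Rightarrow>\<^sub>0 complex"

abbreviation gen :: "complex mat list \<Rightarrow> 'l \<Rightarrow> 'l free_ind" where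
  "gen xs l \<equiv> Poly_Mapping.single (xs, l) 1"

definition free_scale :: "complex \<Rightarrow> 'l free_ind \<Rightarrow> 'l free_ind" where
  "free_scale c f = Poly_Mapping.map (\<lambda>d. c * d) f"

definition free_carrier :: "nat \<Rightarrow> nat \<Rightarrow> 'l free_ind set" where
  "free_carrier m n = {f. Poly_Mapping.keys f \<subseteq> lists (sl m n) \<times> UNIV}"

definition tensor_rels :: "nat \<Rightarrow> nat \<Rightarrow> ('l::ab_group_add) smodule \<Rightarrow> 'l free_ind set" where
  "tensor_rels m n L =
     {gen (xs @ [x + y] @ ys) l - gen (xs @ [x] @ ys) l - gen (xs @ [y] @ ys) l | xs ys x y l.
        xs \<in> lists (sl m n) \<and> ys \<in> lists (sl m n) \<and> x \<in> sl m n \<and> y \<in> sl m n} \<union>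
     {gen (xs @ [c \<cdot>\<^sub>m x] @ ys) l - free_scale c (gen (xs @ [x] @ ys) l) | xs ys x c l.
        xs \<in> lists (sl m n) \<and> ys \<in> lists (sl m n) \<and> x \<in> sl m n} \<union>
     {gen xs (l + l') - gen xs l - gen xs l' | xs l l'. xs \<in> lists (sl m n)} \<union>
     {gen xs (scl L c l) - free_scale c (gen xs l) | xs c l. xs \<in> lists (sl m n)}"

definition env_rels :: "nat \<Rightarrow> nat \<Rightarrow> 'l free_ind set" where
  "env_rels m n =
     {gen (xs @ [x, y] @ ys) l - free_scale ((-1) ^ (a * b)) (gen (xs @ [y, x] @ ys) l)
        - gen (xs @ [sbracket m x y] @ ys) l | xs ys x y a b l.
        xs \<in> lists (sl m n) \<and> ys \<in> lists (sl m n) \<and> x \<in> sl m n \<and> y \<in> sl m n \<and>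
        mat_homog m a x \<and> mat_homog m b y}"

definition balance_rels :: "nat \<Rightarrow> nat \<Rightarrow> ('l::ab_group_add) smodule \<Rightarrow> 'l free_ind set" where
  "balance_rels m n L =
     {gen (xs @ [p]) l - gen xs (act L p l) | xs p l. xs \<in> lists (sl m n) \<and> p \<in> sl_para m n}"

definition ind_relations :: "nat \<Rightarrow> nat \<Rightarrow> ('l::ab_group_add) smodule \<Rightarrow> 'l free_ind set" where
  "ind_relations m n L =
     module.span free_scale (tensor_rels m n L \<union> env_rels m n \<union> balance_rels m n L)"

text \<open>The map \<open>x\<^sub>1 \<cdots> x\<^sub>k \<otimes> l \<mapsto> x\<^sub>1 (\<cdots> (x\<^sub>k (\<iota> l)))\<close>.\<close>

definition ind_map ::
  "('v::ab_group_add) smodule \<Rightarrow> ('l \<Rightarrow> 'v) \<Rightarrow> 'l free_ind \<Rightarrow> 'v" where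
  "ind_map V \<iota> f =
     (\<Sum>k\<in>Poly_Mapping.keys f.
        scl V (Poly_Mapping.lookup f k) (foldr (act V) (fst k) (\<iota> (snd k))))"

text \<open>
  \<open>V\<close>, with the map \<open>\<iota> : L \<rightarrow> V\<close>, is (a copy of) the supermodule \<open>U(g) \<otimes>\<^bsub>U(p)\<^esub> L\<close>: the canonical
  map from the presentation above is onto with kernel the span of the relations. That \<open>\<iota>\<close> is a
  homomorphism of \<open>p\<close>-modules is part of the kernel condition.
\<close>

definition induced_module ::
  "nat \<Rightarrow> nat \<Rightarrow> ('l::ab_group_add) smodule \<Rightarrow> ('v::ab_group_add) smodule \<Rightarrow> ('l \<Rightarrow> 'v) \<Rightarrow> bool"
  where
  "induced_module m n L V \<iota> \<longleftrightarrow>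
     supermodule m (sl m n) V \<and>
     (\<forall>l. \<iota> (evp L l) = evp V (\<iota> l)) \<and>
     ind_map V \<iota> ` free_carrier m n = UNIV \<and>
     {f \<in> free_carrier m n. ind_map V \<iota> f = 0} = ind_relations m n L"

definition kac_module ::
  "nat \<Rightarrow> nat \<Rightarrow> weight \<Rightarrow> ('l::ab_group_add) smodule \<Rightarrow> ('v::ab_group_add) smodule \<Rightarrow>
   ('l \<Rightarrow> 'v) \<Rightarrow> bool" where
  "kac_module m n \<Lambda> L V \<iota> \<longleftrightarrow> level0_module m n \<Lambda> L \<and> induced_module m n L V \<iota>"

section \<open>Cohomology\<close>

text \<open>
  A \<open>p\<close>-linear map is a function on argument lists, extended by 0 to lists that are not of length
  \<open>p\<close> or have entries outside \<open>g\<close>, so that equality of cochains is equality of functions.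
\<close>

type_synonym 'v cochain = "complex mat list \<Rightarrow> 'v"

definition cochains :: "nat \<Rightarrow> nat \<Rightarrow> ('v::ab_group_add) smodule \<Rightarrow> nat \<Rightarrow> 'v cochain set" where
  "cochains m n V p = {\<phi>.
     (\<forall>xs. \<not> (length xs = p \<and> xs \<in> lists (sl m n)) \<longrightarrow> \<phi> xs = 0) \<and>
     (\<forall>xs ys x y. xs @ [x] @ ys \<in> lists (sl m n) \<and> y \<in> sl m n \<longrightarrow>
        \<phi> (xs @ [x + y] @ ys) = \<phi> (xs @ [x] @ ys) + \<phi> (xs @ [y] @ ys)) \<and>
     (\<forall>xs ys x c. xs @ [x] @ ys \<in> lists (sl m n) \<longrightarrow>
        \<phi> (xs @ [c \<cdot>\<^sub>m x] @ ys) = scl V c (\<phi> (xs @ [x] @ ys))) \<and>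
     (\<forall>xs ys x y a b. xs @ [x, y] @ ys \<in> lists (sl m n) \<and> mat_homog m a x \<and> mat_homog m b y \<longrightarrow>
        \<phi> (xs @ [x, y] @ ys) = - scl V ((-1) ^ (a * b)) (\<phi> (xs @ [y, x] @ ys)))}"

definition parities :: "nat \<Rightarrow> nat list set" where
  "parities k = {bs. length bs = k \<and> set bs \<subseteq> {0, 1}}"

definition parts :: "nat \<Rightarrow> nat list \<Rightarrow> complex mat list \<Rightarrow> complex mat list" where
  "parts m bs xs = map2 (mat_part m) bs xs"

text \<open>
  The component of parity \<open>c\<close> of a cochain; a cochain has parity \<open>c\<close> if it maps homogeneous
  \<open>x\<^sub>1, \<dots>, x\<^sub>p\<close> into parity \<open>c + [x\<^sub>1] + \<dots> + [x\<^sub>p]\<close>.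
\<close>

definition cochain_part ::
  "nat \<Rightarrow> ('v::ab_group_add) smodule \<Rightarrow> nat \<Rightarrow> 'v cochain \<Rightarrow> 'v cochain" where
  "cochain_part m V c \<phi> xs =
     (\<Sum>bs\<in>parities (length xs). vpart V (c + sum_list bs) (\<phi> (parts m bs xs)))"

text \<open>
  The displayed formula for \<open>(d\<phi>)(x\<^sub>0, \<dots>, x\<^sub>p)\<close> with \<open>\<phi>\<close> of parity \<open>c\<close> and \<open>x\<^sub>i\<close> of parity \<open>bs ! i\<close>.
\<close>

definition diff_homog ::
  "nat \<Rightarrow> ('v::ab_group_add) smodule \<Rightarrow> nat \<Rightarrow> nat list \<Rightarrow> 'v cochain \<Rightarrow> 'v cochain" where
  "diff_homog m V c bs \<phi> xs =
     (\<Sum>i<length xs.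
        scl V ((-1) ^ (i + bs ! i * (c + (\<Sum>k<i. bs ! k))))
          (act V (xs ! i) (\<phi> (take i xs @ drop (Suc i) xs)))) +
     (\<Sum>j<length xs. \<Sum>i<j.
        scl V ((-1) ^ (j + bs ! j * (\<Sum>k\<in>{i<..<j}. bs ! k)))
          (\<phi> ((take j xs @ drop (Suc j) xs)[i := sbracket m (xs ! i) (xs ! j)])))"

text \<open>Its extension to all cochains and all arguments by additivity.\<close>

definition differential ::
  "nat \<Rightarrow> nat \<Rightarrow> ('v::ab_group_add) smodule \<Rightarrow> 'v cochain \<Rightarrow> 'v cochain" where
  "differential m n V \<phi> xs =
     (if xs \<in> lists (sl m n)
      then \<Sum>c\<in>{0, 1}. \<Sum>bs\<in>parities (length xs).
             diff_homog m V c bs (cochain_part m V c \<phi>) (parts m bs xs)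
      else 0)"

definition cocycles :: "nat \<Rightarrow> nat \<Rightarrow> ('v::ab_group_add) smodule \<Rightarrow> nat \<Rightarrow> 'v cochain set" where
  "cocycles m n V p = {\<phi> \<in> cochains m n V p. differential m n V \<phi> = (\<lambda>_. 0)}"

definition coboundaries :: "nat \<Rightarrow> nat \<Rightarrow> ('v::ab_group_add) smodule \<Rightarrow> nat \<Rightarrow> 'v cochain set" where
  "coboundaries m n V p =
     (if p = 0 then {\<lambda>_. 0} else differential m n V ` cochains m n V (p - 1))"

definition coh_rel ::
  "nat \<Rightarrow> nat \<Rightarrow> ('v::ab_group_add) smodule \<Rightarrow> nat \<Rightarrow> ('v cochain \<times> 'v cochain) set" where
  "coh_rel m n V p =
     {(\<phi>, \<psi>). \<phi> \<in> cocycles m n V p \<and> \<psi> \<in> cocycles m n V p \<and>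
        (\<lambda>xs. \<phi> xs - \<psi> xs) \<in> coboundaries m n V p}"

definition coh_class ::
  "nat \<Rightarrow> nat \<Rightarrow> ('v::ab_group_add) smodule \<Rightarrow> nat \<Rightarrow> 'v cochain \<Rightarrow> 'v cochain set" where
  "coh_class m n V p \<phi> = coh_rel m n V p `` {\<phi>}"

definition cohomology ::
  "nat \<Rightarrow> nat \<Rightarrow> ('v::ab_group_add) smodule \<Rightarrow> nat \<Rightarrow> 'v cochain set set" where
  "cohomology m n V p = cocycles m n V p // coh_rel m n V p"

text \<open>
  \<open>H\<^sup>p(g, V) \<cong> W\<close> as complex vector spaces, for a subspace \<open>W\<close> of \<open>\<complex>\<close>. The operations of the quotient
  \<open>H\<^sup>p(g, V)\<close> are given on representatives.
\<close>

definition cohomology_iso ::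
  "nat \<Rightarrow> nat \<Rightarrow> ('v::ab_group_add) smodule \<Rightarrow> nat \<Rightarrow> complex set \<Rightarrow> bool" where
  "cohomology_iso m n V p W \<longleftrightarrow>
     (\<exists>f. bij_betw f (cohomology m n V p) W \<and>
        (\<forall>\<phi>\<in>cocycles m n V p. \<forall>\<psi>\<in>cocycles m n V p.
           f (coh_class m n V p (\<lambda>xs. \<phi> xs + \<psi> xs)) =
             f (coh_class m n V p \<phi>) + f (coh_class m n V p \<psi>)) \<and>
        (\<forall>c. \<forall>\<phi>\<in>cocycles m n V p.
           f (coh_class m n V p (\<lambda>xs. scl V c (\<phi> xs))) = c * f (coh_class m n V p \<phi>)))"

end

theory Submission
  imports Defs "HOL-Library.Function_Algebras" "HOL-Library.Nat_Bijection"
begin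

text \<open>
  The Kac module is induced from \<open>p = g\<^sub>0 \<oplus> g\<^sub>+\<^sub>1\<close>, and being free over the Grassmann algebra
  \<open>U(g\<^sub>-\<^sub>1)\<close> it is also coinduced, from its \<open>g\<^sub>-\<^sub>1\<close>-invariants \<open>M\<close>: these form the irreducible
  \<open>g\<^sub>0\<close>-module of highest weight \<open>\<mu> = \<Lambda> - 2\<rho>\<^sub>1\<close>. A parity twist turns 1-cocycles into superderivations
  \<open>g \<rightarrow> V\<close> without reference to the parity of \<open>V\<close>. By exactness of the Koszul complex every derivation
  vanishes on \<open>g\<^sub>-\<^sub>1\<close> after subtracting an inner one; it then maps \<open>g\<^sub>0\<close> into \<open>M\<close>, and if it also vanishes
  on \<open>g\<^sub>0\<close>, it restricts to a \<open>g\<^sub>0\<close>-homomorphism \<open>g\<^sub>+\<^sub>1 \<rightarrow> M\<close>. Hence \<open>H\<^sup>1(g, V) = H\<^sup>1(g\<^sub>0, M) \<oplus> Hom(g\<^sub>+\<^sub>1, M)\<close>.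
  The first summand is killed by a Casimir operator unless \<open>\<mu> = 0\<close>, where it is the line of characters of
  \<open>g\<^sub>0\<close>; the second one is nonzero, and then a line, exactly if \<open>\<mu>\<close> is the highest weight \<open>\<alpha>\<^sub>m\<^sub>a\<^sub>x\<close> of \<open>g\<^sub>+\<^sub>1\<close>.
\<close>

section \<open>Block matrices and the superbracket\<close>

text \<open>The Kac module is given by generators and relations only, and without a PBW theorem it
  is not even known to be nonzero. The operators \<open>Op\<close> on the exterior algebra of g_-1
  tensored with L supply one: the relations hold for them, and the monomials that span the module
  become independent there. Afterwards a vector is recognised by its images under g_-1 and by its
  coefficient in the top exterior power, and this test replaces calculations with bases. A second
  obstacle is that the diagonal matrix units are not in sl, while all formulas are written in units;
  the projection \<open>pr\<close> lets them act nevertheless, for m = n as well, where the identity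
  matrix lies in sl. In the case m = n = 1 the root alpha_max vanishes on h, and both summands of
  the cohomology are lines for one and the same weight. For m > 1 at most one of them is
  nonzero.\<close>

locale block_dims =
  fixes m n :: nat
begin

abbreviation "N \<equiv> m + n"
abbreviation "E \<equiv> mat_unit m n"

definition blk :: "nat \<Rightarrow> int" where
  "blk a = (if a < m then 0 else 1)"

text \<open>Degrees range over all integers and the supertrace is left free, so that products and
  brackets stay homogeneous without case distinctions; degrees other than -1, 0, 1 contain only the
  zero matrix.\<close>

definition gdeg :: "int \<Rightarrow> complex mat set" where
  "gdeg d = {A \<in> carrier_mat N N. \<forall>i<N. \<forall>j<N. A $$ (i, j) \<noteq> 0 \<longrightarrow> blk j - blk i = d}"

text \<open>This is (-1)^(d e), written through parities because degrees may be negative.\<close>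

definition sg :: "int \<Rightarrow> int \<Rightarrow> complex" where
  "sg d e = (if odd d \<and> odd e then -1 else 1)"

text \<open>The degrees are arguments, since they cannot be read off from the matrices: the zero
  matrix has every degree.\<close>

definition brk :: "int \<Rightarrow> int \<Rightarrow> complex mat \<Rightarrow> complex mat \<Rightarrow> complex mat" where
  "brk d e A B = A * B - sg d e \<cdot>\<^sub>m (B * A)"

definition cut :: "int \<Rightarrow> complex mat \<Rightarrow> complex mat" where
  "cut d A = mat N N (\<lambda>(i, j). if blk j - blk i = d then A $$ (i, j) else 0)"

definition IX :: "int \<Rightarrow> (nat \<times> nat) set" where
  "IX d = {(a, b). a < N \<and> b < N \<and> blk b - blk a = d}"

lemma finite_IX [simp, intro]: "finite (IX d)"
  by (rule finite_subset[of _ "{..<N} \<times> {..<N}"]) (auto simp: IX_def)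

lemma sg_simps:
  "sg (d + e) f = sg d f * sg e f" "sg f (d + e) = sg f d * sg f e" "sg d e = sg e d"
  "sg d e * sg d e = 1" "sg 0 d = 1" "sg d 0 = 1"
  "sg (d - e) f = sg d f * sg e f" "sg f (d - e) = sg f d * sg f e" "sg (- d) e = sg d e" "sg d (- e) = sg d e"
  by (auto simp: sg_def)

lemma gdeg_carrier: "A \<in> gdeg d \<Longrightarrow> A \<in> carrier_mat N N"
  by (auto simp: gdeg_def)

lemma gdeg_dim [simp]: "A \<in> gdeg d \<Longrightarrow> dim_row A = N" "A \<in> gdeg d \<Longrightarrow> dim_col A = N"
  by (auto simp: gdeg_def)

lemma gdegD: "A \<in> gdeg d \<Longrightarrow> i < N \<Longrightarrow> j < N \<Longrightarrow> blk j - blk i \<noteq> d \<Longrightarrow> A $$ (i, j) = 0"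
  by (auto simp: gdeg_def)

lemma gdeg_zero [intro]: "0\<^sub>m N N \<in> gdeg d"
  by (auto simp: gdeg_def)

lemma gdegI:
  assumes "A \<in> carrier_mat N N"
    and "\<And>i j. i < N \<Longrightarrow> j < N \<Longrightarrow> blk j - blk i \<noteq> d \<Longrightarrow> A $$ (i, j) = 0"
  shows "A \<in> gdeg d"
  using assms unfolding gdeg_def by blast

lemma gdeg_add [intro]: "A \<in> gdeg d \<Longrightarrow> B \<in> gdeg d \<Longrightarrow> A + B \<in> gdeg d"
  by (rule gdegI) (auto simp: gdeg_carrier gdegD)

lemma gdeg_minus [intro]: "A \<in> gdeg d \<Longrightarrow> B \<in> gdeg d \<Longrightarrow> A - B \<in> gdeg d"
  by (rule gdegI) (auto simp: gdeg_carrier gdegD)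

lemma gdeg_smult [intro]: "A \<in> gdeg d \<Longrightarrow> c \<cdot>\<^sub>m A \<in> gdeg d"
  by (auto simp: gdeg_def)

lemma mult_index:
  "A \<in> carrier_mat N N \<Longrightarrow> B \<in> carrier_mat N N \<Longrightarrow> i < N \<Longrightarrow> j < N \<Longrightarrow>
     (A * B) $$ (i, j) = (\<Sum>k<N. A $$ (i, k) * B $$ (k, j))"
  by (auto simp: scalar_prod_def atLeast0LessThan)

lemma gdeg_mult [intro]:
  assumes "A \<in> gdeg d" "B \<in> gdeg e"
  shows "A * B \<in> gdeg (d + e)"
proof -
  have "blk j - blk i = d + e" if "i < N" "j < N" and nz: "(A * B) $$ (i, j) \<noteq> 0" for i j
  proof -
    have "(\<Sum>k<N. A $$ (i, k) * B $$ (k, j)) \<noteq> 0"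
      using nz that mult_index[OF assms[THEN gdeg_carrier], of i j] by (simp del: index_mult_mat)
    then obtain k where "k < N" "A $$ (i, k) * B $$ (k, j) \<noteq> 0"
      by (meson lessThan_iff sum.not_neutral_contains_not_neutral)
    then have "blk k - blk i = d" "blk j - blk k = e"
      using assms that by (auto dest: gdegD)
    then show ?thesis by simp
  qed
  then show ?thesis using assms by (intro gdegI) (auto simp: gdeg_carrier simp del: index_mult_mat(1))
qed

lemma gdeg_trivial: "A \<in> gdeg d \<Longrightarrow> d \<notin> {-1, 0, 1} \<Longrightarrow> A = 0\<^sub>m N N"
  by (rule eq_matI) (auto simp: gdeg_def blk_def split: if_splits)

lemma sl_carrier: "A \<in> sl m n \<Longrightarrow> A \<in> carrier_mat N N"
  by (simp add: sl_def)

lemma sl_zero_mat [intro]: "0\<^sub>m N N \<in> sl m n"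
  by (simp add: sl_def supertrace_def)

lemma sl_add [intro]: "A \<in> sl m n \<Longrightarrow> B \<in> sl m n \<Longrightarrow> A + B \<in> sl m n"
  by (auto simp add: sl_def supertrace_def sum.distrib distrib_left)

lemma sl_minus [intro]: "A \<in> sl m n \<Longrightarrow> B \<in> sl m n \<Longrightarrow> A - B \<in> sl m n"
  by (auto simp add: sl_def supertrace_def sum_subtractf right_diff_distrib)

lemma sl_smult [intro]: "A \<in> sl m n \<Longrightarrow> c \<cdot>\<^sub>m A \<in> sl m n"
  by (auto simp add: sl_def supertrace_def mult.left_commute simp flip: sum_distrib_left)

lemma gdeg_sl: "A \<in> gdeg d \<Longrightarrow> d \<noteq> 0 \<Longrightarrow> A \<in> sl m n"
  by (auto simp: gdeg_carrier gdegD sl_def supertrace_def intro!: sum.neutral)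

lemma brk_gdeg [intro]:
  assumes "A \<in> gdeg d" "B \<in> gdeg e"
  shows "brk d e A B \<in> gdeg (d + e)"
  using gdeg_mult[OF assms] gdeg_mult[OF assms(2,1)] by (auto simp: brk_def add.commute)

lemma brk_gdeg': "A \<in> gdeg d \<Longrightarrow> B \<in> gdeg e \<Longrightarrow> d + e = f \<Longrightarrow> brk d e A B \<in> gdeg f"
  using brk_gdeg by blast

lemma brk_sl [intro]:
  assumes A: "A \<in> gdeg d" and B: "B \<in> gdeg e"
  shows "brk d e A B \<in> sl m n"
proof (cases "d + e = 0")
  case False
  then show ?thesis using gdeg_sl[OF brk_gdeg[OF assms]] by simp
next
  case True
  \<comment> \<open>At a nonzero entry the signs of the diagonal positions a and b differ by (-1)^d,
    which is \<open>sg d e\<close> because e = -d.\<close>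
  have *: "(-1) ^ ipar m a * (A $$ (a, b) * B $$ (b, a)) =
      sg d e * ((-1) ^ ipar m b * (B $$ (b, a) * A $$ (a, b)))" if "a < N" "b < N" for a b
  proof (cases "A $$ (a, b) = 0")
    case False
    then have "blk b - blk a = d" using gdegD[OF A] that by blast
    then show ?thesis using arg_cong[OF True, of even] by (auto simp: blk_def ipar_def sg_def)
  qed simp
  have "(\<Sum>a<N. (-1) ^ ipar m a * (A * B) $$ (a, a)) =
      (\<Sum>a<N. \<Sum>b<N. (-1) ^ ipar m a * (A $$ (a, b) * B $$ (b, a)))"
    using A B by (simp add: mult_index gdeg_carrier sum_distrib_left del: index_mult_mat)
  also have "\<dots> = (\<Sum>a<N. \<Sum>b<N. sg d e * ((-1) ^ ipar m b * (B $$ (b, a) * A $$ (a, b))))"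
    by (intro sum.cong refl *) auto
  also have "\<dots> = (\<Sum>b<N. \<Sum>a<N. sg d e * ((-1) ^ ipar m b * (B $$ (b, a) * A $$ (a, b))))"
    by (rule sum.swap)
  also have "\<dots> = (\<Sum>a<N. (-1) ^ ipar m a * (sg d e \<cdot>\<^sub>m (B * A)) $$ (a, a))"
    using A B by (simp add: mult_index gdeg_carrier sum_distrib_left mult_ac del: index_mult_mat(1))
  finally show ?thesis
    using A B by (simp add: sl_def supertrace_def brk_def right_diff_distrib sum_subtractf
       del: index_mult_mat(1) index_smult_mat(1)) (auto simp: gdeg_def)
qed

lemmas mat_distrib =
  assoc_mult_mat[of _ N N _ N _ N] add_mult_distrib_mat[of _ N N _ _ N]
  mult_add_distrib_mat[of _ N N _ N] minus_mult_distrib_mat[of _ N N _ _ N]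
  mult_minus_distrib_mat[of _ N N _ N] mult_smult_distrib[of _ N N _ N]
  mult_smult_assoc_mat[of _ N N _ N] mult_carrier_mat[of _ N N _ N]

lemma jacobi:
  assumes "A \<in> gdeg d" "B \<in> gdeg e" "C \<in> gdeg f"
  shows "brk (d + e) f (brk d e A B) C =
    brk d (e + f) A (brk e f B C) - sg d e \<cdot>\<^sub>m brk e (d + f) B (brk d f A C)"
proof -
  note [simp] = assms(1)[THEN gdeg_carrier] assms(2)[THEN gdeg_carrier] assms(3)[THEN gdeg_carrier]
  have [simp]: "dim_row A = N" "dim_col A = N" "dim_row B = N" "dim_col B = N" "dim_row C = N" "dim_col C = N"
    using assms by auto
  show ?thesis
    unfolding brk_def
    by (simp add: mat_distrib)
      (rule eq_matI, auto simp: sg_def algebra_simps simp del: index_mult_mat(1))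
qed

lemma mat_part_gdeg:
  assumes "A \<in> gdeg d"
  shows "mat_part m b A = (if even (d + int b) then A else 0\<^sub>m N N)"
proof -
  have key: "(if even (ipar m i + ipar m j + b) then A $$ (i, j) else 0) =
      (if even (d + int b) then A $$ (i, j) else 0)" if "i < N" "j < N" for i j
  proof (cases "A $$ (i, j) = 0")
    case False
    then have "blk j - blk i = d" using gdegD[OF assms that] by blast
    then show ?thesis by (auto simp: blk_def ipar_def)
  qed simp
  show ?thesis
    by (rule eq_matI) (use assms key in \<open>simp_all add: mat_part_def split del: if_split\<close>, auto)
qed

lemma homog_gdeg: "A \<in> gdeg d \<Longrightarrow> mat_homog m (nat \<bar>d\<bar>) A"
  by (auto simp: mat_homog_def mat_part_gdeg even_nat_iff)

lemma sbracket_brk: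
  assumes "A \<in> gdeg d" "B \<in> gdeg e"
  shows "sbracket m A B = brk d e A B"
proof -
  note [simp] = assms[THEN gdeg_carrier]
  have part: "mat_part m 0 X = (if even d then X else 0\<^sub>m N N)"
    "mat_part m 1 X = (if odd d then X else 0\<^sub>m N N)"
    if "X \<in> gdeg d" for d X
    using mat_part_gdeg[OF that] by auto
  show ?thesis
    unfolding sbracket_def Let_def part[OF assms(1)] part[OF assms(2)] brk_def sg_def
    using assms by (auto intro!: eq_matI simp: left_mult_zero_mat[of _ N N] right_mult_zero_mat[of _ N N]
        simp del: index_mult_mat(1))
qed

lemma cut_gdeg [intro, simp]: "cut d A \<in> gdeg d"
  by (rule gdegI) (auto simp: cut_def)

lemma cut_sl [intro]: "A \<in> sl m n \<Longrightarrow> cut d A \<in> sl m n"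
  by (cases "d = 0") (auto simp: gdeg_sl, auto simp: cut_def sl_def supertrace_def)

lemma cut_sum: "A \<in> carrier_mat N N \<Longrightarrow> A = cut (-1) A + (cut 0 A + cut 1 A)"
  by (rule eq_matI) (auto simp: cut_def blk_def)

lemma unit_carrier [simp, intro]: "E a b \<in> carrier_mat N N"
  by (simp add: mat_unit_def)

lemma unit_dim [simp]: "dim_row (E a b) = N" "dim_col (E a b) = N"
  by (simp_all add: mat_unit_def)

lemma unit_index [simp]:
  "i < N \<Longrightarrow> j < N \<Longrightarrow> E a b $$ (i, j) = (if i = a \<and> j = b then 1 else 0)"
  by (simp add: mat_unit_def)

lemma unit_gdeg [intro]: "blk b - blk a = d \<Longrightarrow> E a b \<in> gdeg d"
  by (rule gdegI) auto

lemma mult_unit_index: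
  assumes "A \<in> carrier_mat N N" "i < N" "j < N" "a < N" "b < N"
  shows "(A * E a b) $$ (i, j) = (if j = b then A $$ (i, a) else 0)"
    "(E a b * A) $$ (i, j) = (if i = a then A $$ (b, j) else 0)"
proof -
  show "(A * E a b) $$ (i, j) = (if j = b then A $$ (i, a) else 0)"
    using assms by (subst mult_index) (simp_all add: if_distrib[of "\<lambda>x. _ * x"] cong: if_cong)
  show "(E a b * A) $$ (i, j) = (if i = a then A $$ (b, j) else 0)"
    using assms by (subst mult_index) (simp_all add: if_distrib[of "\<lambda>x. x * _"] cong: if_cong)
qed

lemma unit_mult_unit:
  assumes "a < N" "b < N" "c < N" "d < N"
  shows "E a b * E c d = (if b = c then E a d else 0\<^sub>m N N)"
  using assms by (intro eq_matI) (auto simp: mult_unit_index simp del: index_mult_mat(1))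

text \<open>Linearity is asked for in one degree only, and the scaling \<open>s\<close> is a
  parameter: the lemma is applied to values in V, in L, in the Grassmann model and in the complex
  numbers.\<close>

lemma mat_sum_units:
  assumes h: "\<And>A B. A \<in> gdeg d \<Longrightarrow> B \<in> gdeg d \<Longrightarrow> h (A + B) = h A + h B"
    and hc: "\<And>A c. A \<in> gdeg d \<Longrightarrow> h (c \<cdot>\<^sub>m A) = s c (h A)"
    and s0: "\<And>v. s 0 v = (0 :: 'v :: ab_group_add)"
    and A: "A \<in> gdeg d"
  shows "h A = (\<Sum>(a, b)\<in>IX d. s (A $$ (a, b)) (h (E a b)))"
proof -
  define res where "res F = mat N N (\<lambda>p. if p \<in> F then A $$ p else 0)" for F
  have res: "res F \<in> gdeg d" for F using A by (intro gdegI) (auto simp: res_def gdegD)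
  have "h (res F) = (\<Sum>(a, b)\<in>F. s (A $$ (a, b)) (h (E a b)))" if "finite F" "F \<subseteq> IX d" for F
    using that
  proof (induction F rule: finite_induct)
    case empty
    have "res {} = 0 \<cdot>\<^sub>m A" using A by (intro eq_matI) (auto simp: res_def)
    then show ?case using hc[OF A, of 0] s0 by simp
  next
    case (insert p F)
    obtain a b where p: "p = (a, b)" by force
    with insert have ab: "a < N" "b < N" "E a b \<in> gdeg d" by (auto simp: IX_def)
    have "res (insert p F) = A $$ (a, b) \<cdot>\<^sub>m E a b + res F"
      using insert p ab by (intro eq_matI) (auto simp: res_def)
    then show ?case using insert p ab by (simp add: h hc res gdeg_smult)
  qed
  from this[of "IX d"] have "h (res (IX d)) = (\<Sum>(a, b)\<in>IX d. s (A $$ (a, b)) (h (E a b)))" by simp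
  moreover have "res (IX d) = A" using A by (intro eq_matI) (auto simp: res_def IX_def gdegD)
  ultimately show ?thesis by simp
qed

end

section \<open>Creation and annihilation operators\<close>

text \<open>The sign of moving the factor k past the smaller factors of the monomial S. Only
  elements below k are counted, so S may be infinite.\<close>

definition sig :: "nat \<Rightarrow> nat set \<Rightarrow> 'l \<Rightarrow> 'l::ab_group_add" where
  "sig k S x = (if even (card {j \<in> S. j < k}) then x else - x)"

text \<open>A function f on sets stands for the sum of the monomials S with coefficients
  \<open>f S\<close>. Then \<open>theta k\<close> is left multiplication by the generator k, and
  \<open>del k\<close> is the contraction with it.\<close>

definition theta :: "nat \<Rightarrow> (nat set \<Rightarrow> 'l) \<Rightarrow> nat set \<Rightarrow> 'l::ab_group_add" where
  "theta k f = (\<lambda>S. if k \<in> S then sig k S (f (S - {k})) else 0)"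

definition del :: "nat \<Rightarrow> (nat set \<Rightarrow> 'l) \<Rightarrow> nat set \<Rightarrow> 'l::ab_group_add" where
  "del k f = (\<lambda>S. if k \<notin> S then sig k S (f (insert k S)) else 0)"

definition lift :: "('l \<Rightarrow> 'l) \<Rightarrow> (nat set \<Rightarrow> 'l) \<Rightarrow> nat set \<Rightarrow> 'l" where
  "lift a f = (\<lambda>S. a (f S))"

definition vac :: "'l \<Rightarrow> nat set \<Rightarrow> 'l::ab_group_add" where
  "vac l = (\<lambda>S. if S = {} then l else 0)"

lemma card_below_insert:
  fixes k l :: nat
  shows "k \<notin> S \<Longrightarrow> card {j \<in> insert k S. j < l} = card {j \<in> S. j < l} + (if k < l then 1 else 0)"
proof -
  assume "k \<notin> S"
  moreover have "{j \<in> insert k S. j < l} =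
      (if k < l then insert k {j \<in> S. j < l} else {j \<in> S. j < l})" by auto
  moreover have "finite {j \<in> S. j < l}" by (rule finite_subset[of _ "{..<l}"]) auto
  ultimately show ?thesis by simp
qed

lemma sig_insert: "k \<notin> S \<Longrightarrow> sig l (insert k S) x = (if k < l then - sig l S x else sig l S x)"
  by (simp add: sig_def card_below_insert del: insert_iff)

lemma sig_remove: "k \<in> S \<Longrightarrow> sig l (S - {k}) x = (if k < l then - sig l S x else sig l S x)"
  using sig_insert[of k "S - {k}" l x] by (auto simp: insert_absorb split: if_splits)

lemma sig_simps [simp]: "sig k S 0 = 0" "sig k S (- x) = - sig k S x" "sig k S (sig k S x) = x"
  by (auto simp: sig_def)

lemma sig_commute: "sig k S (sig l T x) = sig l T (sig k S x)"
  by (auto simp: sig_def)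

lemma theta_anticomm: "theta k (theta l f) = - theta l (theta k f)"
proof
  fix S
  consider "k = l" | "k < l" | "l < k" by linarith
  then show "theta k (theta l f) S = (- theta l (theta k f)) S"
    by cases (auto simp: theta_def sig_remove sig_commute[of k S l S] Diff_insert2[symmetric] insert_commute)
qed

text \<open>The canonical anticommutation relation. The commutators of \<open>Op\<close> with
  creation operators see the signs only through it and \<open>theta_anticomm\<close>.\<close>

lemma del_theta: "del k (theta l f) = (if k = l then f else 0) - theta l (del k f)"
proof
  fix S
  consider "k = l" | "k < l" | "l < k" by linarith
  then show "del k (theta l f) S = ((if k = l then f else 0) - theta l (del k f)) S"
    by cases (auto simp: del_def theta_def sig_insert sig_remove sig_commute[of k S l S] insert_absorb
      insert_Diff_if)
qed

lemma theta_add: "theta k (f + g) = theta k f + theta k g"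
  and del_add: "del k (f + g) = del k f + del k g"
  by (auto simp: theta_def del_def sig_def)

lemma theta_additive: "additive (theta k)" and del_additive: "additive (del k)"
  by (simp_all add: additive_def theta_add del_add)

lemmas theta_simps = theta_add additive.zero[OF theta_additive] additive.minus[OF theta_additive]
  additive.diff[OF theta_additive] additive.sum[OF theta_additive]
lemmas del_simps = del_add additive.zero[OF del_additive] additive.minus[OF del_additive]
  additive.diff[OF del_additive] additive.sum[OF del_additive]

lemma del_vac: "del k (vac l) = 0"
  by (auto simp: del_def vac_def)

lemma lift_additive: "additive a \<Longrightarrow> additive (lift a)"
  by (auto simp: additive_def lift_def)

lemma lift_theta: "additive a \<Longrightarrow> lift a (theta k f) = theta k (lift a f)"
  by (auto simp: lift_def theta_def sig_def additive.zero additive.minus)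

lemma lift_del: "additive a \<Longrightarrow> lift a (del k f) = del k (lift a f)"
  by (auto simp: lift_def del_def sig_def additive.zero additive.minus)

lemma vac_additive: "additive vac"
  by (auto simp: additive_def vac_def)

text \<open>A representation of the block diagonal part of gl rather than of sl: the formulas below
  refer to single units, and the diagonal ones have nonzero supertrace.\<close>

locale kac_model = block_dims m n + vector_space s
  for m n :: nat and s :: "complex \<Rightarrow> 'l::ab_group_add \<Rightarrow> 'l" +
  fixes em :: "nat \<Rightarrow> nat \<Rightarrow> 'l \<Rightarrow> 'l"
  assumes e_add: "\<And>a b u v. em a b (u + v) = em a b u + em a b v"
    and e_scale: "\<And>a b c v. em a b (s c v) = s c (em a b v)"
    and e_comm: "\<And>a b c d l. (a, b) \<in> IX 0 \<Longrightarrow> (c, d) \<in> IX 0 \<Longrightarrow>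
      em a b (em c d l) = em c d (em a b l) + (if b = c then em a d l else 0) - (if a = d then em c b l else 0)"
begin

definition fs :: "complex \<Rightarrow> (nat set \<Rightarrow> 'l) \<Rightarrow> nat set \<Rightarrow> 'l" where
  "fs c f = (\<lambda>S. s c (f S))"

sublocale fs: vector_space fs
  by standard (auto simp: fs_def scale_right_distrib scale_left_distrib)

abbreviation "th \<nu> i \<equiv> theta (prod_encode (\<nu>, i))"
abbreviation "dl \<nu> i \<equiv> del (prod_encode (\<nu>, i))"

text \<open>
  The creation operator of \<open>E\<^sub>\<nu>\<^sub>i \<in> g\<^sub>-\<^sub>1\<close> is indexed by the code of the pair \<open>(\<nu>, i)\<close>, so that the signs
  of the Grassmann algebra can refer to the order of the natural numbers.
\<close>

definition K :: "nat set" where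
  "K = prod_encode ` ({m..<N} \<times> {..<m})"

text \<open>The actual tensor product of the exterior algebra of g_-1 with L inside the type of all
  functions on sets of natural numbers.\<close>

definition X :: "(nat set \<Rightarrow> 'l) set" where
  "X = {f. \<forall>S. \<not> S \<subseteq> K \<longrightarrow> f S = 0}"

text \<open>
  The action of \<open>E\<^sub>a\<^sub>b\<close> on \<open>\<Lambda>(g\<^sub>-\<^sub>1) \<otimes> L\<close>. For \<open>a < m \<le> b\<close> it is the only operator that kills
  \<open>1 \<otimes> L\<close> and has the prescribed anticommutators with the creation operators.
\<close>

definition Op :: "nat \<Rightarrow> nat \<Rightarrow> (nat set \<Rightarrow> 'l) \<Rightarrow> nat set \<Rightarrow> 'l" where
  "Op a b f = (if a < m then
      if b < m then lift (em a b) f - (\<Sum>\<nu>\<in>{m..<N}. th \<nu> b (dl \<nu> a f))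
      else (\<Sum>j<m. lift (em a j) (dl b j f)) + (\<Sum>\<eta>\<in>{m..<N}. lift (em \<eta> b) (dl \<eta> a f))
        - (\<Sum>j<m. \<Sum>\<eta>\<in>{m..<N}. th \<eta> j (dl \<eta> a (dl b j f)))
    else if b < m then th a b f
    else lift (em a b) f + (\<Sum>i<m. th a i (dl b i f)))"

lemma e_additive: "additive (em a b)" by (simp add: additive_def e_add)

lemmas lift_e_simps = lift_theta[OF e_additive] lift_del[OF e_additive]
  additive.add[OF lift_additive[OF e_additive]] additive.zero[OF lift_additive[OF e_additive]]
  additive.minus[OF lift_additive[OF e_additive]] additive.diff[OF lift_additive[OF e_additive]]
  additive.sum[OF lift_additive[OF e_additive]]

lemma fs_theta: "theta k (fs c f) = fs c (theta k f)"
  and fs_del: "del k (fs c f) = fs c (del k f)"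
  and fs_lift_e: "lift (em a b) (fs c f) = fs c (lift (em a b) f)"
  by (auto simp: theta_def del_def fs_def sig_def lift_def e_scale)

lemma Op_add: "Op a b (f + g) = Op a b f + Op a b g"
  by (simp add: Op_def theta_simps del_simps lift_e_simps sum.distrib sum_subtractf algebra_simps)

lemma Op_fs: "Op a b (fs c f) = fs c (Op a b f)"
  by (simp add: Op_def fs_theta fs_del fs_lift_e fs.scale_sum_right fs.scale_right_distrib
     fs.scale_right_diff_distrib)

text \<open>Compare the bracket of E_ab and E_\<nu>i, which is -E_\<nu>b for a = i and zero
  otherwise; the annihilation operators in \<open>Op a b\<close> produce exactly this term.\<close>

lemma Op_theta_00:
  assumes "a < m" "b < m" "m \<le> \<nu>" "\<nu> < N" "i < m"
  shows "Op a b (th \<nu> i f) = th \<nu> i (Op a b f) - (if a = i then th \<nu> b f else 0)"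
proof -
  have "th \<nu>' b (dl \<nu>' a (th \<nu> i f)) = (if \<nu>' = \<nu> then if a = i then th \<nu> b f else 0 else 0)
     + th \<nu> i (th \<nu>' b (dl \<nu>' a f))" for \<nu>'
    using theta_anticomm[of "prod_encode (\<nu>', b)" "prod_encode (\<nu>, i)" "dl \<nu>' a f"]
    by (simp add: del_theta theta_simps)
  then show ?thesis using assms
    by (simp add: Op_def theta_simps lift_e_simps sum.distrib)
qed

lemma Op_theta_11:
  assumes "m \<le> a" "m \<le> b" "m \<le> \<nu>" "\<nu> < N" "i < m"
  shows "Op a b (th \<nu> i f) = th \<nu> i (Op a b f) + (if b = \<nu> then th a i f else 0)"
proof -
  have "th a j (dl b j (th \<nu> i f)) = (if j = i then if b = \<nu> then th a i f else 0 else 0)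
     + th \<nu> i (th a j (dl b j f))" for j
    using theta_anticomm[of "prod_encode (a, j)" "prod_encode (\<nu>, i)" "dl b j f"]
    by (simp add: del_theta theta_simps)
  then show ?thesis using assms
    by (simp add: Op_def theta_simps lift_e_simps sum.distrib)
qed

text \<open>This identity dictates the shape of \<open>Op a b\<close> for a < m \<le> b: the two
  sums linear in \<open>del\<close> give the parts of \<open>Op a i\<close> and
  \<open>Op \<nu> b\<close> that act on L, and the cubic sum gives their Grassmann parts.\<close>

lemma Op_theta_01:
  assumes "a < m" "m \<le> b" "b < N" "m \<le> \<nu>" "\<nu> < N" "i < m"
  shows "Op a b (th \<nu> i f) = (if b = \<nu> then Op a i f else 0) + (if a = i then Op \<nu> b f else 0)
    - th \<nu> i (Op a b f)"
proof -
  have 1: "lift (em a j) (dl b j (th \<nu> i f)) = (if j = i then if b = \<nu> then lift (em a i) f else 0 else 0)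
     - th \<nu> i (lift (em a j) (dl b j f))" for j
    by (simp add: del_theta theta_simps lift_e_simps)
  have 2: "lift (em \<eta> b) (dl \<eta> a (th \<nu> i f)) = (if \<eta> = \<nu> then if a = i then lift (em \<nu> b) f else 0 else 0)
     - th \<nu> i (lift (em \<eta> b) (dl \<eta> a f))" for \<eta>
    by (simp add: del_theta theta_simps lift_e_simps)
  have 3: "th \<eta> j (dl \<eta> a (dl b j (th \<nu> i f))) = (if j = i then if b = \<nu> then th \<eta> i (dl \<eta> a f) else 0 else 0)
     - (if \<eta> = \<nu> then if a = i then th \<nu> j (dl b j f) else 0 else 0) - th \<nu> i (th \<eta> j (dl \<eta> a (dl b j f)))" for \<eta> j
    using theta_anticomm[of "prod_encode (\<eta>, j)" "prod_encode (\<nu>, i)" "dl \<eta> a (dl b j f)"]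
    by (simp add: del_theta theta_simps del_simps)
  have 4: "(\<Sum>j<m. \<Sum>\<eta>\<in>{m..<N}. if j = i then G \<eta> else 0) = (\<Sum>\<eta>\<in>{m..<N}. G \<eta>)"
    for G :: "nat \<Rightarrow> nat set \<Rightarrow> 'l"
    using assms by (subst sum.swap) simp
  show ?thesis using assms
    by (auto simp add: Op_def 1 2 3 4 theta_simps sum.distrib sum_subtractf algebra_simps)
qed

lemma lift_vac: "lift (em a b) (vac l) = vac (em a b l)"
  using additive.zero[OF e_additive] by (auto simp: lift_def vac_def)

lemma Op_vac: "(a, b) \<in> IX 0 \<Longrightarrow> Op a b (vac l) = vac (em a b l)"
  "a < m \<Longrightarrow> m \<le> b \<Longrightarrow> Op a b (vac l) = 0"
  by (auto simp: Op_def IX_def blk_def del_vac theta_simps del_simps lift_e_simps lift_vac split: if_splits)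

end

section \<open>The Grassmann model of the Kac module\<close>

context block_dims begin

lemma lin_ext:
  assumes h: "\<And>A B. A \<in> gdeg d \<Longrightarrow> B \<in> gdeg d \<Longrightarrow> h (A + B) = h A + h B"
    and hc: "\<And>A c. A \<in> gdeg d \<Longrightarrow> h (c \<cdot>\<^sub>m A) = s c (h A)"
    and g: "\<And>A B. A \<in> gdeg d \<Longrightarrow> B \<in> gdeg d \<Longrightarrow> g (A + B) = g A + g B"
    and gc: "\<And>A c. A \<in> gdeg d \<Longrightarrow> g (c \<cdot>\<^sub>m A) = s c (g A)"
    and s0: "\<And>v. s 0 v = (0 :: 'v :: ab_group_add)"
    and eq: "\<And>a b. (a, b) \<in> IX d \<Longrightarrow> h (E a b) = g (E a b)"
    and A: "A \<in> gdeg d"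
  shows "h A = g A"
proof -
  have "h A = (\<Sum>(a, b)\<in>IX d. s (A $$ (a, b)) (h (E a b)))"
    by (rule mat_sum_units[of d h s, OF h hc s0 A])
  also have "\<dots> = (\<Sum>(a, b)\<in>IX d. s (A $$ (a, b)) (g (E a b)))"
    by (intro sum.cong) (auto simp: eq)
  also have "\<dots> = g A"
    by (rule mat_sum_units[of d g s, OF g gc s0 A, symmetric])
  finally show ?thesis .
qed

lemma brk_antisym:
  assumes "A \<in> gdeg d" "B \<in> gdeg e"
  shows "brk d e A B = - sg d e \<cdot>\<^sub>m brk e d B A"
  using assms by (intro eq_matI) (auto simp: brk_def sg_def simp del: index_mult_mat(1))

lemma brk_add_left: "A \<in> gdeg d \<Longrightarrow> A' \<in> gdeg d \<Longrightarrow> B \<in> gdeg e \<Longrightarrow>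
    brk d e (A + A') B = brk d e A B + brk d e A' B"
  using gdeg_carrier[of A d] gdeg_carrier[of A' d] gdeg_carrier[of B e]
  by (intro eq_matI) (auto simp: brk_def mat_distrib algebra_simps simp del: index_mult_mat(1))

lemma brk_add_right: "A \<in> gdeg d \<Longrightarrow> B \<in> gdeg e \<Longrightarrow> B' \<in> gdeg e \<Longrightarrow>
    brk d e A (B + B') = brk d e A B + brk d e A B'"
  using gdeg_carrier[of A d] gdeg_carrier[of B' e] gdeg_carrier[of B e]
  by (intro eq_matI) (auto simp: brk_def mat_distrib algebra_simps simp del: index_mult_mat(1))

lemma brk_smult_left: "A \<in> gdeg d \<Longrightarrow> B \<in> gdeg e \<Longrightarrow> brk d e (c \<cdot>\<^sub>m A) B = c \<cdot>\<^sub>m brk d e A B"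
  using gdeg_carrier[of A d] gdeg_carrier[of B e]
  by (intro eq_matI) (auto simp: brk_def mat_distrib algebra_simps simp del: index_mult_mat(1))

lemma brk_smult_right: "A \<in> gdeg d \<Longrightarrow> B \<in> gdeg e \<Longrightarrow> brk d e A (c \<cdot>\<^sub>m B) = c \<cdot>\<^sub>m brk d e A B"
  using gdeg_carrier[of A d] gdeg_carrier[of B e]
  by (intro eq_matI) (auto simp: brk_def mat_distrib algebra_simps simp del: index_mult_mat(1))

lemma brk_units:
  assumes "a < N" "b < N" "c < N" "c' < N"
  shows "brk d e (E a b) (E c c') =
    (if b = c then E a c' else 0\<^sub>m N N) - sg d e \<cdot>\<^sub>m (if c' = a then E c b else 0\<^sub>m N N)"
  using assms by (simp add: brk_def unit_mult_unit)

end

context kac_model begin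

text \<open>Defined by coordinates for all square matrices; the bracket relation is proved for gl,
  but only on vectors of \<open>X\<close>.\<close>

definition rho :: "complex mat \<Rightarrow> (nat set \<Rightarrow> 'l) \<Rightarrow> nat set \<Rightarrow> 'l" where
  "rho A f = (\<Sum>(a, b)\<in>{..<N} \<times> {..<N}. fs (A $$ (a, b)) (Op a b f))"

lemma rho_additive: "additive (rho A)"
  by (simp add: additive_def rho_def Op_add fs.scale_right_distrib sum.distrib split_def)

lemmas rho_simps = additive.add[OF rho_additive] additive.zero[OF rho_additive]
  additive.minus[OF rho_additive] additive.diff[OF rho_additive] additive.sum[OF rho_additive]

lemma rho_fs: "rho A (fs c f) = fs c (rho A f)"
  by (simp add: rho_def Op_fs fs.scale_sum_right split_def mult.commute)

lemma rho_mat_add: "A \<in> carrier_mat N N \<Longrightarrow> B \<in> carrier_mat N N \<Longrightarrow> rho (A + B) f = rho A f + rho B f"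
  by (simp add: rho_def fs.scale_left_distrib sum.distrib split_def flip: sum.distrib cong: sum.cong)
    (auto simp: fs.scale_left_distrib sum.distrib[symmetric] intro!: sum.cong)

lemma rho_mat_smult: "A \<in> carrier_mat N N \<Longrightarrow> rho (c \<cdot>\<^sub>m A) f = fs c (rho A f)"
  unfolding rho_def fs.scale_sum_right by (auto intro!: sum.cong)

lemma rho_mat_diff:
  assumes "A \<in> carrier_mat N N" "B \<in> carrier_mat N N"
  shows "rho (A - B) f = rho A f - rho B f"
proof -
  have "A - B = A + (-1) \<cdot>\<^sub>m B" using assms by (intro eq_matI) auto
  then show ?thesis using assms by (simp add: rho_mat_add rho_mat_smult)
qed

lemma rho_mat_zero [simp]: "rho (0\<^sub>m N N) f = 0"
  by (auto simp: rho_def intro!: sum.neutral)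

lemma rho_unit: "a < N \<Longrightarrow> b < N \<Longrightarrow> rho (E a b) f = Op a b f"
proof -
  assume *: "a < N" "b < N"
  have "rho (E a b) f = (\<Sum>p\<in>{..<N} \<times> {..<N}. if p = (a, b) then Op a b f else 0)"
    unfolding rho_def by (rule sum.cong) auto
  then show ?thesis using * by simp
qed

lemma rho_theta: "m \<le> \<nu> \<Longrightarrow> \<nu> < N \<Longrightarrow> i < m \<Longrightarrow> rho (E \<nu> i) f = th \<nu> i f"
  by (simp add: rho_unit Op_def)

text \<open>The relation is stated at a single vector, because it is proved by induction on the
  vector.\<close>

definition bracket_at :: "int \<Rightarrow> int \<Rightarrow> complex mat \<Rightarrow> complex mat \<Rightarrow> (nat set \<Rightarrow> 'l) \<Rightarrow> bool" where
  "bracket_at d e A B f \<longleftrightarrow> rho A (rho B f) = fs (sg d e) (rho B (rho A f)) + rho (brk d e A B) f"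

lemma bracket_at_sym:
  assumes "A \<in> gdeg d" "B \<in> gdeg e" "bracket_at d e A B f"
  shows "bracket_at e d B A f"
proof -
  have "rho (brk e d B A) f = - fs (sg e d) (rho (brk d e A B) f)"
    using assms by (simp add: brk_antisym[of B e A d] rho_mat_smult[OF gdeg_carrier[OF brk_gdeg]])
  then show ?thesis using assms(3)
    by (simp add: bracket_at_def fs.scale_right_distrib sg_simps)
qed

lemma bracket_at_ext:
  assumes u: "\<And>a b c c'. (a, b) \<in> IX d \<Longrightarrow> (c, c') \<in> IX d' \<Longrightarrow> bracket_at d d' (E a b) (E c c') f"
    and A: "A \<in> gdeg d" and B: "B \<in> gdeg d'"
  shows "bracket_at d d' A B f"
  unfolding bracket_at_def
proof (rule lin_ext[of d' _ fs, OF _ _ _ _ _ _ B])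
  fix c c' assume cc: "(c, c') \<in> IX d'"
  then have U: "E c c' \<in> gdeg d'" by (auto simp: IX_def)
  show "rho A (rho (E c c') f) = fs (sg d d') (rho (E c c') (rho A f)) + rho (brk d d' A (E c c')) f"
  proof (rule lin_ext[of d _ fs, OF _ _ _ _ _ _ A])
    fix a b assume "(a, b) \<in> IX d"
    from u[OF this cc] show "rho (E a b) (rho (E c c') f) =
      fs (sg d d') (rho (E c c') (rho (E a b) f)) + rho (brk d d' (E a b) (E c c')) f"
      by (simp add: bracket_at_def)
  qed (simp_all add: rho_mat_add gdeg_carrier rho_mat_smult rho_simps rho_fs brk_add_left[OF _ _ U]
      brk_smult_left[OF _ U] gdeg_carrier[OF brk_gdeg[OF _ U]] fs.scale_right_distrib mult.commute
      del: plus_fun_apply)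
qed (simp_all add: rho_mat_add gdeg_carrier rho_mat_smult rho_simps rho_fs brk_add_right[OF A]
      brk_smult_right[OF A] gdeg_carrier[OF brk_gdeg[OF A]] fs.scale_right_distrib mult.commute
      del: plus_fun_apply)

text \<open>The four cases are the four blocks of the matrix. No induction on f enters: with
  E_\<nu>i acting as a creation operator this is what \<open>Op\<close> was made for.\<close>

lemma bracket_at_units:
  assumes ab: "(a, b) \<in> IX d" and c: "m \<le> \<nu>" "\<nu> < N" "i < m"
  shows "bracket_at d (-1) (E a b) (E \<nu> i) f"
proof -
  have ab': "a < N" "b < N" and d: "d = blk b - blk a" using ab by (auto simp: IX_def)
  have "rho (brk d (-1) (E a b) (E \<nu> i)) f =
      (if b = \<nu> then Op a i f else 0) - fs (sg d (-1)) (if i = a then Op \<nu> b f else 0)"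
    using ab' c by (auto simp: brk_units rho_mat_diff rho_mat_smult rho_unit)
  moreover consider "a < m" "b < m" | "m \<le> a" "m \<le> b" | "a < m" "m \<le> b" | "m \<le> a" "b < m" by linarith
  then have "Op a b (th \<nu> i f) = fs (sg d (-1)) (th \<nu> i (Op a b f)) +
      ((if b = \<nu> then Op a i f else 0) - fs (sg d (-1)) (if i = a then Op \<nu> b f else 0))"
  proof cases
    case 1
    then show ?thesis using ab' c by (auto simp: Op_theta_00 d blk_def sg_def) (auto simp: Op_def)
  next
    case 2
    then show ?thesis using ab' c by (auto simp: Op_theta_11 d blk_def sg_def) (auto simp: Op_def)
  next
    case 3
    then show ?thesis using ab' c by (auto simp: Op_theta_01 d blk_def sg_def)
  next
    case 4
    then show ?thesis using ab' c theta_anticomm[of "prod_encode (a, b)" "prod_encode (\<nu>, i)" f]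
      by (auto simp: d blk_def sg_def Op_def)
  qed
  ultimately show ?thesis using ab' c by (simp add: bracket_at_def rho_unit rho_theta Op_def)
qed

lemma bracket_at_minus1: "A \<in> gdeg d \<Longrightarrow> B \<in> gdeg (-1) \<Longrightarrow> bracket_at d (-1) A B f"
  by (rule bracket_at_ext) (auto intro!: bracket_at_units simp: IX_def blk_def split: if_splits)

lemma finite_K: "finite K" by (simp add: K_def)

lemma K_E: "k \<in> K \<Longrightarrow> (\<And>\<nu> i. m \<le> \<nu> \<Longrightarrow> \<nu> < N \<Longrightarrow> i < m \<Longrightarrow> k = prod_encode (\<nu>, i) \<Longrightarrow> P) \<Longrightarrow> P"
  by (auto simp: K_def)

lemma X_induct [consumes 1, case_names vac add theta]:
  assumes f: "f \<in> X"
    and vac: "\<And>l. P (vac l)"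
    and add: "\<And>f g. P f \<Longrightarrow> P g \<Longrightarrow> P (f + g)"
    and theta: "\<And>k f. k \<in> K \<Longrightarrow> P f \<Longrightarrow> P (theta k f)"
  shows "P f"
proof -
  define pt :: "nat set \<Rightarrow> 'l \<Rightarrow> nat set \<Rightarrow> 'l" where "pt T l = (\<lambda>S. if S = T then l else 0)" for T l
  have pt: "P (pt T l)" if "finite T" "T \<subseteq> K" for T l
    using that
  proof (induction T arbitrary: l rule: finite_induct)
    case empty
    show ?case using vac[of l] by (simp add: pt_def vac_def)
  next
    case (insert k T)
    \<comment> \<open>The sign is put into the coefficient, where it cancels the one of
      \<open>theta k\<close>.\<close>
    have "pt (insert k T) l = theta k (pt T (sig k (insert k T) l))"
      using insert.hyps by (auto simp: pt_def theta_def)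
    then show ?case using insert theta by auto
  qed
  have sum: "P (\<Sum>T\<in>F. pt T (f T))" if "finite F" "F \<subseteq> Pow K" for F
    using that
  proof (induction F rule: finite_induct)
    case empty
    have "vac 0 = (0 :: nat set \<Rightarrow> 'l)" by (auto simp: vac_def)
    then show ?case using vac[of 0] by (simp del: zero_fun_apply)
  next
    case (insert T F)
    then show ?case using finite_subset[OF _ finite_K] by (auto intro!: add pt simp del: plus_fun_apply)
  qed
  have "(\<Sum>T\<in>F. pt T (f T)) S = (if S \<in> F then f S else 0)" if "finite F" for F S
    using that by (induction F rule: finite_induct) (auto simp: pt_def)
  then have "f = (\<Sum>T\<in>Pow K. pt T (f T))"
    using f finite_K by (intro ext) (auto simp: X_def)
  then show ?thesis using sum[of "Pow K"] finite_K by simp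
qed

lemma X_zero: "0 \<in> X" and X_add: "f \<in> X \<Longrightarrow> g \<in> X \<Longrightarrow> f + g \<in> X"
  and X_diff: "f \<in> X \<Longrightarrow> g \<in> X \<Longrightarrow> f - g \<in> X"
  and X_fs: "f \<in> X \<Longrightarrow> fs c f \<in> X" and X_vac: "vac l \<in> X"
  and X_theta: "k \<in> K \<Longrightarrow> f \<in> X \<Longrightarrow> theta k f \<in> X"
  and X_del: "k \<in> K \<Longrightarrow> f \<in> X \<Longrightarrow> del k f \<in> X"
  and X_lift: "f \<in> X \<Longrightarrow> lift (em a b) f \<in> X"
  using additive.zero[OF e_additive]
  by (auto simp: X_def fs_def vac_def theta_def del_def lift_def sig_def) (metis insert_Diff insert_subset)+

lemma X_sum: "(\<And>i. i \<in> I \<Longrightarrow> f i \<in> X) \<Longrightarrow> sum f I \<in> X"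
  by (induction I rule: infinite_finite_induct) (auto intro: X_zero X_add)

lemma X_Op: "a < N \<Longrightarrow> b < N \<Longrightarrow> f \<in> X \<Longrightarrow> Op a b f \<in> X"
  by (auto simp: Op_def K_def intro!: X_add X_diff X_sum X_lift X_theta X_del)

lemma X_rho: "f \<in> X \<Longrightarrow> rho A f \<in> X"
  by (auto simp: rho_def intro!: X_sum X_fs X_Op)

text \<open>
  The defect \<open>[\<rho>(A), \<rho>(B)] - \<rho>([A, B])\<close> supercommutes with the creation operators, by the Jacobi identity and
  the relations in lower degree. As these generate the model from \<open>1 \<otimes> L\<close>, the defect only has to vanish there.
\<close>

lemma bracket_at_step:
  assumes r1: "\<And>A B f. A \<in> gdeg d \<Longrightarrow> B \<in> gdeg (e - 1) \<Longrightarrow> f \<in> X \<Longrightarrow> bracket_at d (e - 1) A B f"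
    and r2: "\<And>A B f. A \<in> gdeg (d - 1) \<Longrightarrow> B \<in> gdeg e \<Longrightarrow> f \<in> X \<Longrightarrow> bracket_at (d - 1) e A B f"
    and rv: "\<And>l. bracket_at d e A B (vac l)"
    and A: "A \<in> gdeg d" and B: "B \<in> gdeg e" and f: "f \<in> X"
  shows "bracket_at d e A B f"
proof -
  have "f \<in> X \<and> bracket_at d e A B f"
    using f
  proof (induction f rule: X_induct)
    case (vac l)
    show ?case using rv X_vac by simp
  next
    case (add f g)
    then show ?case by (simp add: bracket_at_def X_add rho_simps fs.scale_right_distrib del: plus_fun_apply)
  next
    case (theta k f)
    then obtain \<nu> i where c: "m \<le> \<nu>" "\<nu> < N" "i < m" and k: "k = prod_encode (\<nu>, i)"
      using K_E by metis
    define Y where "Y = E \<nu> i"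
    have Y: "Y \<in> gdeg (-1)" using c by (auto simp: Y_def blk_def)
    have th: "theta k g = rho Y g" for g using c k by (simp add: Y_def rho_theta)
    have fX: "f \<in> X" and IH: "bracket_at d e A B f" using theta by auto
    define AY where "AY = brk d (-1) A Y"
    define BY where "BY = brk e (-1) B Y"
    define AB where "AB = brk d e A B"
    define J where "J = rho (brk e (d - 1) B AY) f"
    have AY: "AY \<in> gdeg (d - 1)" and BY: "BY \<in> gdeg (e - 1)" and AB: "AB \<in> gdeg (d + e)"
      using A B Y by (auto simp: AY_def BY_def AB_def intro!: brk_gdeg')
    have "brk (d + e) (-1) AB Y = brk d (e - 1) A BY - sg d e \<cdot>\<^sub>m brk e (d - 1) B AY"
      using jacobi[OF A B Y] by (simp add: AY_def BY_def AB_def)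
    then have ad: "rho (brk d (e - 1) A BY) f = rho (brk (d + e) (-1) AB Y) f + fs (sg d e) J"
      using gdeg_carrier[OF brk_gdeg[OF A BY]] gdeg_carrier[OF brk_gdeg[OF B AY]]
      by (simp add: rho_mat_diff rho_mat_smult J_def)
    have da: "rho (brk (d - 1) e AY B) f = - fs (sg d e * sg (-1) e) J"
      unfolding brk_antisym[OF AY B] J_def
      by (simp add: rho_mat_smult gdeg_carrier[OF brk_gdeg[OF B AY]] sg_simps)
    \<comment> \<open>Used as rewrite rules, these move Y to the left and A behind B. For each
      parity of d and e both sides then reduce to the same expression.\<close>
    have eqs: "rho A (rho B f) = fs (sg d e) (rho B (rho A f)) + rho AB f"
      "rho B (rho Y f) = fs (sg e (-1)) (rho Y (rho B f)) + rho BY f"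
      "rho A (rho Y f) = fs (sg d (-1)) (rho Y (rho A f)) + rho AY f"
      "rho A (rho Y (rho B f)) = fs (sg d (-1)) (rho Y (rho A (rho B f))) + rho AY (rho B f)"
      "rho B (rho Y (rho A f)) = fs (sg e (-1)) (rho Y (rho B (rho A f))) + rho BY (rho A f)"
      "rho AB (rho Y f) = fs (sg d (-1) * sg e (-1)) (rho Y (rho AB f)) + rho (brk (d + e) (-1) AB Y) f"
      "rho A (rho BY f) = fs (sg d e * sg d (-1)) (rho BY (rho A f)) + rho (brk (d + e) (-1) AB Y) f + fs (sg d e) J"
      "rho AY (rho B f) = fs (sg d e * sg (-1) e) (rho B (rho AY f)) - fs (sg d e * sg (-1) e) J"
      using IH bracket_at_minus1[OF A Y] bracket_at_minus1[OF B Y] bracket_at_minus1[OF AB Y] r1[OF A BY fX] r2[OF AY B fX] ad da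
      by (simp_all add: bracket_at_def AB_def AY_def BY_def sg_simps)
    have "bracket_at d e A B (rho Y f)"
      unfolding bracket_at_def AB_def[symmetric]
      by (cases "even d"; cases "even e")
        (simp_all add: eqs rho_simps rho_fs sg_def fs.scale_right_distrib fs.scale_right_diff_distrib)
    then show ?case using fX X_theta theta.hyps by (simp add: th flip: th)
  qed
  then show ?thesis by simp
qed

end

context kac_model begin

definition lev :: "complex mat \<Rightarrow> 'l \<Rightarrow> 'l" where
  "lev A l = (\<Sum>(a, b)\<in>IX 0. s (A $$ (a, b)) (em a b l))"

lemma rho_gdeg:
  assumes "A \<in> gdeg d"
  shows "rho A f = (\<Sum>(a, b)\<in>IX d. fs (A $$ (a, b)) (Op a b f))"
  unfolding rho_def using gdegD[OF assms]
  by (intro sum.mono_neutral_right) (auto simp: IX_def)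

lemma fs_vac: "fs c (vac l) = vac (s c l)"
  by (auto simp: fs_def vac_def)

lemma rho_vac_0: "A \<in> gdeg 0 \<Longrightarrow> rho A (vac l) = vac (lev A l)"
  unfolding lev_def additive.sum[OF vac_additive]
  by (simp add: rho_gdeg) (auto intro!: sum.cong simp: Op_vac fs_vac)

lemma rho_vac_1: "A \<in> gdeg 1 \<Longrightarrow> rho A (vac l) = 0"
  by (auto intro!: sum.neutral simp: rho_gdeg Op_vac IX_def blk_def split: if_splits)

lemma bracket_at_vac_00: "A \<in> gdeg 0 \<Longrightarrow> B \<in> gdeg 0 \<Longrightarrow> bracket_at 0 0 A B (vac l)"
proof (rule bracket_at_ext)
  fix a b c d assume ab: "(a, b) \<in> IX 0" and cd: "(c, d) \<in> IX 0"
  then have lt: "a < N" "b < N" "c < N" "d < N" and "b = c \<Longrightarrow> (a, d) \<in> IX 0" "a = d \<Longrightarrow> (c, b) \<in> IX 0"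
    by (auto simp: IX_def)
  then have "rho (brk 0 0 (E a b) (E c d)) (vac l) =
     (if b = c then vac (em a d l) else 0) - (if a = d then vac (em c b l) else 0)"
    by (auto simp: brk_units rho_mat_diff rho_mat_smult rho_unit Op_vac sg_def)
  then show "bracket_at 0 0 (E a b) (E c d) (vac l)"
    using lt ab cd e_comm[OF ab cd, of l] additive.zero[OF vac_additive]
    by (auto simp: bracket_at_def rho_unit Op_vac sg_def additive.add[OF vac_additive] additive.diff[OF vac_additive])
qed

lemma bracket_at_vac_10: "A \<in> gdeg 1 \<Longrightarrow> B \<in> gdeg 0 \<Longrightarrow> bracket_at 1 0 A B (vac l)"
  using brk_gdeg[of A 1 B 0] by (simp add: bracket_at_def rho_vac_0 rho_vac_1 rho_simps)

lemma bracket_at_vac_11: "A \<in> gdeg 1 \<Longrightarrow> B \<in> gdeg 1 \<Longrightarrow> bracket_at 1 1 A B (vac l)"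
  using gdeg_trivial[OF brk_gdeg[of A 1 B 1]] by (simp add: bracket_at_def rho_vac_1 rho_simps)

lemma rho_bracket:
  assumes A: "A \<in> gdeg d" and B: "B \<in> gdeg e" and f: "f \<in> X"
  shows "bracket_at d e A B f"
proof -
  have m0: "bracket_at (-1) e A B f" if "A \<in> gdeg (-1)" "B \<in> gdeg e" for A B e f
    using bracket_at_minus1[OF that(2,1)] bracket_at_sym that by blast
  \<comment> \<open>Each case calls those with one degree lowered by one, hence the order (0,0),
    (1,0), (0,1), (1,1); where one degree is -1 the relation is already known.\<close>
  have r00: "bracket_at 0 0 A B f" if "A \<in> gdeg 0" "B \<in> gdeg 0" "f \<in> X" for A B f
    by (rule bracket_at_step[OF _ _ _ that]) (use that in \<open>auto intro: bracket_at_minus1 m0 bracket_at_vac_00\<close>)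
  have r10: "bracket_at 1 0 A B f" if "A \<in> gdeg 1" "B \<in> gdeg 0" "f \<in> X" for A B f
    by (rule bracket_at_step[OF _ _ _ that]) (use that in \<open>auto intro: bracket_at_minus1 r00 bracket_at_vac_10\<close>)
  have r01: "bracket_at 0 1 A B f" if "A \<in> gdeg 0" "B \<in> gdeg 1" "f \<in> X" for A B f
    using that r10 bracket_at_sym by blast
  have r11: "bracket_at 1 1 A B f" if "A \<in> gdeg 1" "B \<in> gdeg 1" "f \<in> X" for A B f
    by (rule bracket_at_step[OF _ _ _ that]) (use that in \<open>auto intro: r01 r10 bracket_at_vac_11\<close>)
  have z: "bracket_at d e A B f" if "A = 0\<^sub>m N N \<or> B = 0\<^sub>m N N" "A \<in> gdeg d" "B \<in> gdeg e" for A B d e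
  proof -
    have "brk d e A B = 0\<^sub>m N N"
      using that by (intro eq_matI) (auto simp: brk_def left_mult_zero_mat[OF gdeg_carrier]
          right_mult_zero_mat[OF gdeg_carrier] simp del: index_mult_mat(1))
    then show ?thesis using that by (auto simp: bracket_at_def rho_simps)
  qed
  show ?thesis
  proof (cases "d \<in> {-1, 0, 1} \<and> e \<in> {-1, 0, 1}")
    case False
    then show ?thesis using gdeg_trivial[OF A] gdeg_trivial[OF B] z A B by blast
  next
    case True
    then consider "d = -1" | "e = -1" | "d = 0" "e = 0" | "d = 0" "e = 1" | "d = 1" "e = 0" | "d = 1" "e = 1"
      by auto
    then show ?thesis
    proof cases
      case 1 with A B m0 show ?thesis by simp
    next
      case 2 with bracket_at_minus1[OF A] B show ?thesis by simp
    next
      case 3 with A B f r00 show ?thesis by simp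
    next
      case 4 with A B f r01 show ?thesis by simp
    next
      case 5 with A B f r10 show ?thesis by simp
    next
      case 6 with A B f r11 show ?thesis by simp
    qed
  qed
qed

section \<open>The top exterior power and the Koszul complex\<close>

lemma theta_del_K: "k \<in> K \<Longrightarrow> l \<in> K \<Longrightarrow> theta k (del l f) K = (if k = l then f K else 0)"
  by (auto simp: theta_def del_def sig_remove insert_absorb)

lemma del_K: "k \<in> K \<Longrightarrow> del k f K = 0"
  by (simp add: del_def)

lemma theta_del_del_K: "p \<in> K \<Longrightarrow> k \<in> K \<Longrightarrow> l \<in> K \<Longrightarrow> theta k (del l (del p f)) K = 0"
  by (auto simp: theta_del_K del_K)

lemma enc_K: "m \<le> \<nu> \<Longrightarrow> \<nu> < N \<Longrightarrow> i < m \<Longrightarrow> prod_encode (\<nu>, i) \<in> K"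
  by (auto simp: K_def)

lemma sum_fun_app: "(\<Sum>i\<in>I. f i) S = (\<Sum>i\<in>I. f i S)" for f :: "'i \<Rightarrow> nat set \<Rightarrow> 'l"
  by (induction I rule: infinite_finite_induct) auto

lemma s_sum_const: "(\<Sum>i\<in>I. x) = s (of_nat (card I)) x"
  by (induction I rule: infinite_finite_induct) (auto simp: scale_left_distrib)

text \<open>The Grassmann part of \<open>Op a a\<close> counts factors: n codes of \<open>K\<close>
  involve a given a < m, and m codes involve a given a \<ge> m. This is the weight -2\<rho>_1 of the
  top exterior power.\<close>

lemma Op_top_0:
  assumes "(a, b) \<in> IX 0"
  shows "Op a b f K = em a b (f K) +
    (if a = b then s (if a < m then - of_nat n else of_nat m) (f K) else 0)"
proof (cases "a < m")
  case True
  then have "b < m" using assms by (auto simp: IX_def blk_def split: if_splits)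
  then show ?thesis using True
    by (auto simp: Op_def lift_def sum_fun_app theta_del_K enc_K s_sum_const intro!: sum.neutral)
next
  case False
  then have "m \<le> b" "a < N" "b < N" using assms by (auto simp: IX_def blk_def split: if_splits)
  then show ?thesis using False
    by (auto simp: Op_def lift_def sum_fun_app theta_del_K enc_K s_sum_const intro!: sum.neutral)
qed

text \<open>Every summand of \<open>Op a b\<close> lowers the exterior degree by one, so nothing
  arrives in the top degree.\<close>

lemma Op_top_1: "a < m \<Longrightarrow> m \<le> b \<Longrightarrow> b < N \<Longrightarrow> Op a b f K = 0"
  by (simp add: Op_def lift_def sum_fun_app theta_del_del_K del_K enc_K additive.zero[OF e_additive])

lemma rho_top_0:
  assumes "A \<in> gdeg 0"
  shows "rho A f K = lev A (f K) +
    s (\<Sum>a<N. (if a < m then - of_nat n else of_nat m) * A $$ (a, a)) (f K)"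
proof -
  have *: "IX 0 = {p \<in> IX 0. fst p \<noteq> snd p} \<union> (\<lambda>a. (a, a)) ` {..<N}"
    by (auto simp: IX_def)
  have "rho A f K = (\<Sum>(a, b)\<in>IX 0. s (A $$ (a, b)) (Op a b f K))"
    unfolding rho_gdeg[OF assms] sum_fun_app by (auto simp: fs_def intro!: sum.cong)
  also have "\<dots> = lev A (f K) +
     (\<Sum>(a, b)\<in>IX 0. if a = b then s ((if a < m then - of_nat n else of_nat m) * A $$ (a, a)) (f K) else 0)"
    unfolding lev_def sum.distrib[symmetric]
    by (intro sum.cong refl) (auto simp: Op_top_0 scale_right_distrib mult.commute)
  also have "(\<Sum>(a, b)\<in>IX 0. if a = b then s ((if a < m then - of_nat n else of_nat m) * A $$ (a, a)) (f K) else 0)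
     = (\<Sum>(a, b)\<in>(\<lambda>a. (a, a)) ` {..<N}. s ((if a < m then - of_nat n else of_nat m) * A $$ (a, a)) (f K))"
    by (rule sum.mono_neutral_cong_right[OF finite_IX]) (auto simp: IX_def)
  also have "\<dots> = s (\<Sum>a<N. (if a < m then - of_nat n else of_nat m) * A $$ (a, a)) (f K)"
    by (subst sum.reindex) (auto simp: inj_on_def scale_sum_left)
  finally show ?thesis .
qed

lemma rho_top_1: "A \<in> gdeg 1 \<Longrightarrow> rho A f K = 0"
  by (simp add: rho_gdeg sum_fun_app)
    (auto simp: fs_def IX_def blk_def Op_top_1 intro!: sum.neutral split: if_splits)

lemma theta_sq: "theta k (theta k f) = 0"
  by (auto simp: theta_def)

text \<open>The equations are solved one k at a time. The error \<open>w\<close> at a new k is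
  killed by \<open>theta k\<close> and by all earlier \<open>theta j\<close>; hence
  \<open>theta k (del k w) = w\<close>, and adding \<open>del k w\<close> repairs the new equation
  without disturbing the earlier ones.\<close>

lemma koszul:
  assumes v: "\<And>k. k \<in> K \<Longrightarrow> v k \<in> X"
    and vv: "\<And>k l. k \<in> K \<Longrightarrow> l \<in> K \<Longrightarrow> theta k (v l) + theta l (v k) = 0"
  shows "\<exists>f\<in>X. \<forall>k\<in>K. theta k f = v k"
proof -
  have "\<exists>f\<in>X. \<forall>k\<in>J. theta k f = v k" if "finite J" "J \<subseteq> K" for J
    using that
  proof (induction J rule: finite_induct)
    case empty
    show ?case using X_zero by auto
  next
    case (insert k J)
    then obtain f where f: "f \<in> X" "\<And>j. j \<in> J \<Longrightarrow> theta j f = v j" by auto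
    have k: "k \<in> K" using insert by simp
    define w where "w = v k - theta k f"
    have wX: "w \<in> X" using f v k by (auto simp: w_def intro!: X_diff X_theta)
    \<comment> \<open>The compatibility of k with itself gives only twice the wanted
      equation.\<close>
    have "theta k (v k) + theta k (v k) = fs 2 (theta k (v k))"
      using fs.scale_left_distrib[of 1 1] by simp
    then have "theta k (v k) = 0" using vv[OF k k] by simp
    then have wk: "theta k w = 0" by (simp add: w_def theta_simps theta_sq)
    have wj: "theta j w = 0" if "j \<in> J" for j
      using that vv[OF k, of j] f(2)[OF that] insert theta_anticomm[of j k f]
      by (auto simp: w_def theta_simps add.commute)
    define f' where "f' = f + del k w"
    have "f' \<in> X" using f k wX by (auto simp: f'_def intro!: X_add X_del)
    moreover have "w - theta k (del k w) = del k (theta k w)" by (simp add: del_theta)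
    then have "theta k (del k w) = w" by (metis wk del_simps(2) eq_iff_diff_eq_0)
    then have "theta k f' = v k" by (simp add: f'_def theta_simps w_def)
    moreover have "theta j f' = v j" if "j \<in> J" for j
    proof -
      have "k \<noteq> j" using that insert by auto
      then have "- theta j (del k w) = del k (theta j w)" by (simp add: del_theta)
      then have "theta j (del k w) = 0" by (simp add: wj[OF that] del_simps)
      then show ?thesis using f(2)[OF that] by (simp add: f'_def theta_simps)
    qed
    ultimately show ?case by auto
  qed
  from this[of K] show ?thesis using finite_K by simp
qed

text \<open>The coefficient at a proper subset S of \<open>K\<close> reappears up to sign in
  \<open>theta k f\<close> at \<open>insert k S\<close>, for any k missing from S.\<close>

lemma theta_kernel:
  assumes f: "f \<in> X" and z: "\<And>k. k \<in> K \<Longrightarrow> theta k f = 0" and top: "f K = 0"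
  shows "f = 0"
proof
  fix S
  show "f S = 0 S"
  proof (cases "S \<subseteq> K \<and> S \<noteq> K")
    case True
    then obtain k where k: "k \<in> K" "k \<notin> S" by auto
    then have "sig k (insert k S) (f S) = 0"
      using fun_cong[OF z[OF k(1)], of "insert k S"] by (simp add: theta_def)
    then show ?thesis by (auto simp: sig_def split: if_splits)
  next
    case False
    then show ?thesis using f top by (auto simp: X_def)
  qed
qed

lemma bottom: "\<exists>f\<in>X. f K = l \<and> (\<forall>k\<in>K. theta k f = 0)"
proof -
  have "(\<lambda>S. if S = K then l else 0) \<in> X" by (auto simp: X_def)
  moreover have "theta k (\<lambda>S. if S = K then l else 0) = 0" if "k \<in> K" for k
    using that by (auto simp: theta_def fun_eq_iff)
  ultimately show ?thesis by (intro bexI[of _ "\<lambda>S. if S = K then l else 0"]) auto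
qed

end

section \<open>Homogeneous components of sl and of its bracket\<close>

context block_dims begin

lemma cut_zero: "mat_homog m a A \<Longrightarrow> A \<in> carrier_mat N N \<Longrightarrow> odd (d + int a) \<Longrightarrow> cut d A = 0\<^sub>m N N"
proof -
  assume h: "mat_homog m a A" and A: "A \<in> carrier_mat N N" and d: "odd (d + int a)"
  have "A $$ (i, j) = 0" if "i < N" "j < N" "blk j - blk i = d" for i j
  proof -
    have "A $$ (i, j) = mat_part m a A $$ (i, j)" using h by (simp add: mat_homog_def)
    also have "\<dots> = 0" using that A d by (auto simp: mat_part_def blk_def ipar_def split: if_splits)
    finally show ?thesis .
  qed
  then show ?thesis by (intro eq_matI) (auto simp: cut_def)
qed

lemma sbracket_add_left: "A \<in> carrier_mat N N \<Longrightarrow> A' \<in> carrier_mat N N \<Longrightarrow> B \<in> carrier_mat N N \<Longrightarrow>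
    sbracket m (A + A') B = sbracket m A B + sbracket m A' B"
proof -
  assume c: "A \<in> carrier_mat N N" "A' \<in> carrier_mat N N" "B \<in> carrier_mat N N"
  have p: "mat_part m b (A + A') = mat_part m b A + mat_part m b A'" for b
    using c by (intro eq_matI) (auto simp: mat_part_def)
  have [simp]: "mat_part m b X \<in> carrier_mat N N" if "X \<in> carrier_mat N N" for b X
    using that by (simp add: mat_part_def)
  have [simp]: "dim_row (mat_part m b X) = dim_row X" "dim_col (mat_part m b X) = dim_col X" for b X
    by (simp_all add: mat_part_def)
  show ?thesis unfolding sbracket_def Let_def p
    using c by (simp add: mat_distrib) (intro eq_matI, use c in \<open>auto simp del: index_mult_mat(1)\<close>)
qed

lemma sbracket_add_right: "A \<in> carrier_mat N N \<Longrightarrow> B \<in> carrier_mat N N \<Longrightarrow> B' \<in> carrier_mat N N \<Longrightarrow>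
    sbracket m A (B + B') = sbracket m A B + sbracket m A B'"
proof -
  assume c: "A \<in> carrier_mat N N" "B \<in> carrier_mat N N" "B' \<in> carrier_mat N N"
  have p: "mat_part m b (B + B') = mat_part m b B + mat_part m b B'" for b
    using c by (intro eq_matI) (auto simp: mat_part_def)
  have [simp]: "mat_part m b X \<in> carrier_mat N N" if "X \<in> carrier_mat N N" for b X
    using that by (simp add: mat_part_def)
  have [simp]: "dim_row (mat_part m b X) = dim_row X" "dim_col (mat_part m b X) = dim_col X" for b X
    by (simp_all add: mat_part_def)
  show ?thesis unfolding sbracket_def Let_def p
    using c by (simp add: mat_distrib) (intro eq_matI, use c in \<open>auto simp del: index_mult_mat(1)\<close>)
qed

lemma cut_induct:
  fixes T :: "complex mat \<Rightarrow> 'v::ab_group_add"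
  assumes add: "\<And>x y. x \<in> sl m n \<Longrightarrow> y \<in> sl m n \<Longrightarrow> T (x + y) = T x + T y"
    and z: "\<And>d. d \<in> {-1, 0, 1} \<Longrightarrow> T (cut d x) = 0" and x: "x \<in> sl m n"
  shows "T x = 0"
proof -
  have "T x = T (cut (-1) x + (cut 0 x + cut 1 x))" using cut_sum[OF sl_carrier[OF x]] by simp
  also have "\<dots> = 0" using x z by (simp add: add cut_sl sl_add)
  finally show ?thesis .
qed

text \<open>Carries identities over from \<int>-homogeneous matrices to those that are homogeneous
  modulo 2 only, whose components of degree -1 and 1 are mixed.\<close>

lemma biadd_cut:
  fixes T :: "complex mat \<Rightarrow> complex mat \<Rightarrow> 'v::ab_group_add"
  assumes l: "\<And>x x' y. x \<in> sl m n \<Longrightarrow> x' \<in> sl m n \<Longrightarrow> y \<in> sl m n \<Longrightarrow> T (x + x') y = T x y + T x' y"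
    and r: "\<And>x y y'. x \<in> sl m n \<Longrightarrow> y \<in> sl m n \<Longrightarrow> y' \<in> sl m n \<Longrightarrow> T x (y + y') = T x y + T x y'"
    and z: "\<And>d e. T (cut d x) (cut e y) = 0" and x: "x \<in> sl m n" and y: "y \<in> sl m n"
  shows "T x y = 0"
proof (rule cut_induct[where T = "\<lambda>x. T x y", OF _ _ x])
  fix d :: int
  show "T (cut d x) y = 0"
    by (rule cut_induct[where T = "\<lambda>y. T (cut d x) y", OF _ _ y]) (auto intro: r z x)
qed (auto intro: l y)

lemma sbracket_sl: "x \<in> sl m n \<Longrightarrow> y \<in> sl m n \<Longrightarrow> sbracket m x y \<in> sl m n"
proof -
  have part: "mat_part m b X \<in> sl m n \<and> mat_part m b X \<in> carrier_mat N N" if "X \<in> sl m n" for b X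
    using that by (cases "even b") (auto simp: mat_part_def sl_def supertrace_def)
  assume x: "x \<in> sl m n" and y: "y \<in> sl m n"
  note c = x[THEN sl_carrier] y[THEN sl_carrier]
  have "sbracket m x y = sbracket m (cut (-1) x + (cut 0 x + cut 1 x)) (cut (-1) y + (cut 0 y + cut 1 y))"
    using cut_sum[OF c(1)] cut_sum[OF c(2)] by simp
  also have "\<dots> \<in> sl m n"
    using cut_gdeg[THEN gdeg_carrier]
    by (simp add: sbracket_add_left sbracket_add_right sbracket_brk[OF cut_gdeg cut_gdeg])
      (intro sl_add brk_sl cut_gdeg)
  finally show ?thesis .
qed

lemma sg_parity: "even (d + int a) \<Longrightarrow> even (e + int b) \<Longrightarrow> sg d e = (-1) ^ (a * b)"
  by (auto simp: sg_def)

lemma G0_zero: "sl_zero m n = gdeg 0 \<inter> sl m n"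
proof -
  have "mat_homog m 0 A \<longleftrightarrow> A \<in> gdeg 0" if A: "A \<in> carrier_mat N N" for A
  proof
    assume h: "mat_homog m 0 A"
    show "A \<in> gdeg 0"
    proof (rule gdegI[OF A])
      fix i j assume ij: "i < N" "j < N" "blk j - blk i \<noteq> 0"
      have "A $$ (i, j) = mat_part m 0 A $$ (i, j)" using h by (simp add: mat_homog_def)
      also have "\<dots> = 0" using ij A by (auto simp: mat_part_def blk_def ipar_def split: if_splits)
      finally show "A $$ (i, j) = 0" .
    qed
  next
    assume "A \<in> gdeg 0"
    then show "mat_homog m 0 A" using homog_gdeg by fastforce
  qed
  then show ?thesis by (auto simp: sl_zero_def sl_carrier gdeg_carrier)
qed

lemma G1_plus: "sl_plus m n = gdeg 1"
proof
  show "sl_plus m n \<subseteq> gdeg 1"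
  proof
    fix A assume A: "A \<in> sl_plus m n"
    then have c: "A \<in> carrier_mat N N" by (simp add: sl_plus_def sl_carrier)
    show "A \<in> gdeg 1"
    proof (rule gdegI[OF c])
      fix i j assume "i < N" "j < N" "blk j - blk i \<noteq> 1"
      then show "A $$ (i, j) = 0" using A by (cases "i < m \<and> m \<le> j") (auto simp: sl_plus_def blk_def)
    qed
  qed
  show "gdeg 1 \<subseteq> sl_plus m n"
  proof
    fix A assume A: "A \<in> gdeg 1"
    have "i < m \<and> m \<le> j" if "i < N" "j < N" "A $$ (i, j) \<noteq> 0" for i j
    proof -
      have "blk j - blk i = 1" using gdegD[OF A that(1,2)] that(3) by blast
      then show ?thesis by (auto simp: blk_def split: if_splits)
    qed
    then show "A \<in> sl_plus m n" using gdeg_sl[OF A] by (simp add: sl_plus_def)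
  qed
qed

lemma para_0: "A \<in> gdeg 0 \<Longrightarrow> A \<in> sl m n \<Longrightarrow> A \<in> sl_para m n"
  unfolding sl_para_def G0_zero G1_plus
  by (rule CollectI, rule exI[of _ A], rule exI[of _ "0\<^sub>m N N"]) (auto simp: gdeg_carrier)

lemma para_1: "A \<in> gdeg 1 \<Longrightarrow> A \<in> sl_para m n"
  unfolding sl_para_def G0_zero G1_plus
  by (rule CollectI, rule exI[of _ "0\<^sub>m N N"], rule exI[of _ A]) (auto simp: gdeg_carrier)

end

section \<open>Evaluation of the presentation of the induced module\<close>

lemma lookup_free_scale: "Poly_Mapping.lookup (free_scale c f) k = c * Poly_Mapping.lookup f k"
  by (simp add: free_scale_def Poly_Mapping.map.rep_eq when_def)

lemma module_free_scale: "Modules.module free_scale"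
  by standard (auto intro!: poly_mapping_eqI simp: lookup_free_scale lookup_add algebra_simps)

text \<open>Keys may cancel when elements are added; linearity is therefore checked over a common
  finite superset of the keys.\<close>

lemma ind_map_superset:
  assumes "vector_space (scl M)" "finite S" "Poly_Mapping.keys f \<subseteq> S"
  shows "ind_map M j f = (\<Sum>k\<in>S. scl M (Poly_Mapping.lookup f k) (foldr (act M) (fst k) (j (snd k))))"
proof -
  interpret vector_space "scl M" by fact
  show ?thesis unfolding ind_map_def
    by (rule sum.mono_neutral_left) (use assms in \<open>auto simp: in_keys_iff\<close>)
qed

lemma ind_map_add:
  assumes "vector_space (scl M)"
  shows "ind_map M j (f + g) = ind_map M j f + ind_map M j g"
proof -
  interpret vector_space "scl M" by fact
  let ?S = "Poly_Mapping.keys f \<union> Poly_Mapping.keys g"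
  have "Poly_Mapping.keys (f + g) \<subseteq> ?S" by (rule Poly_Mapping.keys_add)
  then show ?thesis
    by (subst (1 2 3) ind_map_superset[OF assms, of ?S])
      (auto simp: lookup_add scale_left_distrib sum.distrib)
qed

lemma ind_map_scale:
  assumes "vector_space (scl M)"
  shows "ind_map M j (free_scale c f) = scl M c (ind_map M j f)"
proof -
  interpret vector_space "scl M" by fact
  have "Poly_Mapping.keys (free_scale c f) \<subseteq> Poly_Mapping.keys f"
    by (auto simp: in_keys_iff lookup_free_scale)
  then show ?thesis
    by (subst (1 2) ind_map_superset[OF assms, of "Poly_Mapping.keys f"])
      (auto simp: lookup_free_scale scale_sum_right)
qed

lemma ind_map_diff:
  assumes "vector_space (scl M)"
  shows "ind_map M j (f - g) = ind_map M j f - ind_map M j g"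
  using ind_map_add[OF assms, of j "f - g" g] by simp

lemma ind_map_gen:
  assumes "vector_space (scl M)"
  shows "ind_map M j (gen xs l) = foldr (act M) xs (j l)"
proof -
  interpret vector_space "scl M" by fact
  show ?thesis by (simp add: ind_map_def)
qed

section \<open>Modules over \<open>g\<^sub>0\<close>\<close>

locale block_dims_pos = block_dims +
  assumes N_pos: "0 < N"
begin

text \<open>The identity has supertrace m - n, which may vanish; this central element of the block
  diagonal part has supertrace m + n.\<close>

definition Dm :: "complex mat" where
  "Dm = mat N N (\<lambda>(i, j). if i = j then if i < m then 1 else -1 else 0)"

text \<open>
  The projection onto \<open>sl\<close> along the matrix \<open>diag(1, \<dots>, 1 | -1, \<dots>, -1)\<close>, which is central in the even part
  of \<open>gl\<close>: through it every \<open>g\<^sub>0\<close>-module becomes a module over all block diagonal matrices.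
\<close>

definition pr :: "complex mat \<Rightarrow> complex mat" where
  "pr A = A - (supertrace m n A / of_nat N) \<cdot>\<^sub>m Dm"

lemma Dm_gdeg: "Dm \<in> gdeg 0"
  by (rule gdegI) (auto simp: Dm_def)

lemma Dm_dim [simp]: "dim_row Dm = N" "dim_col Dm = N"
  by (simp_all add: Dm_def)

lemma Dm_supertrace: "supertrace m n Dm = of_nat N"
proof -
  have "supertrace m n Dm = (\<Sum>a<N. 1)"
    unfolding supertrace_def by (intro sum.cong) (auto simp: Dm_def ipar_def)
  then show ?thesis by simp
qed

lemma supertrace_linear:
  "A \<in> carrier_mat N N \<Longrightarrow> B \<in> carrier_mat N N \<Longrightarrow> supertrace m n (A + B) = supertrace m n A + supertrace m n B"
  "A \<in> carrier_mat N N \<Longrightarrow> B \<in> carrier_mat N N \<Longrightarrow> supertrace m n (A - B) = supertrace m n A - supertrace m n B"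
  "A \<in> carrier_mat N N \<Longrightarrow> supertrace m n (c \<cdot>\<^sub>m A) = c * supertrace m n A"
  by (auto simp: supertrace_def sum.distrib sum_subtractf algebra_simps sum_distrib_left)

lemma pr_gdeg: "A \<in> gdeg 0 \<Longrightarrow> pr A \<in> gdeg 0"
  unfolding pr_def by (intro gdeg_minus gdeg_smult Dm_gdeg)

lemma pr_sl:
  assumes "A \<in> gdeg 0" shows "pr A \<in> sl m n"
proof -
  have "of_nat N \<noteq> (0 :: complex)" using N_pos unfolding of_nat_eq_0_iff by simp
  then have "supertrace m n (pr A) = 0"
    using gdeg_carrier[OF assms] gdeg_carrier[OF Dm_gdeg]
    by (simp add: pr_def supertrace_linear Dm_supertrace del: of_nat_add)
  then show ?thesis using gdeg_carrier[OF pr_gdeg[OF assms]] by (simp add: sl_def)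
qed

lemma pr_id: "A \<in> sl m n \<Longrightarrow> pr A = A"
  by (intro eq_matI) (auto simp: pr_def sl_def)

lemma pr_add: "A \<in> gdeg 0 \<Longrightarrow> B \<in> gdeg 0 \<Longrightarrow> pr (A + B) = pr A + pr B"
  by (intro eq_matI) (auto simp: pr_def supertrace_linear gdeg_carrier algebra_simps add_divide_distrib)

lemma pr_smult: "A \<in> gdeg 0 \<Longrightarrow> pr (c \<cdot>\<^sub>m A) = c \<cdot>\<^sub>m pr A"
  by (intro eq_matI) (auto simp: pr_def supertrace_linear gdeg_carrier algebra_simps)

lemma Dm_central:
  assumes A: "A \<in> gdeg 0" shows "Dm * A = A * Dm"
proof (rule eq_matI)
  fix i j assume "i < dim_row (A * Dm)" "j < dim_col (A * Dm)"
  then have ij: "i < N" "j < N" using A by auto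
  have "(Dm * A) $$ (i, j) = (if i < m then 1 else -1) * A $$ (i, j)"
    using ij gdeg_carrier[OF A] gdeg_carrier[OF Dm_gdeg]
    by (subst mult_index) (simp_all add: Dm_def if_distrib[of "\<lambda>x. x * _"] cong: if_cong)
  moreover have "(A * Dm) $$ (i, j) = (if j < m then 1 else -1) * A $$ (i, j)"
    using ij gdeg_carrier[OF A] gdeg_carrier[OF Dm_gdeg]
    by (subst mult_index) (simp_all add: Dm_def if_distrib[of "\<lambda>x. _ * x"] cong: if_cong)
  moreover have "A $$ (i, j) = 0 \<or> (i < m \<longleftrightarrow> j < m)"
    using gdegD[OF A ij] by (cases "i < m"; cases "j < m"; simp add: blk_def)
  ultimately show "(Dm * A) $$ (i, j) = (A * Dm) $$ (i, j)" using ij by auto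
qed (use A in auto)

text \<open>\<open>pr\<close> alters a block diagonal matrix only by a multiple of the central
  element \<open>Dm\<close>.\<close>

lemma brk_pr:
  assumes "A \<in> gdeg 0" "B \<in> gdeg 0"
  shows "brk 0 0 (pr A) (pr B) = brk 0 0 A B"
proof -
  note [simp] = assms(1)[THEN gdeg_carrier] assms(2)[THEN gdeg_carrier] Dm_gdeg[THEN gdeg_carrier] Dm_central[OF assms(1)] Dm_central[OF assms(2)]
  have [simp]: "dim_row A = N" "dim_col A = N" "dim_row B = N" "dim_col B = N" using assms by auto
  show ?thesis unfolding brk_def pr_def
    by (simp add: mat_distrib minus_carrier_mat[of _ N N])
      (intro eq_matI, auto simp: sg_def algebra_simps simp del: index_mult_mat(1))
qed

end

locale g0_rep = block_dims_pos m n + vector_space s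
  for m n :: nat and s :: "complex \<Rightarrow> 'l::ab_group_add \<Rightarrow> 'l" +
  fixes h0 :: "complex mat \<Rightarrow> 'l \<Rightarrow> 'l"
  assumes h0_add: "A \<in> gdeg 0 \<Longrightarrow> A \<in> sl m n \<Longrightarrow> h0 A (u + v) = h0 A u + h0 A v"
    and h0_scale: "A \<in> gdeg 0 \<Longrightarrow> A \<in> sl m n \<Longrightarrow> h0 A (s c v) = s c (h0 A v)"
    and h0_mat_add: "A \<in> gdeg 0 \<Longrightarrow> A \<in> sl m n \<Longrightarrow> B \<in> gdeg 0 \<Longrightarrow> B \<in> sl m n \<Longrightarrow>
      h0 (A + B) v = h0 A v + h0 B v"
    and h0_mat_scale: "A \<in> gdeg 0 \<Longrightarrow> A \<in> sl m n \<Longrightarrow> h0 (c \<cdot>\<^sub>m A) v = s c (h0 A v)"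
    and h0_rel: "A \<in> gdeg 0 \<Longrightarrow> A \<in> sl m n \<Longrightarrow> B \<in> gdeg 0 \<Longrightarrow> B \<in> sl m n \<Longrightarrow>
      h0 A (h0 B v) = h0 B (h0 A v) + h0 (brk 0 0 A B) v"
begin

text \<open>The value 0 outside the blocks makes \<open>em a b\<close> linear for all indices, as
  \<open>kac_model\<close> demands.\<close>

definition em :: "nat \<Rightarrow> nat \<Rightarrow> 'l \<Rightarrow> 'l" where
  "em a b l = (if (a, b) \<in> IX 0 then h0 (pr (E a b)) l else 0)"

lemma unit_IX: "(a, b) \<in> IX d \<Longrightarrow> E a b \<in> gdeg d"
  by (auto simp: IX_def)

lemma h0_pr_zero: "h0 (pr (0\<^sub>m N N)) l = 0"
  using h0_mat_scale[of "pr (0\<^sub>m N N)" 0 l] pr_gdeg[OF gdeg_zero] pr_sl[OF gdeg_zero] pr_smult[of "0\<^sub>m N N" 0]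
  by (simp add: gdeg_zero)

lemma h0_pr_add: "A \<in> gdeg 0 \<Longrightarrow> B \<in> gdeg 0 \<Longrightarrow> h0 (pr (A + B)) l = h0 (pr A) l + h0 (pr B) l"
  by (simp add: pr_add h0_mat_add pr_gdeg pr_sl)

lemma h0_pr_smult: "A \<in> gdeg 0 \<Longrightarrow> h0 (pr (c \<cdot>\<^sub>m A)) l = s c (h0 (pr A) l)"
  by (simp add: pr_smult h0_mat_scale pr_gdeg pr_sl)

lemma em_add: "em a b (u + v) = em a b u + em a b v"
  and em_scale: "em a b (s c v) = s c (em a b v)"
  by (simp_all add: em_def h0_add h0_scale pr_gdeg pr_sl unit_IX)

lemma em_additive: "additive (em a b)"
  by (simp add: additive_def em_add)

lemma pr_brk_units:
  assumes ab: "(a, b) \<in> IX 0" and cd: "(c, d) \<in> IX 0"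
  shows "brk 0 0 (pr (E a b)) (pr (E c d)) =
    pr ((if b = c then E a d else 0\<^sub>m N N) + (-1) \<cdot>\<^sub>m (if a = d then E c b else 0\<^sub>m N N))"
proof -
  note g = unit_IX[OF ab] unit_IX[OF cd]
  have lt: "a < N" "b < N" "c < N" "d < N" using ab cd by (auto simp: IX_def)
  have "brk 0 0 (E a b) (E c d) =
      (if b = c then E a d else 0\<^sub>m N N) + (-1) \<cdot>\<^sub>m (if a = d then E c b else 0\<^sub>m N N)"
    using lt by (intro eq_matI) (auto simp: brk_units sg_def)
  then show ?thesis using pr_id[OF brk_sl[OF g]] brk_pr[OF g] by simp
qed

text \<open>The map D is kept general because it will be the action on a fixed vector as well as a
  derivation.\<close>

lemma linear_pr_brk_units:
  assumes ab: "(a, b) \<in> IX 0" and cd: "(c, d) \<in> IX 0"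
    and add: "\<And>A B. A \<in> gdeg 0 \<Longrightarrow> B \<in> gdeg 0 \<Longrightarrow> D (pr (A + B)) = D (pr A) + D (pr B)"
    and smult: "\<And>A c. A \<in> gdeg 0 \<Longrightarrow> D (pr (c \<cdot>\<^sub>m A)) = s c (D (pr A))"
  shows "D (brk 0 0 (pr (E a b)) (pr (E c d))) =
    (if b = c then D (pr (E a d)) else 0) - (if a = d then D (pr (E c b)) else 0)"
proof -
  have ix: "b = c \<Longrightarrow> (a, d) \<in> IX 0" "a = d \<Longrightarrow> (c, b) \<in> IX 0" using ab cd by (auto simp: IX_def)
  have z: "D (pr (0\<^sub>m N N)) = 0"
    using smult[of "0\<^sub>m N N" 0] by (simp add: gdeg_zero)
  show ?thesis unfolding pr_brk_units[OF ab cd]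
    using ix by (subst add) (auto intro!: gdeg_smult gdeg_zero unit_IX simp: z smult unit_IX gdeg_zero)
qed

lemma em_comm:
  assumes ab: "(a, b) \<in> IX 0" and cd: "(c, d) \<in> IX 0"
  shows "em a b (em c d l) = em c d (em a b l) + (if b = c then em a d l else 0) - (if a = d then em c b l else 0)"
proof -
  note g = unit_IX[OF ab] unit_IX[OF cd]
  have ix: "b = c \<Longrightarrow> (a, d) \<in> IX 0" "a = d \<Longrightarrow> (c, b) \<in> IX 0" using ab cd by (auto simp: IX_def)
  have "h0 (pr (E a b)) (h0 (pr (E c d)) l) = h0 (pr (E c d)) (h0 (pr (E a b)) l) +
      h0 (brk 0 0 (pr (E a b)) (pr (E c d))) l"
    by (rule h0_rel) (auto intro!: pr_gdeg pr_sl g)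
  also have "h0 (brk 0 0 (pr (E a b)) (pr (E c d))) l = (if b = c then em a d l else 0) - (if a = d then em c b l else 0)"
    using linear_pr_brk_units[OF ab cd, of "\<lambda>A. h0 A l"] ix by (auto simp: em_def h0_pr_add h0_pr_smult)
  finally show ?thesis using ab cd by (simp add: em_def)
qed

lemma h0_units:
  assumes A: "A \<in> gdeg 0" "A \<in> sl m n"
  shows "h0 A l = (\<Sum>(a, b)\<in>IX 0. s (A $$ (a, b)) (em a b l))"
proof -
  have "h0 (pr A) l = (\<Sum>(a, b)\<in>IX 0. s (A $$ (a, b)) (h0 (pr (E a b)) l))"
    by (rule mat_sum_units[of 0 "\<lambda>A. h0 (pr A) l" s]) (auto simp: h0_pr_add h0_pr_smult A)
  also have "\<dots> = (\<Sum>(a, b)\<in>IX 0. s (A $$ (a, b)) (em a b l))" by (intro sum.cong) (auto simp: em_def)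
  finally show ?thesis using A by (simp add: pr_id)
qed

end

locale kac_setup = block_dims_pos m n for m n :: nat +
  fixes L :: "('l::ab_group_add) smodule" and V :: "('v::ab_group_add) smodule" and \<iota> :: "'l \<Rightarrow> 'v"
  assumes L_mod: "supermodule m (sl_para m n) L"
    and L_plus: "\<And>x l. x \<in> sl_plus m n \<Longrightarrow> act L x l = 0"
    and ind: "induced_module m n L V \<iota>"
begin

lemma V_mod: "supermodule m (sl m n) V"
  using ind by (simp add: induced_module_def)

sublocale Lv: vector_space "scl L"
  using L_mod by (simp add: supermodule_def)

sublocale Vv: vector_space "scl V"
  using V_mod by (simp add: supermodule_def)

lemma actV_add: "x \<in> sl m n \<Longrightarrow> act V x (u + v) = act V x u + act V x v"
  and actV_scale: "x \<in> sl m n \<Longrightarrow> act V x (scl V c v) = scl V c (act V x v)"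
  and actV_mat_add: "x \<in> sl m n \<Longrightarrow> y \<in> sl m n \<Longrightarrow> act V (x + y) v = act V x v + act V y v"
  and actV_mat_scale: "x \<in> sl m n \<Longrightarrow> act V (c \<cdot>\<^sub>m x) v = scl V c (act V x v)"
  using V_mod by (simp_all add: supermodule_def)

lemma actV_additive: "x \<in> sl m n \<Longrightarrow> additive (act V x)"
  by (simp add: additive_def actV_add)

lemma actL_add: "x \<in> sl_para m n \<Longrightarrow> act L x (u + v) = act L x u + act L x v"
  and actL_scale: "x \<in> sl_para m n \<Longrightarrow> act L x (scl L c v) = scl L c (act L x v)"
  and actL_mat_add: "x \<in> sl_para m n \<Longrightarrow> y \<in> sl_para m n \<Longrightarrow> act L (x + y) v = act L x v + act L y v"
  and actL_mat_scale: "x \<in> sl_para m n \<Longrightarrow> act L (c \<cdot>\<^sub>m x) v = scl L c (act L x v)"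
  using L_mod by (simp_all add: supermodule_def)

lemma actV_rel:
  assumes "A \<in> gdeg d" "A \<in> sl m n" "B \<in> gdeg e" "B \<in> sl m n"
  shows "act V A (act V B v) = scl V (sg d e) (act V B (act V A v)) + act V (brk d e A B) v"
proof -
  have "act V (sbracket m A B) v =
      act V A (act V B v) - scl V ((-1) ^ (nat \<bar>d\<bar> * nat \<bar>e\<bar>)) (act V B (act V A v))"
    using V_mod homog_gdeg[OF assms(1)] homog_gdeg[OF assms(3)] assms(2,4)
    unfolding supermodule_def by blast
  moreover have "sg d e = (-1) ^ (nat \<bar>d\<bar> * nat \<bar>e\<bar>)" by (rule sg_parity) (auto simp: even_nat_iff)
  ultimately show ?thesis by (simp add: sbracket_brk[OF assms(1,3)])
qed

lemma actL_rel:
  assumes "A \<in> gdeg 0" "A \<in> sl m n" "B \<in> gdeg 0" "B \<in> sl m n"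
  shows "act L A (act L B v) = act L B (act L A v) + act L (brk 0 0 A B) v"
proof -
  have "act L (sbracket m A B) v = act L A (act L B v) - scl L ((-1) ^ (0 * 0)) (act L B (act L A v))"
    using L_mod homog_gdeg[OF assms(1)] homog_gdeg[OF assms(3)] para_0 assms
    unfolding supermodule_def by auto
  then show ?thesis by (simp add: sbracket_brk[OF assms(1,3)])
qed

sublocale g0_rep m n "scl L" "act L"
  by unfold_locales (auto intro: actL_add actL_scale actL_mat_add actL_mat_scale actL_rel para_0)

sublocale kac_model m n "scl L" em
  by unfold_locales (rule em_add em_scale em_comm; assumption?)+

lemma lev_act:
  assumes A: "A \<in> gdeg 0" "A \<in> sl m n"
  shows "lev A l = act L A l"
  by (simp add: lev_def h0_units[OF A])

end

section \<open>Highest weight modules\<close>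

context block_dims begin

lemma mat_units_induct:
  assumes A: "A \<in> gdeg d"
    and add: "\<And>A B. A \<in> gdeg d \<Longrightarrow> B \<in> gdeg d \<Longrightarrow> P A \<Longrightarrow> P B \<Longrightarrow> P (A + B)"
    and smult: "\<And>A c. A \<in> gdeg d \<Longrightarrow> P A \<Longrightarrow> P (c \<cdot>\<^sub>m A)"
    and zero: "P (0\<^sub>m N N)"
    and unit: "\<And>a b. (a, b) \<in> IX d \<Longrightarrow> P (E a b)"
  shows "P A"
proof -
  define res where "res F = mat N N (\<lambda>p. if p \<in> F then A $$ p else 0)" for F
  have res: "res F \<in> gdeg d" for F using A by (intro gdegI) (auto simp: res_def gdegD)
  have "P (res F)" if "finite F" "F \<subseteq> IX d" for F
    using that
  proof (induction F rule: finite_induct)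
    case empty
    have "res {} = 0\<^sub>m N N" by (intro eq_matI) (auto simp: res_def)
    then show ?case using zero by simp
  next
    case (insert p F)
    obtain a b where p: "p = (a, b)" by force
    with insert have ab: "a < N" "b < N" "(a, b) \<in> IX d" "E a b \<in> gdeg d" by (auto simp: IX_def)
    have "res (insert p F) = A $$ (a, b) \<cdot>\<^sub>m E a b + res F"
      using insert p ab by (intro eq_matI) (auto simp: res_def)
    then show ?case using insert p ab unit by (auto intro!: add smult gdeg_smult res)
  qed
  from this[of "IX d"] have "P (res (IX d))" by simp
  moreover have "res (IX d) = A" using A by (intro eq_matI) (auto simp: res_def IX_def gdegD)
  ultimately show ?thesis by simp
qed

lemma pos_even_IX: "(a, b) \<in> pos_even_pairs m n \<longleftrightarrow> (a, b) \<in> IX 0 \<and> a < b"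
  by (auto simp: pos_even_pairs_def IX_def blk_def)

lemma IX0_swap: "(a, b) \<in> IX 0 \<longleftrightarrow> (b, a) \<in> IX 0"
  by (auto simp: IX_def)

end

context block_dims_pos begin

lemma pr_unit: "(a, b) \<in> IX 0 \<Longrightarrow> a \<noteq> b \<Longrightarrow> pr (E a b) = E a b"
  by (rule pr_id) (auto simp: sl_def supertrace_def IX_def intro!: sum.neutral)

lemma pr_unit_cartan: "a < N \<Longrightarrow> pr (E a a) \<in> cartan m n"
proof -
  assume a: "a < N"
  then have g: "E a a \<in> gdeg 0" by auto
  have "pr (E a a) $$ (i, j) = 0" if "i < N" "j < N" "i \<noteq> j" for i j
    using that a by (auto simp: pr_def Dm_def)
  then show ?thesis using pr_sl[OF g] gdeg_dim[OF pr_gdeg[OF g]] by (auto simp: cartan_def diagonal_mat_def)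
qed

lemma cartan_gdeg: "H \<in> cartan m n \<Longrightarrow> H \<in> gdeg 0" and cartan_sl: "H \<in> cartan m n \<Longrightarrow> H \<in> sl m n"
  and cartan_diag: "H \<in> cartan m n \<Longrightarrow> i < N \<Longrightarrow> j < N \<Longrightarrow> i \<noteq> j \<Longrightarrow> H $$ (i, j) = 0"
proof -
  assume H: "H \<in> cartan m n"
  then have c: "H \<in> carrier_mat N N" by (auto simp: cartan_def sl_carrier)
  show "H \<in> sl m n" using H by (simp add: cartan_def)
  show d: "H $$ (i, j) = 0" if "i < N" "j < N" "i \<noteq> j" for i j
    using H c that by (auto simp: cartan_def diagonal_mat_def)
  show "H \<in> gdeg 0" by (rule gdegI[OF c]) (use d in \<open>force simp: blk_def\<close>)
qed

lemma weight_eval_units: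
  assumes H: "H \<in> cartan m n"
  shows "weight_eval m n \<nu> H = (\<Sum>a<N. H $$ (a, a) * weight_eval m n \<nu> (pr (E a a)))"
proof -
  have lin: "weight_eval m n \<nu> (A + B) = weight_eval m n \<nu> A + weight_eval m n \<nu> B"
    "weight_eval m n \<nu> (c \<cdot>\<^sub>m A) = c * weight_eval m n \<nu> A" if "A \<in> gdeg 0" "B \<in> gdeg 0" for A B c
    using that by (simp_all add: weight_eval_def sum.distrib algebra_simps sum_distrib_left)
  have "weight_eval m n \<nu> H = weight_eval m n \<nu> (pr H)" using pr_id cartan_sl[OF H] by simp
  also have "\<dots> = (\<Sum>(a, b)\<in>IX 0. H $$ (a, b) * weight_eval m n \<nu> (pr (E a b)))"
    by (rule mat_sum_units[of 0 "\<lambda>A. weight_eval m n \<nu> (pr A)" "(*)"])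
      (auto simp: pr_add pr_smult lin pr_gdeg cartan_gdeg[OF H])
  also have "\<dots> = (\<Sum>(a, b)\<in>(\<lambda>a. (a, a)) ` {..<N}. H $$ (a, b) * weight_eval m n \<nu> (pr (E a b)))"
    by (rule sum.mono_neutral_right[OF finite_IX]) (auto simp: IX_def cartan_diag[OF H] image_iff)
  also have "\<dots> = (\<Sum>a<N. H $$ (a, a) * weight_eval m n \<nu> (pr (E a a)))"
    by (subst sum.reindex) (auto simp: inj_on_def)
  finally show ?thesis .
qed

text \<open>A height element: every positive even root takes a positive integer value on it. This
  one Cartan element replaces the whole weight grading.\<close>

definition Ht :: "complex mat" where
  "Ht = mat N N (\<lambda>(i, j). if i = j then - of_nat i else 0)"

lemma Ht_gdeg: "Ht \<in> gdeg 0"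
  by (rule gdegI) (auto simp: Ht_def)

lemma Ht_cartan: "pr Ht \<in> cartan m n"
  using pr_sl[OF Ht_gdeg] gdeg_dim[OF pr_gdeg[OF Ht_gdeg]]
  by (auto simp: cartan_def diagonal_mat_def) (auto simp: pr_def Ht_def Dm_def)

lemma Ht_brk:
  assumes ab: "(a, b) \<in> IX 0"
  shows "brk 0 0 (pr Ht) (pr (E a b)) = (of_nat b - of_nat a) \<cdot>\<^sub>m pr (E a b)"
proof (cases "a = b")
  case True
  have "brk 0 0 (pr Ht) (pr (E a b)) = brk 0 0 Ht (E a b)"
    using ab by (intro brk_pr Ht_gdeg) (auto simp: IX_def)
  also have "\<dots> = (of_nat b - of_nat a) \<cdot>\<^sub>m pr (E a b)"
    using ab True gdeg_carrier[OF Ht_gdeg] gdeg_dim[OF pr_gdeg[OF unit_gdeg[of a a]]]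
    by (intro eq_matI) (auto simp: brk_def mult_unit_index sg_def IX_def Ht_def simp del: index_mult_mat(1))
  finally show ?thesis .
next
  case False
  have "brk 0 0 (pr Ht) (pr (E a b)) = brk 0 0 Ht (E a b)"
    using ab by (intro brk_pr Ht_gdeg) (auto simp: IX_def)
  also have "\<dots> = (of_nat b - of_nat a) \<cdot>\<^sub>m E a b"
    using ab gdeg_carrier[OF Ht_gdeg]
    by (intro eq_matI) (auto simp: brk_def mult_unit_index sg_def IX_def Ht_def simp del: index_mult_mat(1))
  finally show ?thesis using ab False by (simp add: pr_unit)
qed

end

section \<open>Submodules generated by lowering operators\<close>

context g0_rep begin

lemma h0_additive: "A \<in> gdeg 0 \<Longrightarrow> A \<in> sl m n \<Longrightarrow> additive (h0 A)"
  by (simp add: additive_def h0_add)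

lemma subspace_stableI:
  assumes W: "subspace W" and u: "\<And>a b. (a, b) \<in> IX 0 \<Longrightarrow> em a b w \<in> W"
    and x: "x \<in> gdeg 0" "x \<in> sl m n"
  shows "h0 x w \<in> W"
  unfolding h0_units[OF x] using u by (auto intro!: subspace_sum[OF W] subspace_scale[OF W])

inductive_set Fsp :: "'l set \<Rightarrow> 'l set" for G where
  gen: "g \<in> G \<Longrightarrow> g \<in> Fsp G"
| zero: "0 \<in> Fsp G"
| add: "u \<in> Fsp G \<Longrightarrow> v \<in> Fsp G \<Longrightarrow> u + v \<in> Fsp G"
| scale: "v \<in> Fsp G \<Longrightarrow> s c v \<in> Fsp G"
| low: "v \<in> Fsp G \<Longrightarrow> (a, b) \<in> IX 0 \<Longrightarrow> b < a \<Longrightarrow> em a b v \<in> Fsp G"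

lemma Fsp_subspace: "subspace (Fsp G)"
  by (auto simp: subspace_def intro: Fsp.zero Fsp.add Fsp.scale)

text \<open>Moving x past a lowering operator leaves a bracket, which is again in g_0; the induction
  therefore treats all x at once.\<close>

lemma Fsp_stable:
  assumes g: "\<And>g x. g \<in> G \<Longrightarrow> x \<in> gdeg 0 \<Longrightarrow> x \<in> sl m n \<Longrightarrow> h0 x g \<in> Fsp G"
    and w: "w \<in> Fsp G" and x: "x \<in> gdeg 0" "x \<in> sl m n"
  shows "h0 x w \<in> Fsp G"
  using w x
proof (induction arbitrary: x rule: Fsp.induct)
  case (gen w)
  then show ?case using g by blast
next
  case zero
  then show ?case by (simp add: additive.zero[OF h0_additive] Fsp.zero)
next
  case (add u v)
  then show ?case by (simp add: h0_add Fsp.add)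
next
  case (scale v c)
  then show ?case by (simp add: h0_scale Fsp.scale)
next
  case (low v a b)
  note ab = unit_IX[OF low.hyps(2)]
  have "h0 x (em a b v) = em a b (h0 x v) + h0 (brk 0 0 x (pr (E a b))) v"
    using low by (simp add: em_def h0_rel[OF low.prems pr_gdeg pr_sl] ab)
  moreover have "brk 0 0 x (pr (E a b)) \<in> gdeg 0" "brk 0 0 x (pr (E a b)) \<in> sl m n"
    using brk_gdeg'[OF low.prems(1) pr_gdeg[OF ab]] brk_sl[OF low.prems(1) pr_gdeg[OF ab]] by auto
  ultimately show ?case using low by (auto intro!: Fsp.add Fsp.low)
qed

end

locale hw_rep = g0_rep m n s h0
  for m n :: nat and s :: "complex \<Rightarrow> 'l::ab_group_add \<Rightarrow> 'l" and h0 +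
  fixes \<mu> :: weight and v0 :: 'l
  assumes irred: "\<And>W. subspace W \<Longrightarrow> (\<And>x w. x \<in> gdeg 0 \<Longrightarrow> x \<in> sl m n \<Longrightarrow> w \<in> W \<Longrightarrow> h0 x w \<in> W) \<Longrightarrow> W = {0} \<or> W = UNIV"
    and v0: "v0 \<noteq> 0"
    and v0_weight: "\<And>H. H \<in> cartan m n \<Longrightarrow> h0 H v0 = s (weight_eval m n \<mu> H) v0"
    and v0_raise: "\<And>a b. (a, b) \<in> pos_even_pairs m n \<Longrightarrow> h0 (E a b) v0 = 0"
begin

lemma em_v0:
  "(a, b) \<in> IX 0 \<Longrightarrow> a < b \<Longrightarrow> em a b v0 = 0"
  "(a, a) \<in> IX 0 \<Longrightarrow> em a a v0 = s (weight_eval m n \<mu> (pr (E a a))) v0"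
  using v0_raise[of a b] v0_weight[OF pr_unit_cartan[of a]]
  by (auto simp: em_def pr_unit pos_even_IX) (auto simp: IX_def)

definition c0 :: complex where "c0 = weight_eval m n \<mu> (pr Ht)"

text \<open>The factor that kills the eigenspace j levels below the highest weight vector. Products
  of such factors take the place of a decomposition into eigenspaces.\<close>

definition q :: "nat \<Rightarrow> 'l \<Rightarrow> 'l" where
  "q j u = h0 (pr Ht) u - s (c0 - of_nat j) u"

lemma Ht_g: "pr Ht \<in> gdeg 0" "pr Ht \<in> sl m n"
  using pr_gdeg[OF Ht_gdeg] pr_sl[OF Ht_gdeg] by auto

lemma q_additive: "additive (q j)"
  by (simp add: additive_def q_def h0_add[OF Ht_g] scale_right_distrib)

lemma q_scale: "q j (s c u) = s c (q j u)"
  by (simp add: q_def h0_scale[OF Ht_g] scale_right_diff_distrib mult.commute)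

lemma q_comm: "q j (q k u) = q k (q j u)"
  by (simp add: q_def additive.diff[OF h0_additive[OF Ht_g]] h0_add[OF Ht_g] h0_scale[OF Ht_g] scale_right_diff_distrib
    scale_left_diff_distrib mult.commute algebra_simps)

lemma q_low:
  assumes ab: "(a, b) \<in> IX 0" and "b < a"
  shows "q (j + (a - b)) (em a b u) = em a b (q j u)"
proof -
  note g = unit_IX[OF ab]
  have "h0 (pr Ht) (em a b u) = em a b (h0 (pr Ht) u) + s (of_nat b - of_nat a) (em a b u)"
    using h0_rel[OF Ht_g pr_gdeg[OF g] pr_sl[OF g], of u] ab
    by (simp add: em_def Ht_brk h0_mat_scale[OF pr_gdeg[OF g] pr_sl[OF g]])
  moreover have "of_nat (a - b) = (of_nat a - of_nat b :: complex)" using assms by (simp add: of_nat_diff)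
  ultimately show ?thesis
    by (simp add: q_def additive.diff[OF em_additive] em_scale scale_left_diff_distrib scale_left_distrib)
qed

lemma foldr_q: "additive (foldr q js)" "foldr q js (s c u) = s c (foldr q js u)"
  by (induction js) (simp_all add: additive_def q_scale additive.add[OF q_additive])

lemma foldr_q_comm: "foldr q js (q j u) = q j (foldr q js u)"
  by (induction js) (simp_all add: q_comm)

lemma foldr_q_comm': "foldr q js (foldr q ks u) = foldr q ks (foldr q js u)"
  by (induction ks) (simp_all add: foldr_q_comm)

text \<open>
  Vectors without a component in the eigenspace \<open>c0\<close> of the height element; they form a complement
  of the line of the highest weight vector.
\<close>

definition Ann :: "'l set" where
  "Ann = {w. \<exists>js. 0 \<notin> set js \<and> foldr q js w = 0}"

lemma Ann_subspace: "subspace Ann"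
  unfolding subspace_def
proof (intro conjI ballI allI)
  show "0 \<in> Ann" unfolding Ann_def by (auto intro: exI[of _ "[]"])
next
  fix u w assume "u \<in> Ann" "w \<in> Ann"
  then obtain js ks where "0 \<notin> set js" "foldr q js u = 0" "0 \<notin> set ks" "foldr q ks w = 0"
    by (auto simp: Ann_def)
  then have "0 \<notin> set (js @ ks) \<and> foldr q (js @ ks) (u + w) = 0"
    using foldr_q_comm'[of js ks u]
    by (simp add: additive.add[OF foldr_q(1)] additive.zero[OF foldr_q(1)])
  then show "u + w \<in> Ann" unfolding Ann_def by blast
next
  fix c u assume "u \<in> Ann"
  then show "s c u \<in> Ann" by (auto simp: Ann_def foldr_q(2))
qed

lemma Ann_low:
  assumes w: "w \<in> Ann" and ab: "(a, b) \<in> IX 0" "b < a"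
  shows "em a b w \<in> Ann"
proof -
  obtain js where js: "0 \<notin> set js" "foldr q js w = 0" using w by (auto simp: Ann_def)
  have "foldr q (map (\<lambda>j. j + (a - b)) js) (em a b w) = em a b (foldr q js w)"
    using q_low[OF ab] by (induction js) simp_all
  then show ?thesis using js
    by (auto simp: Ann_def additive.zero[OF em_additive] intro!: exI[of _ "map (\<lambda>j. j + (a - b)) js"])
qed

lemma foldr_q_eigen:
  assumes "h0 (pr Ht) u = s c u"
  shows "foldr q js u = s (\<Prod>j\<leftarrow>js. c - c0 + of_nat j) u"
  by (induction js) (simp_all add: q_scale, simp add: q_def assms algebra_simps)

text \<open>On the highest weight vector \<open>q j\<close> is multiplication by j, and a product of
  nonzero j is nonzero.\<close>

lemma v0_notin_Ann: "s c v0 \<in> Ann \<Longrightarrow> c = 0"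
proof -
  assume "s c v0 \<in> Ann"
  then obtain js where js: "0 \<notin> set js" "foldr q js (s c v0) = 0" by (auto simp: Ann_def)
  then have "s (c * (\<Prod>j\<leftarrow>js. of_nat j)) v0 = 0"
    using foldr_q_eigen[OF v0_weight[OF Ht_cartan], of js] by (simp add: foldr_q(2) c0_def)
  moreover have "(\<Prod>j\<leftarrow>js. of_nat j) \<noteq> (0 :: complex)" using js(1) by (induction js) auto
  ultimately show ?thesis using v0 by simp
qed

lemma low_v0_Ann: "(a, b) \<in> IX 0 \<Longrightarrow> b < a \<Longrightarrow> em a b v0 \<in> Ann"
proof -
  assume ab: "(a, b) \<in> IX 0" "b < a"
  have "q 0 v0 = 0" by (simp add: q_def v0_weight[OF Ht_cartan] c0_def)
  then have "q (a - b) (em a b v0) = 0" using q_low[OF ab, of 0 v0] by (simp add: additive.zero[OF em_additive])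
  then show ?thesis using ab by (auto simp: Ann_def intro!: exI[of _ "[a - b]"])
qed

lemma h0_v0_Fsp: "x \<in> gdeg 0 \<Longrightarrow> x \<in> sl m n \<Longrightarrow> h0 x v0 \<in> Fsp {v0}"
proof (rule subspace_stableI[OF Fsp_subspace])
  fix a b assume ab: "(a, b) \<in> IX 0"
  then show "em a b v0 \<in> Fsp {v0}"
    by (cases a b rule: linorder_cases) (auto simp: em_v0 intro: Fsp.intros)
qed

lemma Fsp_v0_UNIV: "w \<in> Fsp {v0}"
proof -
  have "v0 \<in> Fsp {v0}" by (auto intro: Fsp.gen)
  then show ?thesis using irred[OF Fsp_subspace[of "{v0}"]] Fsp_stable[of "{v0}"] h0_v0_Fsp v0 by blast
qed

text \<open>By irreducibility lowering operators generate everything from the highest weight vector,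
  and one lowering step already leads into \<open>Ann\<close>.\<close>

lemma decomp: "\<exists>c. w - s c v0 \<in> Ann"
  using Fsp_v0_UNIV[of w]
proof (induction rule: Fsp.induct)
  case (gen g)
  then show ?case using subspace_0[OF Ann_subspace] by (auto intro: exI[of _ 1])
next
  case zero
  then show ?case using subspace_0[OF Ann_subspace] by (auto intro: exI[of _ 0])
next
  case (add u v)
  then obtain c d where "u - s c v0 \<in> Ann" "v - s d v0 \<in> Ann" by blast
  from subspace_add[OF Ann_subspace this] show ?case
    by (intro exI[of _ "c + d"]) (simp add: scale_left_distrib algebra_simps)
next
  case (scale v d)
  then obtain c where "v - s c v0 \<in> Ann" by blast
  from subspace_scale[OF Ann_subspace this, of d] show ?case
    by (intro exI[of _ "d * c"]) (simp add: scale_right_diff_distrib)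
next
  case (low v a b)
  then obtain c where c: "v - s c v0 \<in> Ann" by blast
  have "em a b v = em a b (v - s c v0) + s c (em a b v0)"
    by (simp add: additive.diff[OF em_additive] em_scale)
  then have "em a b v \<in> Ann"
    using Ann_low[OF c low.hyps(2,3)] low_v0_Ann[OF low.hyps(2,3)]
    by (metis Ann_subspace subspace_add subspace_scale)
  then show ?case by (intro exI[of _ 0]) simp
qed

text \<open>A product of factors \<open>q j\<close> with j > 0 kills the part of \<open>v1\<close>
  in \<open>Ann\<close>. On \<open>v1\<close> itself the product is a scalar: if it is nonzero,
  \<open>v1\<close> is a multiple of \<open>v0\<close>, and if it is zero, some factor reveals the
  eigenvalue.\<close>

lemma eigen_dichotomy:
  assumes v1: "h0 (pr Ht) v1 = s c1 v1"
  shows "(\<exists>c. v1 = s c v0) \<or> (\<exists>j>0. c1 = c0 - of_nat j)"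
proof -
  obtain c js where js: "0 \<notin> set js" "foldr q js (v1 - s c v0) = 0"
    using decomp[of v1] by (auto simp: Ann_def)
  define p where "p = (\<Prod>j\<leftarrow>js. c1 - c0 + of_nat j)"
  define r where "r = (\<Prod>j\<leftarrow>js. (of_nat j :: complex))"
  have e: "s p v1 = s (c * r) v0"
    using js(2) foldr_q_eigen[OF v1, of js] foldr_q_eigen[OF v0_weight[OF Ht_cartan], of js]
    by (simp add: additive.diff[OF foldr_q(1)] foldr_q(2) p_def r_def c0_def)
  show ?thesis
  proof (cases "p = 0")
    case True
    then have "\<exists>j\<in>set js. c1 - c0 + of_nat j = 0" unfolding p_def by (induction js) auto
    then obtain j where "j \<in> set js" "c1 = c0 - of_nat j" by (auto simp: algebra_simps eq_neg_iff_add_eq_0)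
    then show ?thesis using js(1) by (metis gr0I)
  next
    case False
    then have "v1 = s (inverse p) (s p v1)" by simp
    then have "v1 = s (inverse p * (c * r)) v0" unfolding e by simp
    then show ?thesis by blast
  qed
qed

lemma hw_unique:
  assumes v1: "v1 \<noteq> 0" and w1: "\<And>H. H \<in> cartan m n \<Longrightarrow> h0 H v1 = s (weight_eval m n \<nu> H) v1"
    and r1: "\<And>a b. (a, b) \<in> pos_even_pairs m n \<Longrightarrow> h0 (E a b) v1 = 0"
  shows "\<exists>c. v1 = s c v0" "weight_eq m n \<mu> \<nu>"
proof -
  \<comment> \<open>With the roles exchanged the dichotomy applies again; neither vector can lie
    strictly below the other in both directions.\<close>
  interpret H1: hw_rep m n s h0 \<nu> v1
    by unfold_locales (use irred v1 w1 r1 in auto)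
  show *: "\<exists>c. v1 = s c v0"
  proof -
    have "(\<exists>c. v1 = s c v0) \<or> (\<exists>j>0. H1.c0 = c0 - of_nat j)"
      using eigen_dichotomy[OF w1[OF Ht_cartan]] by (simp add: H1.c0_def)
    moreover have "(\<exists>c. v0 = s c v1) \<or> (\<exists>j>0. c0 = H1.c0 - of_nat j)"
      using H1.eigen_dichotomy[OF v0_weight[OF Ht_cartan]] by (simp add: c0_def)
    moreover have False if "H1.c0 = c0 - of_nat j" "c0 = H1.c0 - of_nat k" "0 < j" for j k
    proof -
      have "of_nat (j + k) = (0 :: complex)" using that by (simp add: algebra_simps)
      then show False using that unfolding of_nat_eq_0_iff by simp
    qed
    moreover have "\<exists>d. v1 = s d v0" if "v0 = s c v1" for c
    proof -
      have "c \<noteq> 0" using that v0 by auto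
      then have "v1 = s (inverse c) v0" using that by simp
      then show ?thesis by blast
    qed
    ultimately show ?thesis by blast
  qed
  then obtain c where c: "v1 = s c v0" "c \<noteq> 0" using v1 by force
  have "weight_eval m n \<mu> H = weight_eval m n \<nu> H" if H: "H \<in> cartan m n" for H
  proof -
    have "s (weight_eval m n \<mu> H) v1 = s (weight_eval m n \<nu> H) v1"
      using w1[OF H] v0_weight[OF H] h0_scale[OF cartan_gdeg[OF H] cartan_sl[OF H]]
      by (simp add: c mult.commute)
    then show ?thesis using v1 by simp
  qed
  then show "weight_eq m n \<mu> \<nu>" by (simp add: weight_eq_def)
qed

text \<open>If the Cartan part acts by zero on \<open>v0\<close>, raising operators never lead back
  to it from below. So the vectors one step below \<open>v0\<close> generate a submodule inside
  \<open>Ann\<close>, which must be zero; then \<open>v0\<close> is invariant, and the invariants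
  form a nonzero submodule.\<close>

lemma trivial_weight:
  assumes \<mu>: "\<And>H. H \<in> cartan m n \<Longrightarrow> weight_eval m n \<mu> H = 0"
    and x: "x \<in> gdeg 0" "x \<in> sl m n"
  shows "h0 x w = 0"
proof -
  define G where "G = {em a b v0 | a b. (a, b) \<in> IX 0 \<and> b < a}"
  have base: "h0 x v0 \<in> Fsp G" if "x \<in> gdeg 0" "x \<in> sl m n" for x
  proof (rule subspace_stableI[OF Fsp_subspace _ that])
    fix a b assume ab: "(a, b) \<in> IX 0"
    then have "a = b \<Longrightarrow> em a b v0 = 0" using em_v0 \<mu>[OF pr_unit_cartan[of a]] by (auto simp: IX_def)
    then show "em a b v0 \<in> Fsp G"
      using ab em_v0(1)[OF ab] by (cases a b rule: linorder_cases) (simp_all add: Fsp.zero, rule Fsp.gen, auto simp: G_def)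
  qed
  have stable: "h0 x g \<in> Fsp G" if g: "g \<in> G" and x: "x \<in> gdeg 0" "x \<in> sl m n" for g x
  proof -
    obtain a b where ab: "g = em a b v0" "(a, b) \<in> IX 0" "b < a" using g by (auto simp: G_def)
    note u = unit_IX[OF ab(2)]
    have "h0 x g = em a b (h0 x v0) + h0 (brk 0 0 x (pr (E a b))) v0"
      using ab by (simp add: em_def h0_rel[OF x pr_gdeg pr_sl] u)
    moreover have "brk 0 0 x (pr (E a b)) \<in> gdeg 0" "brk 0 0 x (pr (E a b)) \<in> sl m n"
      using brk_gdeg'[OF x(1) pr_gdeg[OF u]] brk_sl[OF x(1) pr_gdeg[OF u]] by auto
    ultimately show ?thesis using ab x base by (auto intro!: Fsp.add Fsp.low)
  qed
  have "Fsp G \<subseteq> Ann"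
  proof
    fix w assume "w \<in> Fsp G"
    then show "w \<in> Ann"
      by (induction rule: Fsp.induct)
        (auto simp: G_def intro: low_v0_Ann Ann_low subspace_0[OF Ann_subspace]
          subspace_add[OF Ann_subspace] subspace_scale[OF Ann_subspace])
  qed
  then have "v0 \<notin> Fsp G" using v0_notin_Ann[of 1] by auto
  then have z: "Fsp G = {0}"
    using irred[OF Fsp_subspace[of G]] Fsp_stable[of G] stable by blast
  define W where "W = {l. \<forall>x. x \<in> gdeg 0 \<longrightarrow> x \<in> sl m n \<longrightarrow> h0 x l = 0}"
  have "subspace W"
    unfolding subspace_def W_def by (auto simp: h0_add h0_scale additive.zero[OF h0_additive])
  moreover have "h0 x w \<in> W" if "x \<in> gdeg 0" "x \<in> sl m n" "w \<in> W" for x w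
    using that \<open>subspace W\<close> by (auto simp: W_def additive.zero[OF h0_additive])
  moreover have "v0 \<in> W" using base z by (auto simp: W_def)
  ultimately have "W = UNIV" using irred[of W] v0 by blast
  then show ?thesis using x by (auto simp: W_def)
qed

end

context block_dims_pos begin

lemma brk_0_gdeg: "h \<in> gdeg 0 \<Longrightarrow> x \<in> gdeg d \<Longrightarrow> brk 0 d h x \<in> gdeg d"
  using brk_gdeg[of h 0 x d] by simp

lemma brk_zero_left: "x \<in> gdeg e \<Longrightarrow> brk d e (0\<^sub>m N N) x = 0\<^sub>m N N"
  using gdeg_carrier[of x e] by (intro eq_matI) (auto simp: brk_def simp del: index_mult_mat(1))

lemma brk_zero_right: "x \<in> gdeg d \<Longrightarrow> brk d e x (0\<^sub>m N N) = 0\<^sub>m N N"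
  using gdeg_carrier[of x d] by (intro eq_matI) (auto simp: brk_def simp del: index_mult_mat(1))

end

section \<open>The highest weight vector of g_+1 and homomorphisms from g_+1 to M\<close>

locale block_dims_both = block_dims_pos +
  assumes m_pos: "0 < m" and n_pos: "0 < n"
begin

definition top1 :: "complex mat" where
  "top1 = E 0 (N - 1)"

lemma top1_gdeg: "top1 \<in> gdeg 1"
  using m_pos n_pos by (auto simp: top1_def blk_def)

lemma IX1_iff: "(i, j) \<in> IX 1 \<longleftrightarrow> i < m \<and> m \<le> j \<and> j < N"
  by (auto simp: IX_def blk_def split: if_splits)

lemma unit_minus_zero: "E a b - 0\<^sub>m N N = E a b"
  by (intro eq_matI) auto

text \<open>Two lowering steps reach every unit: one moves row 0 to row i, the other moves the last
  column to column j and costs a sign.\<close>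

lemma IX1_top: "(i, j) \<in> IX 1 \<Longrightarrow>
    E i j = (let x = (if i = 0 then top1 else brk 0 1 (E i 0) top1) in
      if j = N - 1 then x else (-1) \<cdot>\<^sub>m brk 0 1 (E (N - 1) j) x)"
  using m_pos n_pos by (auto simp: IX1_iff top1_def brk_units sg_def Let_def unit_minus_zero intro!: eq_matI)

lemma stable_top1:
  assumes add: "\<And>A B. A \<in> gdeg 1 \<Longrightarrow> B \<in> gdeg 1 \<Longrightarrow> P A \<Longrightarrow> P B \<Longrightarrow> P (A + B)"
    and smult: "\<And>A c. A \<in> gdeg 1 \<Longrightarrow> P A \<Longrightarrow> P (c \<cdot>\<^sub>m A)"
    and stable: "\<And>h A. h \<in> gdeg 0 \<Longrightarrow> h \<in> sl m n \<Longrightarrow> A \<in> gdeg 1 \<Longrightarrow> P A \<Longrightarrow> P (brk 0 1 h A)"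
    and top: "P top1" and A: "A \<in> gdeg 1"
  shows "P A"
proof (rule mat_units_induct[OF A add smult])
  have "0 \<cdot>\<^sub>m top1 = 0\<^sub>m N N" using top1_gdeg by (intro eq_matI) auto
  then show "P (0\<^sub>m N N)" using smult[OF top1_gdeg top, of 0] by simp
next
  fix i j assume ij: "(i, j) \<in> IX 1"
  have u: "E a b \<in> gdeg 0 \<and> E a b \<in> sl m n" if "(a, b) \<in> IX 0" "a \<noteq> b" for a b
    using pr_unit[OF that] pr_sl[of "E a b"] unit_gdeg[of b a 0] that by (auto simp: IX_def)
  have "(i, 0) \<in> IX 0" "(N - 1, j) \<in> IX 0"
    using ij m_pos n_pos unfolding IX1_iff by (auto simp: IX_def blk_def)
  note u1 = u[OF this(1)] and u2 = u[OF this(2)]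
  define x where "x = (if i = 0 then top1 else brk 0 1 (E i 0) top1)"
  have x: "x \<in> gdeg 1 \<and> P x"
    using u1 top stable top1_gdeg brk_0_gdeg by (auto simp: x_def)
  then have "P (if j = N - 1 then x else (-1) \<cdot>\<^sub>m brk 0 1 (E (N - 1) j) x)"
    using u2 by (auto intro!: smult stable brk_0_gdeg)
  then show "P (E i j)" by (subst IX1_top[OF ij]) (simp only: x_def Let_def)
qed auto

lemma cartan_mult_top1:
  assumes H: "H \<in> cartan m n"
  shows "brk 0 1 H top1 = weight_eval m n (alpha_max m n) H \<cdot>\<^sub>m top1"
proof -
  have "weight_eval m n (alpha_max m n) H = H $$ (0, 0) - H $$ (N - 1, N - 1)"
    using m_pos n_pos
    by (simp add: weight_eval_def alpha_max_def wroot_def eps_def left_diff_distrib sum_subtractf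
        if_distrib[of "\<lambda>x. x * _"] cong: if_cong)
  then show ?thesis
    using m_pos n_pos gdeg_carrier[OF cartan_gdeg[OF H]] cartan_diag[OF H]
    by (intro eq_matI) (auto simp: brk_def top1_def mult_unit_index sg_def simp del: index_mult_mat(1))
qed

lemma raise_top1: "(a, b) \<in> IX 0 \<Longrightarrow> a < b \<Longrightarrow> brk 0 1 (E a b) top1 = 0\<^sub>m N N"
  using m_pos n_pos by (auto simp: top1_def brk_units IX_def sg_def intro!: eq_matI)

text \<open>The coordinate of \<open>top1\<close> vanishes on everything obtained by lowering; on
  g_+1 it does what the complement \<open>Ann\<close> does on M.\<close>

lemma low_top_entry:
  assumes ab: "(a, b) \<in> IX 0" "b < a" and x: "x \<in> gdeg 1"
  shows "brk 0 1 (E a b) x $$ (0, N - 1) = 0"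
  using assms m_pos n_pos gdeg_carrier[OF x]
  by (auto simp: brk_def mult_unit_index IX_def simp del: index_mult_mat(1))

end

locale hw_rep_both = hw_rep m n s h0 \<mu> v0 + block_dims_both m n
  for m n :: nat and s :: "complex \<Rightarrow> 'l::ab_group_add \<Rightarrow> 'l" and h0 \<mu> v0
begin

text \<open>
  The submodule of \<open>M \<oplus> g\<^sub>+\<^sub>1\<close> generated by the pair of highest weight vectors: if the weights agree,
  it is the graph of a homomorphism \<open>g\<^sub>+\<^sub>1 \<rightarrow> M\<close>.
\<close>

inductive Graph :: "'l \<Rightarrow> complex mat \<Rightarrow> bool" where
  base: "Graph v0 top1"
| add: "Graph l x \<Longrightarrow> Graph l' x' \<Longrightarrow> Graph (l + l') (x + x')"
| scale: "Graph l x \<Longrightarrow> Graph (s c l) (c \<cdot>\<^sub>m x)"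
| low: "Graph l x \<Longrightarrow> (a, b) \<in> IX 0 \<Longrightarrow> b < a \<Longrightarrow> Graph (em a b l) (brk 0 1 (pr (E a b)) x)"

lemma Graph_gdeg: "Graph l x \<Longrightarrow> x \<in> gdeg 1"
  by (induction rule: Graph.induct) (auto intro!: top1_gdeg brk_0_gdeg pr_gdeg simp: unit_IX)

lemma Graph_zero: "Graph 0 (0\<^sub>m N N)"
proof -
  have "0 \<cdot>\<^sub>m top1 = 0\<^sub>m N N" using top1_gdeg by (intro eq_matI) auto
  then show ?thesis using Graph.scale[OF Graph.base, of 0] by simp
qed

lemma Graph_stable:
  assumes w: "Graph l x" and h: "h \<in> gdeg 0" "h \<in> sl m n"
    and \<mu>: "weight_eq m n \<mu> (alpha_max m n)"
  shows "Graph (h0 h l) (brk 0 1 h x)"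
  using w h
proof (induction arbitrary: h rule: Graph.induct)
  case base
  have "Graph (h0 (pr h) v0) (brk 0 1 (pr h) top1)"
    using base(1)
  proof (rule mat_units_induct)
    fix A B assume A: "A \<in> gdeg 0" and B: "B \<in> gdeg 0"
      and W: "Graph (h0 (pr A) v0) (brk 0 1 (pr A) top1)" "Graph (h0 (pr B) v0) (brk 0 1 (pr B) top1)"
    show "Graph (h0 (pr (A + B)) v0) (brk 0 1 (pr (A + B)) top1)"
      unfolding pr_add[OF A B] h0_mat_add[OF pr_gdeg[OF A] pr_sl[OF A] pr_gdeg[OF B] pr_sl[OF B]]
        brk_add_left[OF pr_gdeg[OF A] pr_gdeg[OF B] top1_gdeg]
      by (rule Graph.add[OF W])
  next
    fix A c assume A: "A \<in> gdeg 0" and W: "Graph (h0 (pr A) v0) (brk 0 1 (pr A) top1)"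
    show "Graph (h0 (pr (c \<cdot>\<^sub>m A)) v0) (brk 0 1 (pr (c \<cdot>\<^sub>m A)) top1)"
      unfolding pr_smult[OF A] h0_mat_scale[OF pr_gdeg[OF A] pr_sl[OF A]]
        brk_smult_left[OF pr_gdeg[OF A] top1_gdeg]
      by (rule Graph.scale[OF W])
  next
    have "pr (0\<^sub>m N N) = 0\<^sub>m N N" by (rule pr_id) auto
    then show "Graph (h0 (pr (0\<^sub>m N N)) v0) (brk 0 1 (pr (0\<^sub>m N N)) top1)"
      using h0_pr_zero[of v0] Graph_zero brk_zero_left[OF top1_gdeg] by simp
  next
    fix a b assume ab: "(a, b) \<in> IX 0"
    consider "a < b" | "a = b" | "b < a" by linarith
    then show "Graph (h0 (pr (E a b)) v0) (brk 0 1 (pr (E a b)) top1)"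
    proof cases
      case 1
      then show ?thesis using em_v0(1)[OF ab] raise_top1[OF ab] Graph_zero ab by (simp add: em_def pr_unit)
    next
      case 2
      \<comment> \<open>Here the equality of the weights enters: both components are scaled by the
        same eigenvalue.\<close>
      have H: "pr (E a a) \<in> cartan m n" using ab by (intro pr_unit_cartan) (auto simp: IX_def)
      show ?thesis using 2 Graph.scale[OF Graph.base] v0_weight[OF H] cartan_mult_top1[OF H] \<mu> H
        by (simp add: weight_eq_def)
    next
      case 3
      then show ?thesis using Graph.low[OF Graph.base ab] ab by (simp add: em_def)
    qed
  qed
  then show ?case using base by (simp add: pr_id)
next
  case (add l x l' x')
  then show ?case by (simp add: h0_add brk_add_right Graph_gdeg Graph.add)
next
  case (scale l x c)
  then show ?case by (simp add: h0_scale brk_smult_right Graph_gdeg Graph.scale)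
next
  case (low l x a b)
  note ab = unit_IX[OF low.hyps(2)]
  note g = pr_gdeg[OF ab] pr_sl[OF ab]
  have x: "x \<in> gdeg 1" using low.hyps(1) by (rule Graph_gdeg)
  have gb: "brk 0 0 h (pr (E a b)) \<in> gdeg 0" "brk 0 0 h (pr (E a b)) \<in> sl m n"
    using brk_0_gdeg[OF low.prems(1) g(1)] brk_sl[OF low.prems(1) g(1)] by auto
  have "h0 h (em a b l) = em a b (h0 h l) + h0 (brk 0 0 h (pr (E a b))) l"
    using low by (simp add: em_def h0_rel[OF low.prems g])
  moreover have "brk 0 1 h (brk 0 1 (pr (E a b)) x) =
      brk 0 1 (pr (E a b)) (brk 0 1 h x) + brk 0 1 (brk 0 0 h (pr (E a b))) x"
    using jacobi[OF low.prems(1) g(1) x] gdeg_dim[OF brk_0_gdeg[OF low.prems(1) brk_0_gdeg[OF g(1) x]]]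
      gdeg_dim[OF brk_0_gdeg[OF g(1) brk_0_gdeg[OF low.prems(1) x]]]
    by (intro eq_matI) (auto simp: sg_def)
  ultimately show ?case
    using low gb by (auto intro!: Graph.add Graph.low)
qed

text \<open>For x = 0 this puts l into \<open>Ann\<close>, so \<open>v0\<close> is not in the fibre
  over zero.\<close>

lemma Graph_top: "Graph l x \<Longrightarrow> l - s (x $$ (0, N - 1)) v0 \<in> Ann"
proof (induction rule: Graph.induct)
  case base
  have "top1 $$ (0, N - 1) = 1" using m_pos n_pos by (simp add: top1_def)
  then show ?case using subspace_0[OF Ann_subspace] by simp
next
  case (add l x l' x')
  have "x \<in> carrier_mat N N" "x' \<in> carrier_mat N N" using add Graph_gdeg gdeg_carrier by blast+
  then have "(x + x') $$ (0, N - 1) = x $$ (0, N - 1) + x' $$ (0, N - 1)" using N_pos by simp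
  then show ?case using subspace_add[OF Ann_subspace add.IH] by (simp add: scale_left_distrib algebra_simps)
next
  case (scale l x c)
  have "x \<in> carrier_mat N N" using scale Graph_gdeg gdeg_carrier by blast
  then have "(c \<cdot>\<^sub>m x) $$ (0, N - 1) = c * x $$ (0, N - 1)" using N_pos by simp
  then show ?case using subspace_scale[OF Ann_subspace scale.IH, of c] by (simp add: scale_right_diff_distrib)
next
  case (low l x a b)
  let ?c = "x $$ (0, N - 1)"
  have "brk 0 1 (pr (E a b)) x $$ (0, N - 1) = 0"
    using low low_top_entry Graph_gdeg by (simp add: pr_unit)
  moreover have "em a b l = em a b (l - s ?c v0) + s ?c (em a b v0)"
    by (simp add: additive.diff[OF em_additive] em_scale)
  then have "em a b l \<in> Ann"
    using Ann_low[OF low.IH low.hyps(2,3)] low_v0_Ann[OF low.hyps(2,3)]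
    by (metis Ann_subspace subspace_add subspace_scale)
  ultimately show ?case by simp
qed

text \<open>The fibre over zero is a submodule of M that misses \<open>v0\<close>, hence zero by
  irreducibility.\<close>

lemma Graph_unique:
  assumes \<mu>: "weight_eq m n \<mu> (alpha_max m n)" and w: "Graph l x" "Graph l' x"
  shows "l = l'"
proof -
  define W where "W = {l. Graph l (0\<^sub>m N N)}"
  have sub: "subspace W"
    unfolding subspace_def
  proof (intro conjI ballI allI)
    show "0 \<in> W" by (simp add: W_def Graph_zero)
  next
    fix u v assume "u \<in> W" "v \<in> W"
    then show "u + v \<in> W" using Graph.add[of u "0\<^sub>m N N" v "0\<^sub>m N N"] by (simp add: W_def)
  next
    fix c u assume "u \<in> W"
    then show "s c u \<in> W" using Graph.scale[of u "0\<^sub>m N N" c] by (simp add: W_def)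
  qed
  have "h0 h u \<in> W" if "h \<in> gdeg 0" "h \<in> sl m n" "u \<in> W" for h u
    using Graph_stable[of u "0\<^sub>m N N", OF _ that(1,2) \<mu>] that brk_zero_right[OF that(1)] by (simp add: W_def)
  moreover have "v0 \<notin> W"
    using Graph_top[of v0 "0\<^sub>m N N"] v0_notin_Ann[of 1] N_pos by (auto simp: W_def)
  ultimately have W: "W = {0}" using irred[OF sub] by blast
  have "x + (-1) \<cdot>\<^sub>m x = 0\<^sub>m N N" using gdeg_dim[OF Graph_gdeg[OF w(1)]] by (intro eq_matI) auto
  then have "Graph (l - l') (0\<^sub>m N N)" using Graph.add[OF w(1) Graph.scale[OF w(2), of "-1"]] by simp
  then have "l - l' \<in> W" by (simp add: W_def)
  then show ?thesis using W by simp
qed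

lemma equivariant_exists:
  assumes \<mu>: "weight_eq m n \<mu> (alpha_max m n)"
  shows "\<exists>f. (\<forall>A B. A \<in> gdeg 1 \<longrightarrow> B \<in> gdeg 1 \<longrightarrow> f (A + B) = f A + f B) \<and>
    (\<forall>A c. A \<in> gdeg 1 \<longrightarrow> f (c \<cdot>\<^sub>m A) = s c (f A)) \<and>
    (\<forall>h A. h \<in> gdeg 0 \<longrightarrow> h \<in> sl m n \<longrightarrow> A \<in> gdeg 1 \<longrightarrow> f (brk 0 1 h A) = h0 h (f A)) \<and> f top1 = v0"
proof -
  have ex: "\<exists>l. Graph l x" if "x \<in> gdeg 1" for x
    using _ _ _ _ that
  proof (rule stable_top1)
    show "\<exists>l. Graph l top1" using Graph.base by blast
  qed (blast intro: Graph.add Graph.scale Graph_stable \<mu>)+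
  define f where "f x = (THE l. Graph l x)" for x
  have f: "f x = l" if "Graph l x" for x l
    unfolding f_def using Graph_unique[OF \<mu>] that by blast
  have W: "Graph (f x) x" if "x \<in> gdeg 1" for x using ex[OF that] f by auto
  show ?thesis
    by (intro exI[of _ f] conjI allI impI f Graph.add Graph.scale Graph_stable \<mu> W Graph.base)
qed

lemma equivariant_zero:
  assumes add: "\<And>A B. A \<in> gdeg 1 \<Longrightarrow> B \<in> gdeg 1 \<Longrightarrow> f (A + B) = f A + f B"
    and smult: "\<And>A c. A \<in> gdeg 1 \<Longrightarrow> f (c \<cdot>\<^sub>m A) = s c (f A)"
    and eq: "\<And>h A. h \<in> gdeg 0 \<Longrightarrow> h \<in> sl m n \<Longrightarrow> A \<in> gdeg 1 \<Longrightarrow> f (brk 0 1 h A) = h0 h (f A)"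
    and top: "f top1 = 0" and x: "x \<in> gdeg 1"
  shows "f x = 0"
  by (rule stable_top1[where P = "\<lambda>x. f x = 0", OF _ _ _ top x])
    (simp_all add: add smult eq additive.zero[OF h0_additive])

text \<open>The image of \<open>top1\<close> is a highest weight vector of weight alpha_max, and M
  has only one line of highest weight vectors.\<close>

lemma equivariant_top:
  assumes add: "\<And>A B. A \<in> gdeg 1 \<Longrightarrow> B \<in> gdeg 1 \<Longrightarrow> f (A + B) = f A + f B"
    and smult: "\<And>A c. A \<in> gdeg 1 \<Longrightarrow> f (c \<cdot>\<^sub>m A) = s c (f A)"
    and eq: "\<And>h A. h \<in> gdeg 0 \<Longrightarrow> h \<in> sl m n \<Longrightarrow> A \<in> gdeg 1 \<Longrightarrow> f (brk 0 1 h A) = h0 h (f A)"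
    and nz: "f top1 \<noteq> 0"
  shows "weight_eq m n \<mu> (alpha_max m n)" "\<exists>c. f top1 = s c v0"
proof -
  have "h0 H (f top1) = s (weight_eval m n (alpha_max m n) H) (f top1)" if H: "H \<in> cartan m n" for H
    using eq[OF cartan_gdeg[OF H] cartan_sl[OF H] top1_gdeg] cartan_mult_top1[OF H] smult[OF top1_gdeg] by simp
  moreover have "h0 (E a b) (f top1) = 0" if "(a, b) \<in> pos_even_pairs m n" for a b
  proof -
    have ab: "(a, b) \<in> IX 0" "a < b" using that by (auto simp: pos_even_IX)
    have "E a b \<in> gdeg 0" "E a b \<in> sl m n"
      using pr_unit[OF ab(1)] pr_sl[OF unit_IX[OF ab(1)]] ab unit_IX by auto
    from eq[OF this top1_gdeg] have "h0 (E a b) (f top1) = f (0 \<cdot>\<^sub>m top1)"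
      using raise_top1[OF ab] top1_gdeg by (metis smult_zero_mat gdeg_zero smult scale_zero_left)
    then show ?thesis by (simp add: smult[OF top1_gdeg])
  qed
  ultimately show "weight_eq m n \<mu> (alpha_max m n)" "\<exists>c. f top1 = s c v0"
    using hw_unique[OF nz] by blast+
qed

end

section \<open>The Casimir operator and derivations of g_0\<close>

context g0_rep begin

lemma h0_brk: "A \<in> gdeg 0 \<Longrightarrow> A \<in> sl m n \<Longrightarrow> B \<in> gdeg 0 \<Longrightarrow> B \<in> sl m n \<Longrightarrow>
    h0 (brk 0 0 A B) v = h0 A (h0 B v) - h0 B (h0 A v)"
  using h0_rel[of A B v] by simp

text \<open>The Casimir element of the block diagonal part of gl for the trace form; through
  \<open>pr\<close> the central direction \<open>Dm\<close> acts by zero.\<close>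

definition Cas :: "'l \<Rightarrow> 'l" where
  "Cas l = (\<Sum>(a, b)\<in>IX 0. em a b (em b a l))"

lemma Cas_linear: "Cas (u + v) = Cas u + Cas v" "Cas (s c u) = s c (Cas u)"
  by (simp_all add: Cas_def split_def em_add em_scale sum.distrib scale_sum_right)

definition Bk :: "nat \<Rightarrow> nat set" where
  "Bk c = {b. (c, b) \<in> IX 0}"

lemma sum_IX_fst: "c < N \<Longrightarrow> (\<Sum>(a, b)\<in>IX 0. if a = c then g b else 0) = (\<Sum>b\<in>Bk c. g b :: 'l)"
proof -
  have "(\<Sum>(a, b)\<in>IX 0. if a = c then g b else 0) = (\<Sum>(a, b)\<in>Pair c ` Bk c. g b)"
    by (rule sum.mono_neutral_cong_right[OF finite_IX]) (auto simp: Bk_def)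
  also have "\<dots> = (\<Sum>b\<in>Bk c. g b)" by (subst sum.reindex) (auto simp: inj_on_def)
  finally show ?thesis .
qed

lemma sum_IX_snd: "c < N \<Longrightarrow> (\<Sum>(a, b)\<in>IX 0. if b = c then g a else 0) = (\<Sum>a\<in>Bk c. g a :: 'l)"
proof -
  have "(\<Sum>(a, b)\<in>IX 0. if b = c then g a else 0) = (\<Sum>(a, b)\<in>(\<lambda>a. (a, c)) ` Bk c. g a)"
    by (rule sum.mono_neutral_cong_right[OF finite_IX]) (auto simp: Bk_def IX0_swap[of c])
  also have "\<dots> = (\<Sum>a\<in>Bk c. g a)" by (subst sum.reindex) (auto simp: inj_on_def)
  finally show ?thesis .
qed

text \<open>The derivation is contracted with the tensor of all E_ab \<otimes> E_ba. When E_cd is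
  moved through the sum, the derivation rule for D leaves the Casimir operator on
  \<open>D (pr (E c d))\<close>, and the remaining bracket terms cancel since the tensor is
  invariant.\<close>

lemma Casimir_derivation_unit:
  assumes add: "\<And>A B. A \<in> gdeg 0 \<Longrightarrow> B \<in> gdeg 0 \<Longrightarrow> D (pr (A + B)) = D (pr A) + D (pr B)"
    and smult: "\<And>A c. A \<in> gdeg 0 \<Longrightarrow> D (pr (c \<cdot>\<^sub>m A)) = s c (D (pr A))"
    and der: "\<And>A B. A \<in> gdeg 0 \<Longrightarrow> A \<in> sl m n \<Longrightarrow> B \<in> gdeg 0 \<Longrightarrow> B \<in> sl m n \<Longrightarrow>
      D (brk 0 0 A B) = h0 A (D B) - h0 B (D A)"
    and cd: "(c, d) \<in> IX 0"
  shows "em c d (\<Sum>(a, b)\<in>IX 0. em a b (D (pr (E b a)))) = Cas (D (pr (E c d)))"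
proof -
  let ?X = "\<lambda>a b. D (pr (E a b))"
  have lt: "c < N" "d < N" using cd by (auto simp: IX_def)
  have Bk: "Bk c = Bk d" using cd by (auto simp: Bk_def IX_def)
  have x: "em c d (?X b a) = em b a (?X c d) + (if d = b then ?X c a else 0) - (if c = a then ?X b d else 0)"
    if "(a, b) \<in> IX 0" for a b
  proof -
    have ba: "(b, a) \<in> IX 0" using that IX0_swap by blast
    show ?thesis
      using linear_pr_brk_units[OF cd ba, of D, OF add smult]
        der[OF pr_gdeg pr_sl pr_gdeg pr_sl, OF unit_IX[OF cd] unit_IX[OF cd] unit_IX[OF ba] unit_IX[OF ba]] cd ba
      by (simp add: em_def algebra_simps)
  qed
  have t: "em c d (em a b (?X b a)) = em a b (em b a (?X c d)) + (if b = d then em a d (?X c a) else 0)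
      - (if a = c then em c b (?X b d) else 0) + (if a = d then em c b (?X b d) else 0)
      - (if b = c then em a d (?X c a) else 0)"
    if "(a, b) \<in> IX 0" for a b
    using em_comm[OF cd that, of "?X b a"] x[OF that]
    by (auto simp: em_add additive.diff[OF em_additive] additive.zero[OF em_additive])
  have "em c d (\<Sum>(a, b)\<in>IX 0. em a b (?X b a)) = (\<Sum>(a, b)\<in>IX 0. em c d (em a b (?X b a)))"
    by (simp add: additive.sum[OF em_additive] split_def)
  also have "\<dots> = (\<Sum>(a, b)\<in>IX 0. em a b (em b a (?X c d)) + (if b = d then em a d (?X c a) else 0)
      - (if a = c then em c b (?X b d) else 0) + (if a = d then em c b (?X b d) else 0)
      - (if b = c then em a d (?X c a) else 0))"
    by (rule sum.cong) (auto simp: t)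
  also have "\<dots> = Cas (?X c d) + (\<Sum>(a, b)\<in>IX 0. if b = d then em a d (?X c a) else 0)
      - (\<Sum>(a, b)\<in>IX 0. if a = c then em c b (?X b d) else 0) + (\<Sum>(a, b)\<in>IX 0. if a = d then em c b (?X b d) else 0)
      - (\<Sum>(a, b)\<in>IX 0. if b = c then em a d (?X c a) else 0)"
    by (simp add: Cas_def sum.distrib sum_subtractf split_def)
  \<comment> \<open>The four sums become sums over the blocks of c and d, which coincide; they
    cancel in pairs.\<close>
  also have "\<dots> = Cas (?X c d)"
    using sum_IX_snd[of d "\<lambda>a. em a d (?X c a)"] sum_IX_snd[of c "\<lambda>a. em a d (?X c a)"]
      sum_IX_fst[of c "\<lambda>b. em c b (?X b d)"] sum_IX_fst[of d "\<lambda>b. em c b (?X b d)"] lt Bk by simp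
  finally show ?thesis .
qed

lemma Casimir_derivation:
  assumes add: "\<And>A B. A \<in> gdeg 0 \<Longrightarrow> A \<in> sl m n \<Longrightarrow> B \<in> gdeg 0 \<Longrightarrow> B \<in> sl m n \<Longrightarrow> D (A + B) = D A + D B"
    and smult: "\<And>A c. A \<in> gdeg 0 \<Longrightarrow> A \<in> sl m n \<Longrightarrow> D (c \<cdot>\<^sub>m A) = s c (D A)"
    and der: "\<And>A B. A \<in> gdeg 0 \<Longrightarrow> A \<in> sl m n \<Longrightarrow> B \<in> gdeg 0 \<Longrightarrow> B \<in> sl m n \<Longrightarrow>
      D (brk 0 0 A B) = h0 A (D B) - h0 B (D A)"
    and x: "x \<in> gdeg 0" "x \<in> sl m n"
  shows "h0 x (\<Sum>(a, b)\<in>IX 0. em a b (D (pr (E b a)))) = Cas (D x)"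
proof -
  have add': "D (pr (A + B)) = D (pr A) + D (pr B)" if "A \<in> gdeg 0" "B \<in> gdeg 0" for A B
    using that by (simp add: pr_add add pr_gdeg pr_sl)
  have smult': "D (pr (c \<cdot>\<^sub>m A)) = s c (D (pr A))" if "A \<in> gdeg 0" for A c
    using that by (simp add: pr_smult smult pr_gdeg pr_sl)
  let ?w = "\<Sum>(a, b)\<in>IX 0. em a b (D (pr (E b a)))"
  have unit: "h0 (pr (E a b)) ?w = Cas (D (pr (E a b)))" if "(a, b) \<in> IX 0" for a b
    using Casimir_derivation_unit[of D, OF add' smult' der that] that em_def[of a b ?w] by simp
  have "h0 (pr x) ?w = Cas (D (pr x))"
    by (rule lin_ext[of 0 "\<lambda>x. h0 (pr x) ?w" s "\<lambda>x. Cas (D (pr x))"])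
      (simp_all add: h0_pr_add h0_pr_smult add' smult' Cas_linear x unit)
  then show ?thesis using x by (simp add: pr_id)
qed

end

context hw_rep begin

definition tt :: "nat \<Rightarrow> complex" where
  "tt a = weight_eval m n \<mu> (pr (E a a))"

text \<open>
  The eigenvalue \<open>(\<mu>, \<mu> + 2\<rho>\<^sub>0)\<close> of the Casimir operator, for the trace form of the block diagonal
  matrices; unlike the supertrace form it is positive.
\<close>

definition casval :: complex where
  "casval = (\<Sum>(a, b)\<in>IX 0. if a = b then tt a * tt a else if a < b then tt a - tt b else 0)"

lemma Cas_v0: "Cas v0 = s casval v0"
proof -
  have "em a b (em b a v0) = s (if a = b then tt a * tt a else if a < b then tt a - tt b else 0) v0"
    if ab: "(a, b) \<in> IX 0" for a b
  proof -
    have ba: "(b, a) \<in> IX 0" "(a, a) \<in> IX 0" "(b, b) \<in> IX 0" using ab by (auto simp: IX_def)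
    consider "a < b" | "a = b" | "b < a" by linarith
    then show ?thesis
    proof cases
      case 1
      then show ?thesis
        using em_comm[OF ab ba(1), of v0] em_v0(1)[OF ab] em_v0(2)[OF ba(2)] em_v0(2)[OF ba(3)]
        by (simp add: additive.zero[OF em_additive] tt_def scale_left_diff_distrib)
    next
      case 2
      then show ?thesis using em_v0(2)[OF ba(2)] by (simp add: em_scale tt_def)
    next
      case 3
      then show ?thesis using em_v0(1)[OF ba(1)] by (simp add: additive.zero[OF em_additive])
    qed
  qed
  then show ?thesis unfolding Cas_def casval_def scale_sum_left by (auto intro!: sum.cong)
qed

lemma Cas_scalar: "Cas l = s casval l"
proof -
  define W where "W = {l. Cas l = s casval l}"
  have "subspace W"
    using Cas_linear(2)[of 0 0] by (auto simp: W_def subspace_def Cas_linear scale_right_distrib mult.commute)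
  moreover have "h0 x l \<in> W" if "x \<in> gdeg 0" "x \<in> sl m n" "l \<in> W" for x l
  proof -
    \<comment> \<open>For an inner derivation the contraction is \<open>Cas l\<close>, so the
      identity says that the Casimir operator commutes with the action.\<close>
    have "h0 x (\<Sum>(a, b)\<in>IX 0. em a b (h0 (pr (E b a)) l)) = Cas (h0 x l)"
      by (rule Casimir_derivation[of "\<lambda>x. h0 x l"])
        (use that in \<open>auto simp: h0_mat_add h0_mat_scale intro: h0_brk\<close>)
    moreover have "(\<Sum>(a, b)\<in>IX 0. em a b (h0 (pr (E b a)) l)) = Cas l"
      unfolding Cas_def by (intro sum.cong) (auto simp: em_def IX0_swap)
    ultimately show ?thesis using that by (simp add: W_def h0_scale)
  qed
  moreover have "v0 \<in> W" by (simp add: W_def Cas_v0)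
  ultimately have "W = UNIV" using irred[of W] v0 by blast
  then show ?thesis by (auto simp: W_def)
qed

text \<open>\<open>casval\<close> is a sum of nonnegative terms, squares of real numbers on the
  diagonal and dominance differences above it. If it were zero, all \<open>tt a\<close> would
  vanish, and with them the weight on h.\<close>

lemma derivation_inner:
  assumes real: "\<And>a. a < N \<Longrightarrow> tt a \<in> \<real>"
    and dom: "\<And>a b. (a, b) \<in> pos_even_pairs m n \<Longrightarrow> tt a - tt b \<in> \<real>\<^sub>\<ge>\<^sub>0"
    and nontriv: "\<not> (\<forall>H\<in>cartan m n. weight_eval m n \<mu> H = 0)"
    and add: "\<And>A B. A \<in> gdeg 0 \<Longrightarrow> A \<in> sl m n \<Longrightarrow> B \<in> gdeg 0 \<Longrightarrow> B \<in> sl m n \<Longrightarrow> D (A + B) = D A + D B"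
    and smult: "\<And>A c. A \<in> gdeg 0 \<Longrightarrow> A \<in> sl m n \<Longrightarrow> D (c \<cdot>\<^sub>m A) = s c (D A)"
    and der: "\<And>A B. A \<in> gdeg 0 \<Longrightarrow> A \<in> sl m n \<Longrightarrow> B \<in> gdeg 0 \<Longrightarrow> B \<in> sl m n \<Longrightarrow>
      D (brk 0 0 A B) = h0 A (D B) - h0 B (D A)"
  shows "\<exists>w. \<forall>x. x \<in> gdeg 0 \<longrightarrow> x \<in> sl m n \<longrightarrow> D x = h0 x w"
proof -
  have "casval \<noteq> 0"
  proof
    assume z: "casval = 0"
    let ?g = "\<lambda>(a, b). Re (if a = b then tt a * tt a else if a < b then tt a - tt b else 0)"
    have nn: "0 \<le> ?g p" if "p \<in> IX 0" for p
    proof -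
      obtain a b where p: "p = (a, b)" by force
      have "a < N" using that p by (auto simp: IX_def)
      then have "0 \<le> Re (tt a * tt a)" using real[of a] by (auto elim!: Reals_cases)
      moreover have "a < b \<Longrightarrow> 0 \<le> Re (tt a - tt b)"
        using dom[of a b] that p by (auto simp: pos_even_IX complex_nonneg_Reals_iff)
      ultimately show ?thesis by (auto simp: p)
    qed
    have "(\<Sum>p\<in>IX 0. ?g p) = Re casval" by (simp add: casval_def split_def)
    then have "\<forall>p\<in>IX 0. ?g p = 0" using z nn by (simp add: sum_nonneg_eq_0_iff[OF finite_IX] del: sum_nonneg_eq_0_iff)
    then have "tt a = 0" if "a < N" for a
    proof -
      have "(a, a) \<in> IX 0" using that by (simp add: IX_def)
      with \<open>\<forall>p\<in>IX 0. ?g p = 0\<close> have "?g (a, a) = 0" by (rule bspec)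
      then show ?thesis using real[OF that] by (auto elim!: Reals_cases)
    qed
    then have "weight_eval m n \<mu> H = 0" if "H \<in> cartan m n" for H
      unfolding weight_eval_units[OF that] by (auto simp: tt_def)
    then show False using nontriv by blast
  qed
  define w where "w = (\<Sum>(a, b)\<in>IX 0. em a b (D (pr (E b a))))"
  \<comment> \<open>The contraction \<open>w\<close> satisfies x w = Cas (D x), and the Casimir
    operator is the nonzero scalar \<open>casval\<close>.\<close>
  have "D x = h0 x (s (inverse casval) w)" if "x \<in> gdeg 0" "x \<in> sl m n" for x
    using Casimir_derivation[of D, OF add smult der that] Cas_scalar[of "D x"] \<open>casval \<noteq> 0\<close> that
    by (simp add: h0_scale w_def)
  then show ?thesis by blast
qed

end

section \<open>The Kac module is the Grassmann model\<close>

context kac_setup begin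

text \<open>Only \<open>scl\<close> and \<open>act\<close> enter \<open>ind_map\<close>; the parity
  projection is a placeholder, and the bracket relation is available on \<open>X\<close>
  alone.\<close>

definition Xmod :: "(nat set \<Rightarrow> 'l) smodule" where
  "Xmod = \<lparr>scl = fs, evp = id, act = rho\<rparr>"

lemma Xmod_simps: "scl Xmod = fs" "act Xmod = rho"
  by (simp_all add: Xmod_def)

lemma foldr_rho_linear:
  "additive (foldr rho xs)" "foldr rho xs (fs c f) = fs c (foldr rho xs f)"
  by (induction xs) (simp_all add: additive_def rho_simps rho_fs)

lemma foldr_rho_X: "f \<in> X \<Longrightarrow> foldr rho xs f \<in> X"
  by (induction xs) (simp_all add: X_rho)

lemma rho_homog:
  assumes x: "x \<in> sl m n" "mat_homog m a x" and y: "y \<in> sl m n" "mat_homog m b y" and f: "f \<in> X"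
  shows "rho x (rho y f) = fs ((-1) ^ (a * b)) (rho y (rho x f)) + rho (sbracket m x y) f"
proof -
  note cx = sl_carrier[OF x(1)] and cy = sl_carrier[OF y(1)]
  define T' where "T' d e = rho (cut d x) (rho (cut e y) f) - fs ((-1) ^ (a * b)) (rho (cut e y) (rho (cut d x) f))
      - rho (sbracket m (cut d x) (cut e y)) f" for d e
  have T': "T' d e = 0" for d e
  proof (cases "even (d + int a) \<and> even (e + int b)")
    case True
    then show ?thesis using rho_bracket[OF cut_gdeg[of d x] cut_gdeg[of e y] f]
      by (simp add: T'_def bracket_at_def sbracket_brk[OF cut_gdeg cut_gdeg] sg_parity)
  next
    case False
    then have z: "cut d x = 0\<^sub>m N N \<or> cut e y = 0\<^sub>m N N"
      using cut_zero[OF x(2) cx] cut_zero[OF y(2) cy] by blast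
    have "sbracket m (cut d x) (cut e y) = 0\<^sub>m N N"
      unfolding sbracket_brk[OF cut_gdeg cut_gdeg]
      using z gdeg_carrier[OF cut_gdeg, of d x] gdeg_carrier[OF cut_gdeg, of e y]
      by (intro eq_matI) (auto simp: brk_def simp del: index_mult_mat(1))
    then show ?thesis using z by (auto simp: T'_def rho_simps)
  qed
  note c = cut_gdeg[THEN gdeg_carrier]
  have "rho x (rho y f) - fs ((-1) ^ (a * b)) (rho y (rho x f)) - rho (sbracket m x y) f =
     (\<Sum>d\<in>{-1,0,1}. \<Sum>e\<in>{-1,0,1}. T' d e)"
    using sbracket_sl[THEN sl_carrier, OF cut_sl cut_sl, OF x(1) y(1)]
    by (subst (1 2 3) cut_sum[OF cx], subst (1 2 3) cut_sum[OF cy])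
      (simp add: rho_mat_add c rho_simps sbracket_add_left sbracket_add_right T'_def
        fs.scale_right_distrib del: plus_fun_apply)
  then show ?thesis using T' by (simp add: algebra_simps del: plus_fun_apply)
qed

text \<open>The independence half of PBW: the relations identify nothing that the model
  distinguishes. The Lie relations hold because all words applied to the vacuum stay in
  \<open>X\<close>.\<close>

lemma ind_relations_X:
  assumes "f \<in> ind_relations m n L"
  shows "ind_map Xmod vac f = 0"
proof -
  interpret F: Modules.module free_scale by (rule module_free_scale)
  have vs: "vector_space (scl Xmod)" unfolding Xmod_simps by unfold_locales
  note ims = ind_map_add[OF vs] ind_map_diff[OF vs] ind_map_scale[OF vs] ind_map_gen[OF vs] Xmod_simps
  note fr = additive.add[OF foldr_rho_linear(1)] additive.diff[OF foldr_rho_linear(1)]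
    additive.zero[OF foldr_rho_linear(1)] foldr_rho_linear(2)
  have "F.subspace {f. ind_map Xmod vac f = 0}"
    unfolding F.subspace_def by (simp add: ims) (simp add: ind_map_def)
  moreover have "ind_map Xmod vac f = 0"
    if "f \<in> tensor_rels m n L \<union> env_rels m n \<union> balance_rels m n L" for f
    using that
  proof (elim UnE)
    assume "f \<in> tensor_rels m n L"
    then show ?thesis unfolding tensor_rels_def
      by (auto simp: ims rho_mat_add rho_mat_smult sl_carrier fr additive.add[OF vac_additive] fs_vac[symmetric]
         simp del: plus_fun_apply)
  next
    assume "f \<in> env_rels m n"
    then obtain xs ys x y a b l where f: "f = gen (xs @ [x, y] @ ys) l
        - free_scale ((-1) ^ (a * b)) (gen (xs @ [y, x] @ ys) l) - gen (xs @ [sbracket m x y] @ ys) l"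
      and h: "x \<in> sl m n" "mat_homog m a x" "y \<in> sl m n" "mat_homog m b y"
      unfolding env_rels_def by blast
    show ?thesis unfolding f using rho_homog[OF h foldr_rho_X[OF X_vac]]
      by (simp add: ims fr del: plus_fun_apply)
  next
    assume "f \<in> balance_rels m n L"
    then obtain xs p l where f: "f = gen (xs @ [p]) l - gen xs (act L p l)" and p: "p \<in> sl_para m n"
      unfolding balance_rels_def by blast
    from p obtain A B where AB: "p = A + B" "A \<in> gdeg 0" "A \<in> sl m n" "B \<in> gdeg 1"
      unfolding sl_para_def G0_zero G1_plus by blast
    have "act L p l = act L A l"
      using AB L_plus[of B l] by (simp add: actL_mat_add para_0 para_1 G1_plus)
    then have "rho p (vac l) = vac (act L p l)"
      using AB by (simp add: rho_mat_add gdeg_carrier rho_vac_0 rho_vac_1 lev_act)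
    then show ?thesis unfolding f by (simp add: ims)
  qed
  ultimately show ?thesis
    using F.span_induct[of f _ "\<lambda>f. ind_map Xmod vac f = 0"] assms unfolding ind_relations_def by blast
qed

text \<open>The graph of the comparison map from V to the model. A vector of V has many expressions
  by words, so the map starts as a relation.\<close>

inductive Rel :: "'v \<Rightarrow> (nat set \<Rightarrow> 'l) \<Rightarrow> bool" where
  word: "xs \<in> lists (sl m n) \<Longrightarrow> Rel (foldr (act V) xs (\<iota> l)) (foldr rho xs (vac l))"
| add: "Rel v w \<Longrightarrow> Rel v' w' \<Longrightarrow> Rel (v + v') (w + w')"
| scale: "Rel v w \<Longrightarrow> Rel (scl V c v) (fs c w)"

lemma Rel_base: "Rel (\<iota> l) (vac l)"
  using Rel.word[of "[]" l] by simp

lemma Rel_act: "Rel v w \<Longrightarrow> x \<in> sl m n \<Longrightarrow> Rel (act V x v) (rho x w)"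
proof (induction rule: Rel.induct)
  case (word xs l)
  then show ?case using Rel.word[of "x # xs" l] by simp
next
  case (add v w v' w')
  then show ?case using Rel.add by (simp add: actV_add rho_simps del: plus_fun_apply)
next
  case (scale v w c)
  then show ?case using Rel.scale by (simp add: actV_scale rho_fs)
qed

lemma Rel_diff: "Rel v w \<Longrightarrow> Rel v' w' \<Longrightarrow> Rel (v - v') (w - w')"
  using Rel.add[of v w "scl V (-1) v'" "fs (-1) w'"] Rel.scale[of v' w' "-1"] by simp

lemma Rel_X: "Rel v w \<Longrightarrow> w \<in> X"
  by (induction rule: Rel.induct) (auto intro: X_add X_fs foldr_rho_X X_vac simp del: plus_fun_apply)

lemma Rel_free:
  "Rel v w \<Longrightarrow> \<exists>f\<in>free_carrier m n. ind_map V \<iota> f = v \<and> ind_map Xmod vac f = w"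
proof (induction rule: Rel.induct)
  have vs: "vector_space (scl Xmod)" unfolding Xmod_simps by unfold_locales
  have vv: "vector_space (scl V)" by unfold_locales
  {
    case (word xs l)
    then show ?case
      by (intro bexI[of _ "gen xs l"]) (auto simp: ind_map_gen[OF vs] ind_map_gen[OF vv] Xmod_simps free_carrier_def)
  next
    case (add v w v' w')
    then obtain f f' where "f \<in> free_carrier m n" "f' \<in> free_carrier m n" "ind_map V \<iota> f = v"
      "ind_map Xmod vac f = w" "ind_map V \<iota> f' = v'" "ind_map Xmod vac f' = w'" by blast
    moreover from this have "f + f' \<in> free_carrier m n"
      using Poly_Mapping.keys_add[of f f'] by (auto simp: free_carrier_def)
    ultimately show ?case by (intro bexI[of _ "f + f'"]) (auto simp: ind_map_add[OF vs] ind_map_add[OF vv])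
  next
    case (scale v w c)
    then obtain f where "f \<in> free_carrier m n" "ind_map V \<iota> f = v" "ind_map Xmod vac f = w" by blast
    moreover from this have "free_scale c f \<in> free_carrier m n"
      by (auto simp: free_carrier_def in_keys_iff lookup_free_scale)
    ultimately show ?case by (intro bexI[of _ "free_scale c f"])
       (auto simp: ind_map_scale[OF vs] ind_map_scale[OF vv] Xmod_simps)
  }
qed

text \<open>A pair over 0 comes from an element in the kernel of \<open>ind_map V \<iota>\<close>;
  this kernel consists of relations, and they vanish in the model.\<close>

lemma Rel_unique: "Rel v w \<Longrightarrow> Rel v w' \<Longrightarrow> w = w'"
proof -
  assume "Rel v w" "Rel v w'"
  then have "Rel 0 (w - w')" using Rel_diff by fastforce
  then obtain f where "f \<in> free_carrier m n" "ind_map V \<iota> f = 0" "ind_map Xmod vac f = w - w'"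
    using Rel_free by blast
  then show ?thesis using ind ind_relations_X[of f] unfolding induced_module_def by auto
qed

lemma Rel_total: "\<exists>w. Rel v w"
proof -
  have "v \<in> ind_map V \<iota> ` free_carrier m n" using ind by (simp add: induced_module_def)
  then obtain f where f: "f \<in> free_carrier m n" and v: "v = ind_map V \<iota> f" by blast
  have "\<exists>w. Rel (\<Sum>k\<in>S. scl V (Poly_Mapping.lookup f k) (foldr (act V) (fst k) (\<iota> (snd k)))) w"
    if "finite S" "S \<subseteq> Poly_Mapping.keys f" for S
    using that
  proof (induction S rule: finite_induct)
    case empty
    have "Rel (scl V 0 (\<iota> 0)) (fs 0 (vac 0))" by (intro Rel.scale Rel_base)
    then show ?case by (auto intro: exI)
  next
    case (insert k S)
    then have "fst k \<in> lists (sl m n)" using f by (auto simp: free_carrier_def)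
    from Rel.word[OF this, of "snd k"] show ?case using insert
      by (auto intro: Rel.add Rel.scale)
  qed
  from this[of "Poly_Mapping.keys f"] show ?thesis unfolding v ind_map_def by simp
qed

definition Phi :: "'v \<Rightarrow> nat set \<Rightarrow> 'l" where
  "Phi v = (THE w. Rel v w)"

lemma Rel_Phi: "Rel v (Phi v)"
  unfolding Phi_def using Rel_total Rel_unique by (metis theI')

lemma Phi_eqI: "Rel v w \<Longrightarrow> Phi v = w"
  using Rel_Phi Rel_unique by blast

lemma Phi_add: "Phi (u + v) = Phi u + Phi v"
  and Phi_scale: "Phi (scl V c v) = fs c (Phi v)"
  and Phi_act: "x \<in> sl m n \<Longrightarrow> Phi (act V x v) = rho x (Phi v)"
  and Phi_iota: "Phi (\<iota> l) = vac l"
  and Phi_X: "Phi v \<in> X"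
  by (auto intro!: Phi_eqI Rel.add Rel.scale Rel_act Rel_Phi Rel_base simp: Rel_X[OF Rel_Phi])

lemma Phi_additive: "additive Phi" by (simp add: additive_def Phi_add)

lemma unit_K: "m \<le> \<nu> \<Longrightarrow> \<nu> < N \<Longrightarrow> i < m \<Longrightarrow> E \<nu> i \<in> gdeg (-1)"
  by (auto simp: blk_def)

lemma unit_K_sl: "m \<le> \<nu> \<Longrightarrow> \<nu> < N \<Longrightarrow> i < m \<Longrightarrow> E \<nu> i \<in> sl m n"
  using unit_K gdeg_sl by fastforce

definition yk :: "nat \<Rightarrow> 'v \<Rightarrow> 'v" where
  "yk k = act V (case prod_decode k of (\<nu>, i) \<Rightarrow> E \<nu> i)"

lemma yk_sl: "k \<in> K \<Longrightarrow> (case prod_decode k of (\<nu>, i) \<Rightarrow> E \<nu> i) \<in> sl m n"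
  by (auto simp: K_def unit_K_sl)

lemma yk_gdeg: "k \<in> K \<Longrightarrow> (case prod_decode k of (\<nu>, i) \<Rightarrow> E \<nu> i) \<in> gdeg (-1)"
  by (auto simp: K_def unit_K)

lemma Phi_yk: "k \<in> K \<Longrightarrow> Phi (yk k v) = theta k (Phi v)"
  using yk_sl[of k] by (auto simp: yk_def Phi_act K_def rho_theta)

lemma Phi_surj: "f \<in> X \<Longrightarrow> \<exists>v. Phi v = f"
proof (induction f rule: X_induct)
  case (vac l)
  then show ?case using Phi_iota by blast
next
  case (add f g)
  then show ?case using Phi_add by metis
next
  case (theta k f)
  then show ?case using Phi_yk by metis
qed

lemma yk_anticomm: "k \<in> K \<Longrightarrow> l \<in> K \<Longrightarrow> yk k (yk l v) = - yk l (yk k v)"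
proof -
  assume kl: "k \<in> K" "l \<in> K"
  have "brk (-1) (-1) (case prod_decode k of (\<nu>, i) \<Rightarrow> E \<nu> i) (case prod_decode l of (\<nu>, i) \<Rightarrow> E \<nu> i) = 0\<^sub>m N N"
    by (rule gdeg_trivial[OF brk_gdeg[OF yk_gdeg yk_gdeg]]) (use kl in auto)
  moreover have "act V (0\<^sub>m N N) v = 0" using actV_mat_scale[of "0\<^sub>m N N" 0 v] by auto
  ultimately show ?thesis
    using actV_rel[OF yk_gdeg yk_sl yk_gdeg yk_sl, of k l v] kl by (simp add: yk_def sg_def)
qed

lemma yk_additive: "k \<in> K \<Longrightarrow> additive (yk k)"
  unfolding yk_def by (intro actV_additive yk_sl)

lemma yk_sq: "k \<in> K \<Longrightarrow> yk k (yk k v) = 0"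
proof -
  assume k: "k \<in> K"
  have "yk k (yk k v) + yk k (yk k v) = 0" using yk_anticomm[OF k k, of v] by (metis add.right_inverse)
  then have "scl V 2 (yk k (yk k v)) = 0" using Vv.scale_left_distrib[of 1 1] by simp
  then show ?thesis by simp
qed

lemma iota_additive: "additive \<iota>"
proof -
  have "gen [] (l + l') - gen [] l - gen [] l' \<in> ind_relations m n L" for l l' :: 'l
    unfolding ind_relations_def
    by (rule Modules.module.span_base[OF module_free_scale], unfold tensor_rels_def, rule UnI1, rule UnI1,
        rule UnI1, rule UnI2, rule CollectI, rule exI[of _ "[]"], rule exI[of _ l], rule exI[of _ l']) simp
  then have "ind_map V \<iota> (gen [] (l + l') - gen [] l - gen [] l') = 0" for l l' :: 'l
    using ind unfolding induced_module_def by blast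
  then show ?thesis
    by (simp add: additive_def ind_map_diff[OF Vv.vector_space_axioms] ind_map_gen[OF Vv.vector_space_axioms]
        ind_map_add[OF Vv.vector_space_axioms] algebra_simps)
qed

lemma iota_act: "p \<in> sl_para m n \<Longrightarrow> act V p (\<iota> l) = \<iota> (act L p l)"
proof -
  assume p: "p \<in> sl_para m n"
  then have "gen ([] @ [p]) l - gen [] (act L p l) \<in> balance_rels m n L"
    unfolding balance_rels_def by blast
  then have "gen ([] @ [p]) l - gen [] (act L p l) \<in> ind_relations m n L"
    unfolding ind_relations_def by (intro Modules.module.span_base[OF module_free_scale]) auto
  then have "ind_map V \<iota> (gen ([] @ [p]) l - gen [] (act L p l)) = 0"
    using ind unfolding induced_module_def by blast
  then show ?thesis
    by (simp add: ind_map_diff[OF Vv.vector_space_axioms] ind_map_gen[OF Vv.vector_space_axioms])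
qed

text \<open>What g_-1 generates from the image of L. It is stable under g_0 and then under g_+1, as
  each bracket with g_-1 falls into the part treated before; this is the spanning half of
  PBW.\<close>

inductive_set Ysp :: "'v set" where
  iota: "\<iota> l \<in> Ysp"
| add: "u \<in> Ysp \<Longrightarrow> v \<in> Ysp \<Longrightarrow> u + v \<in> Ysp"
| scale: "v \<in> Ysp \<Longrightarrow> scl V c v \<in> Ysp"
| yk: "k \<in> K \<Longrightarrow> v \<in> Ysp \<Longrightarrow> yk k v \<in> Ysp"

lemma zero_Ysp: "0 \<in> Ysp"
  using Ysp.scale[OF Ysp.iota, of 0 0] by simp

lemma Ysp_sum: "(\<And>i. i \<in> I \<Longrightarrow> f i \<in> Ysp) \<Longrightarrow> sum f I \<in> Ysp"
  by (induction I rule: infinite_finite_induct) (auto intro: zero_Ysp Ysp.add)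

lemma Ysp_minus1: "A \<in> gdeg (-1) \<Longrightarrow> v \<in> Ysp \<Longrightarrow> act V A v \<in> Ysp"
proof -
  assume A: "A \<in> gdeg (-1)" and v: "v \<in> Ysp"
  have "act V A v = (\<Sum>(a, b)\<in>IX (-1). scl V (A $$ (a, b)) (act V (E a b) v))"
    by (rule mat_sum_units[of "-1" "\<lambda>A. act V A v" "scl V"])
      (auto simp: actV_mat_add actV_mat_scale gdeg_sl[of _ "-1"] A)
  moreover have "act V (E a b) v \<in> Ysp" if "(a, b) \<in> IX (-1)" for a b
  proof -
    have "m \<le> a" "a < N" "b < m" using that by (auto simp: IX_def blk_def split: if_splits)
    then show ?thesis using Ysp.yk[OF enc_K v, of a b] by (simp add: yk_def)
  qed
  ultimately show ?thesis by (auto intro!: Ysp_sum Ysp.scale)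
qed

lemma Ysp_0:
  assumes v: "v \<in> Ysp" shows "A \<in> gdeg 0 \<Longrightarrow> A \<in> sl m n \<Longrightarrow> act V A v \<in> Ysp"
  using v
proof (induction arbitrary: A rule: Ysp.induct)
  case (iota l)
  then show ?case by (simp add: iota_act para_0 Ysp.iota)
next
  case (add u v)
  then show ?case by (simp add: actV_add Ysp.add)
next
  case (scale v c)
  then show ?case by (simp add: actV_scale Ysp.scale)
next
  case (yk k v)
  note yk' = yk_gdeg[OF yk.hyps(1)] yk_sl[OF yk.hyps(1)]
  have "act V (brk 0 (-1) A (case prod_decode k of (\<nu>, i) \<Rightarrow> E \<nu> i)) v \<in> Ysp"
    using yk yk' by (intro Ysp_minus1 brk_gdeg') auto
  then show ?case using yk actV_rel[OF yk.prems yk', of v]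
    by (simp add: yk_def[symmetric] sg_def Ysp.add Ysp.yk)
qed

lemma Ysp_1:
  assumes v: "v \<in> Ysp" shows "A \<in> gdeg 1 \<Longrightarrow> act V A v \<in> Ysp"
  using v
proof (induction rule: Ysp.induct)
  case (iota l)
  then show ?case by (simp add: iota_act para_1 Ysp.iota)
next
  case (add u v)
  then show ?case by (simp add: actV_add Ysp.add gdeg_sl[of _ 1])
next
  case (scale v c)
  then show ?case by (simp add: actV_scale Ysp.scale gdeg_sl[of _ 1])
next
  case (yk k v)
  note yk' = yk_gdeg[OF yk.hyps(1)] yk_sl[OF yk.hyps(1)]
  have "act V (brk 1 (-1) A (case prod_decode k of (\<nu>, i) \<Rightarrow> E \<nu> i)) v \<in> Ysp"
    using yk yk' by (intro Ysp_0 brk_gdeg' brk_sl) auto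
  moreover have "scl V (-1) (yk k (act V A v)) \<in> Ysp" using yk by (intro Ysp.scale Ysp.yk) auto
  ultimately show ?case using yk actV_rel[OF yk.prems gdeg_sl[OF yk.prems] yk', of v] Ysp.add
    by (fastforce simp: yk_def[symmetric] sg_def)
qed

lemma Ysp_act:
  assumes v: "v \<in> Ysp" and x: "x \<in> sl m n"
  shows "act V x v \<in> Ysp"
proof -
  have "act V x v = act V (cut (-1) x) v + (act V (cut 0 x) v + act V (cut 1 x) v)"
    using cut_sum[OF sl_carrier[OF x]] x by (metis actV_mat_add cut_sl sl_add)
  then show ?thesis
    using Ysp_0[OF v cut_gdeg cut_sl[OF x]] Ysp_1[OF v cut_gdeg] Ysp_minus1[OF cut_gdeg v]
    by (simp add: Ysp.add)
qed

lemma Ysp_UNIV: "v \<in> Ysp"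
proof -
  have "Rel v w \<Longrightarrow> v \<in> Ysp" for w
  proof (induction rule: Rel.induct)
    case (word xs l)
    then show ?case by (induction xs) (auto intro: Ysp.iota Ysp_act)
  qed (auto intro: Ysp.add Ysp.scale)
  then show ?thesis using Rel_total by blast
qed

text \<open>
  Splitting off one creation operator at a time shows that \<open>Phi\<close> is injective without choosing a basis of
  ordered monomials.
\<close>

fun Ul :: "nat list \<Rightarrow> 'v set" where
  "Ul [] = range \<iota>"
| "Ul (k # ks) = {u + yk k v | u v. u \<in> Ul ks \<and> v \<in> Ul ks}"

lemma iota_scale: "scl V c (\<iota> l) = \<iota> (scl L c l)"
proof -
  have "gen [] (scl L c l) - free_scale c (gen [] l) \<in> ind_relations m n L"
    unfolding ind_relations_def
    by (rule Modules.module.span_base[OF module_free_scale], unfold tensor_rels_def, rule UnI1, rule UnI1,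
        rule UnI2, rule CollectI, rule exI[of _ "[]"], rule exI[of _ c], rule exI[of _ l]) simp
  then have "ind_map V \<iota> (gen [] (scl L c l) - free_scale c (gen [] l)) = 0"
    using ind unfolding induced_module_def by blast
  then show ?thesis
    by (simp add: ind_map_diff[OF Vv.vector_space_axioms] ind_map_gen[OF Vv.vector_space_axioms]
       ind_map_scale[OF Vv.vector_space_axioms])
qed

lemma yk_scale: "k \<in> K \<Longrightarrow> yk k (scl V c v) = scl V c (yk k v)"
  unfolding yk_def by (intro actV_scale yk_sl)

lemma Ul_ConsI: "u \<in> Ul ks \<Longrightarrow> v \<in> Ul ks \<Longrightarrow> u + yk k v \<in> Ul (k # ks)"
  by auto

lemma Ul_add: "set ks \<subseteq> K \<Longrightarrow> u \<in> Ul ks \<Longrightarrow> v \<in> Ul ks \<Longrightarrow> u + v \<in> Ul ks"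
proof (induction ks arbitrary: u v)
  case Nil
  then show ?case by (auto simp: additive.add[OF iota_additive, symmetric])
next
  case (Cons k ks)
  then obtain u1 u2 v1 v2 where "u = u1 + yk k u2" "v = v1 + yk k v2"
    "u1 \<in> Ul ks" "u2 \<in> Ul ks" "v1 \<in> Ul ks" "v2 \<in> Ul ks" by auto
  then have "u + v = (u1 + v1) + yk k (u2 + v2)" "u1 + v1 \<in> Ul ks" "u2 + v2 \<in> Ul ks"
    using Cons by (auto simp: additive.add[OF yk_additive] algebra_simps)
  then show ?case by auto
qed

lemma Ul_scale: "set ks \<subseteq> K \<Longrightarrow> u \<in> Ul ks \<Longrightarrow> scl V c u \<in> Ul ks"
proof (induction ks arbitrary: u)
  case Nil
  then show ?case by (auto simp: iota_scale)
next
  case (Cons k ks)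
  then obtain u1 u2 where "u = u1 + yk k u2" "u1 \<in> Ul ks" "u2 \<in> Ul ks" by auto
  then have "scl V c u = scl V c u1 + yk k (scl V c u2)" "scl V c u1 \<in> Ul ks" "scl V c u2 \<in> Ul ks"
    using Cons by (auto simp: yk_scale Vv.scale_right_distrib)
  then show ?case by auto
qed

lemma Ul_zero: "set ks \<subseteq> K \<Longrightarrow> 0 \<in> Ul ks"
proof (induction ks)
  case Nil
  then show ?case using additive.zero[OF iota_additive] by (metis Ul.simps(1) rangeI)
next
  case (Cons k ks)
  then show ?case using Ul_ConsI[of 0 ks 0 k] by (simp add: additive.zero[OF yk_additive])
qed

lemma Ul_yk: "set ks \<subseteq> K \<Longrightarrow> u \<in> Ul ks \<Longrightarrow> k \<in> set ks \<Longrightarrow> yk k u \<in> Ul ks"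
proof (induction ks arbitrary: u)
  case Nil
  then show ?case by simp
next
  case (Cons j ks)
  then obtain u1 u2 where u: "u = u1 + yk j u2" "u1 \<in> Ul ks" "u2 \<in> Ul ks" by auto
  have jk: "j \<in> K" "k \<in> K" using Cons by auto
  show ?case
  proof (cases "k = j")
    case True
    then have "yk k u = 0 + yk j u1"
      using jk by (simp add: u additive.add[OF yk_additive] yk_sq)
    then show ?thesis using u Ul_ConsI[OF Ul_zero[of ks] u(2), of j] Cons by simp
  next
    case False
    then have "yk k u1 \<in> Ul ks" "yk k u2 \<in> Ul ks" using Cons u by auto
    moreover have "yk k u = yk k u1 + yk j (scl V (-1) (yk k u2))"
      using jk by (simp add: u additive.add[OF yk_additive] additive.minus[OF yk_additive] yk_anticomm[of k j])
    ultimately show ?thesis using Ul_ConsI[of _ ks _ j] Ul_scale[of ks "yk k u2" "-1"] Cons.prems by (metis insert_subset list.simps(15))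
  qed
qed

text \<open>Only the generators in the list have been multiplied in; this keeps the supports of the
  two summands in \<open>Ul (k # ks)\<close> apart.\<close>

lemma Ul_Phi: "set ks \<subseteq> K \<Longrightarrow> u \<in> Ul ks \<Longrightarrow> Phi u S \<noteq> 0 \<Longrightarrow> S \<subseteq> set ks"
proof (induction ks arbitrary: u S)
  case Nil
  then show ?case by (auto simp: Phi_iota vac_def split: if_splits)
next
  case (Cons k ks)
  then obtain u1 u2 where u: "u = u1 + yk k u2" "u1 \<in> Ul ks" "u2 \<in> Ul ks" by auto
  have "Phi u1 S \<noteq> 0 \<or> Phi u2 (S - {k}) \<noteq> 0"
    using Cons.prems by (auto simp: u Phi_add Phi_yk theta_def split: if_splits)
  then show ?case using Cons u by auto
qed

lemma Ul_inj: "set ks \<subseteq> K \<Longrightarrow> distinct ks \<Longrightarrow> u \<in> Ul ks \<Longrightarrow> Phi u = 0 \<Longrightarrow> u = 0"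
proof (induction ks arbitrary: u)
  case Nil
  then obtain l where "u = \<iota> l" by auto
  moreover have "Phi u {} = 0" using Nil by simp
  ultimately show ?case using additive.zero[OF iota_additive] by (simp add: Phi_iota vac_def)
next
  case (Cons k ks)
  then obtain u1 u2 where u: "u = u1 + yk k u2" "u1 \<in> Ul ks" "u2 \<in> Ul ks" by auto
  have ks: "set ks \<subseteq> K" "k \<in> K" "k \<notin> set ks" using Cons by auto
  have eq: "Phi u1 S + theta k (Phi u2) S = 0" for S
    using fun_cong[OF Cons.prems(4), of S] ks by (simp add: u Phi_add Phi_yk)
  \<comment> \<open>The two summands have disjoint supports: the sets S for \<open>u1\<close> avoid
    k, those for \<open>yk k u2\<close> contain it.\<close>
  have "Phi u1 S = 0" for S
    using eq[of S] Ul_Phi[OF ks(1) u(2), of S] ks by (cases "k \<in> S") (auto simp: theta_def)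
  then have u1: "u1 = 0" using Cons u ks by (auto simp: fun_eq_iff)
  have "Phi u2 S = 0" for S
  proof (cases "k \<in> S")
    case True
    then show ?thesis using Ul_Phi[OF ks(1) u(3), of S] ks by auto
  next
    case False
    then have "sig k (insert k S) (Phi u2 S) = 0"
      using eq[of "insert k S"] \<open>\<And>S. Phi u1 S = 0\<close> by (simp add: theta_def)
    then show ?thesis by (auto simp: sig_def split: if_splits)
  qed
  then have "u2 = 0" using Cons u ks by (auto simp: fun_eq_iff)
  then show ?case using u1 u ks by (simp add: additive.zero[OF yk_additive])
qed

lemma Phi_zero: "Phi u = 0 \<Longrightarrow> u = 0"
proof -
  obtain ks where ks: "set ks = K" "distinct ks" using finite_distinct_list[OF finite_K] by blast
  have "v \<in> Ysp \<Longrightarrow> v \<in> Ul ks" for v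
  proof (induction rule: Ysp.induct)
    case (iota l)
    have "set ks' \<subseteq> K \<Longrightarrow> \<iota> l \<in> Ul ks'" for ks'
    proof (induction ks')
      case (Cons k ks')
      then show ?case using Ul_ConsI[of "\<iota> l" ks' 0 k] Ul_zero[of ks']
        by (simp add: additive.zero[OF yk_additive])
    qed auto
    then show ?case using ks by simp
  qed (use ks in \<open>auto intro: Ul_add Ul_scale Ul_yk\<close>)
  then show "Phi u = 0 \<Longrightarrow> u = 0" using Ul_inj[of ks u] ks Ysp_UNIV by auto
qed

lemma Phi_inj: "Phi u = Phi v \<longleftrightarrow> u = v"
  using Phi_zero[of "u - v"] additive.diff[OF Phi_additive, of u v] by auto

end

section \<open>Derivations into the Kac module\<close>

context kac_setup begin

text \<open>By \<open>top_0\<close> and \<open>top_1\<close> this is a g_0-homomorphism from V to M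
  which kills g_+1 V; \<open>bot\<close> is its section with values in the g_-1-invariants.\<close>

definition top :: "'v \<Rightarrow> 'l" where
  "top v = Phi v K"

text \<open>
  The action of \<open>g\<^sub>0\<close> on the \<open>g\<^sub>-\<^sub>1\<close>-invariants, transported to \<open>L\<close>: they are \<open>L\<close> tensored with the top
  exterior power of \<open>g\<^sub>-\<^sub>1\<close>, a character of weight \<open>-2\<rho>\<^sub>1\<close>.
\<close>

definition tw :: "complex mat \<Rightarrow> 'l \<Rightarrow> 'l" where
  "tw A l = act L A l + scl L (\<Sum>a<N. (if a < m then - of_nat n else of_nat m) * A $$ (a, a)) l"

lemma top_add: "top (u + v) = top u + top v" and top_scale: "top (scl V c v) = scl L c (top v)"
  by (simp_all add: top_def Phi_add Phi_scale fs_def)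

lemma top_additive: "additive top" by (simp add: additive_def top_add)

lemma top_0: "A \<in> gdeg 0 \<Longrightarrow> A \<in> sl m n \<Longrightarrow> top (act V A v) = tw A (top v)"
  by (simp add: top_def tw_def Phi_act rho_top_0 lev_act)

lemma top_1: "A \<in> gdeg 1 \<Longrightarrow> top (act V A v) = 0"
  by (simp add: top_def Phi_act gdeg_sl[of A 1] rho_top_1)

definition yker :: "'v \<Rightarrow> bool" where
  "yker v \<longleftrightarrow> (\<forall>A\<in>gdeg (-1). act V A v = 0)"

lemma gdeg_minus1_sl: "A \<in> gdeg (-1) \<Longrightarrow> A \<in> sl m n" and gdeg_1_sl: "A \<in> gdeg 1 \<Longrightarrow> A \<in> sl m n"
  using gdeg_sl by fastforce+

lemma yk_gm: "k \<in> K \<Longrightarrow> \<exists>A\<in>gdeg (-1). \<forall>v. yk k v = act V A v"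
  using yk_gdeg[of k] by (auto simp: yk_def)

lemma yker_iff: "yker v \<longleftrightarrow> (\<forall>k\<in>K. yk k v = 0)"
proof
  assume "yker v" then show "\<forall>k\<in>K. yk k v = 0" using yk_gm unfolding yker_def by metis
next
  assume z: "\<forall>k\<in>K. yk k v = 0"
  have "act V A v = 0" if "A \<in> gdeg (-1)" for A
    using that
  proof (rule mat_units_induct)
    fix a b assume "(a, b) \<in> IX (-1)"
    then have "m \<le> a" "a < N" "b < m" by (auto simp: IX_def blk_def split: if_splits)
    then show "act V (E a b) v = 0" using z enc_K[of a b] by (force simp: yk_def)
  next
    show "act V (0\<^sub>m N N) v = 0" using actV_mat_scale[of "0\<^sub>m N N" 0 v] by auto
  qed (simp_all add: actV_mat_add actV_mat_scale gdeg_minus1_sl)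
  then show "yker v" by (simp add: yker_def)
qed

lemma act_zero_mat: "act V (0\<^sub>m N N) v = 0"
  using actV_mat_scale[of "0\<^sub>m N N" 0 v] by auto

lemma act_zero: "A \<in> sl m n \<Longrightarrow> act V A 0 = 0"
  by (simp add: additive.zero[OF actV_additive])

lemma act_diff: "A \<in> sl m n \<Longrightarrow> act V A (u - v) = act V A u - act V A v"
  by (simp add: additive.diff[OF actV_additive])

text \<open>Coinduction in elementary form: a vector killed by g_-1 lies in the top exterior power,
  where \<open>top\<close> is injective.\<close>

lemma eqI_top:
  assumes t: "top u = top v" and y: "\<And>A. A \<in> gdeg (-1) \<Longrightarrow> act V A u = act V A v"
  shows "u = v"
proof -
  have "yker (u - v)" using y by (simp add: yker_def act_diff gdeg_minus1_sl)
  then have "\<forall>k\<in>K. theta k (Phi (u - v)) = 0"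
    by (auto simp: yker_iff Phi_yk[symmetric] additive.zero[OF Phi_additive])
  moreover have "Phi (u - v) K = 0" using t by (simp add: top_def[symmetric] additive.diff[OF top_additive])
  ultimately have "Phi (u - v) = 0" using theta_kernel Phi_X by blast
  then show ?thesis using Phi_zero by fastforce
qed

lemma bot_ex: "\<exists>!v. yker v \<and> top v = l"
proof -
  obtain f where f: "f \<in> X" "f K = l" "\<forall>k\<in>K. theta k f = 0" using bottom by blast
  obtain v where v: "Phi v = f" using Phi_surj[OF f(1)] by blast
  have "yker v" using f v Phi_zero by (auto simp: yker_iff Phi_yk)
  moreover have "top v = l" using f v by (simp add: top_def)
  ultimately show ?thesis using eqI_top by (auto simp: yker_def)
qed

definition bot :: "'l \<Rightarrow> 'v" where
  "bot l = (THE v. yker v \<and> top v = l)"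

lemma bot: "yker (bot l)" "top (bot l) = l"
  using theI'[OF bot_ex[of l]] by (auto simp: bot_def)

lemma bot_y: "A \<in> gdeg (-1) \<Longrightarrow> act V A (bot l) = 0"
  using bot(1) by (simp add: yker_def)

lemma bot_top: "yker v \<Longrightarrow> bot (top v) = v"
  by (rule eqI_top) (auto simp: bot bot_y yker_def)

lemma bot_add: "bot (k + l) = bot k + bot l"
  by (rule eqI_top) (auto simp: bot bot_y top_add actV_add gdeg_minus1_sl)

lemma bot_scale: "bot (scl L c l) = scl V c (bot l)"
  by (rule eqI_top) (auto simp: bot bot_y top_scale actV_scale gdeg_minus1_sl)

lemma bot_additive: "additive bot" by (simp add: additive_def bot_add)

lemma bot_0:
  assumes "A \<in> gdeg 0" "A \<in> sl m n"
  shows "act V A (bot l) = bot (tw A l)"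
proof (rule eqI_top)
  show "top (act V A (bot l)) = top (bot (tw A l))" by (simp add: top_0 assms bot)
  fix B assume B: "B \<in> gdeg (-1)"
  have "act V A (act V B (bot l)) = act V B (act V A (bot l)) + act V (brk 0 (-1) A B) (bot l)"
    using actV_rel[OF assms B gdeg_minus1_sl[OF B]] by (simp add: sg_simps)
  then show "act V B (act V A (bot l)) = act V B (bot (tw A l))"
    using brk_gdeg[OF assms(1) B] by (simp add: bot_y B act_zero assms)
qed

sublocale tw: g0_rep m n "scl L" tw
proof
  fix A B u v c assume A: "A \<in> gdeg 0" "A \<in> sl m n"
  show "tw A (u + v) = tw A u + tw A v"
    by (simp add: tw_def actL_add para_0 A Lv.scale_right_distrib)
  show "tw A (scl L c v) = scl L c (tw A v)"
    by (simp add: tw_def actL_scale para_0 A Lv.scale_right_distrib mult.commute)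
  show "tw (c \<cdot>\<^sub>m A) v = scl L c (tw A v)"
    using A by (simp add: tw_def actL_mat_scale para_0 Lv.scale_right_distrib sum_distrib_left mult.left_commute)
  assume B: "B \<in> gdeg 0" "B \<in> sl m n"
  show "tw (A + B) v = tw A v + tw B v"
    using A B by (simp add: tw_def actL_mat_add para_0 Lv.scale_left_distrib[symmetric] sum.distrib[symmetric]
      distrib_left add.assoc add.left_commute)
  \<comment> \<open>The bracket relation is inherited from V, since every vector of L is the top of
    some vector; no trace of a commutator is computed.\<close>
  have "tw A (tw B (top (bot v))) = tw B (tw A (top (bot v))) + tw (brk 0 0 A B) (top (bot v))"
    using actV_rel[OF A B, of "bot v"] brk_gdeg[OF A(1) B(1)] brk_sl[OF A(1) B(1)]
    by (simp add: top_0[symmetric] A B top_add[symmetric] sg_simps)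
  then show "tw A (tw B v) = tw B (tw A v) + tw (brk 0 0 A B) v" by (simp add: bot)
qed

lemma koszul_V:
  assumes w: "\<And>k l. k \<in> K \<Longrightarrow> l \<in> K \<Longrightarrow> yk k (w l) + yk l (w k) = 0"
  shows "\<exists>v. \<forall>k\<in>K. yk k v = w k"
proof -
  have "\<exists>f\<in>X. \<forall>k\<in>K. theta k f = Phi (w k)"
    using w Phi_X additive.zero[OF Phi_additive]
    by (intro koszul) (auto simp: Phi_yk[symmetric] Phi_add[symmetric] simp del: plus_fun_apply)
  then obtain f where f: "f \<in> X" "\<And>k. k \<in> K \<Longrightarrow> theta k f = Phi (w k)" by blast
  obtain v where "Phi v = f" using Phi_surj[OF f(1)] by blast
  then have "yk k v = w k" if "k \<in> K" for k
    using f(2)[OF that] Phi_yk[OF that] Phi_inj by metis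
  then show ?thesis by blast
qed

text \<open>Elements of g_-1 have zero bracket, so \<open>anti\<close> is the cocycle condition, and
  the conclusion is the vanishing of H^1(g_-1, V).\<close>

lemma koszul_gm:
  assumes add: "\<And>A B. A \<in> gdeg (-1) \<Longrightarrow> B \<in> gdeg (-1) \<Longrightarrow> \<psi> (A + B) = \<psi> A + \<psi> B"
    and smult: "\<And>A c. A \<in> gdeg (-1) \<Longrightarrow> \<psi> (c \<cdot>\<^sub>m A) = scl V c (\<psi> A)"
    and anti: "\<And>A B. A \<in> gdeg (-1) \<Longrightarrow> B \<in> gdeg (-1) \<Longrightarrow> act V A (\<psi> B) + act V B (\<psi> A) = 0"
  shows "\<exists>v. \<forall>A\<in>gdeg (-1). \<psi> A = act V A v"
proof -
  define Y where "Y k = (case prod_decode k of (\<nu>, i) \<Rightarrow> E \<nu> i)" for k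
  have Y: "Y k \<in> gdeg (-1)" if "k \<in> K" for k using yk_gdeg[OF that] by (simp add: Y_def)
  have yk: "yk k = act V (Y k)" for k by (simp add: yk_def Y_def)
  have "\<exists>v. \<forall>k\<in>K. yk k v = \<psi> (Y k)"
    by (rule koszul_V) (simp add: yk anti Y)
  then obtain v where v: "\<And>k. k \<in> K \<Longrightarrow> yk k v = \<psi> (Y k)" by blast
  have "\<psi> A = act V A v" if A: "A \<in> gdeg (-1)" for A
  proof (rule lin_ext[of "-1" \<psi> "scl V" "\<lambda>A. act V A v", OF _ _ _ _ _ _ A])
    fix a b assume "(a, b) \<in> IX (-1)"
    then have "m \<le> a" "a < N" "b < m" by (auto simp: IX_def blk_def split: if_splits)
    from v[OF enc_K[OF this]] show "\<psi> (E a b) = act V (E a b) v" by (simp add: yk_def Y_def)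
  qed (simp_all add: add smult actV_mat_add actV_mat_scale gdeg_minus1_sl)
  then show ?thesis by blast
qed

text \<open>The Leibniz rule of an even derivation, imposed on maps of every parity; the twist
  \<open>toder\<close> brings all 1-cocycles into this form.\<close>

definition der :: "(complex mat \<Rightarrow> 'v) \<Rightarrow> bool" where
  "der \<psi> \<longleftrightarrow> (\<forall>A\<in>sl m n. \<forall>B\<in>sl m n. \<psi> (A + B) = \<psi> A + \<psi> B) \<and>
    (\<forall>c. \<forall>A\<in>sl m n. \<psi> (c \<cdot>\<^sub>m A) = scl V c (\<psi> A)) \<and>
    (\<forall>d e. \<forall>A\<in>gdeg d \<inter> sl m n. \<forall>B\<in>gdeg e \<inter> sl m n.
      \<psi> (brk d e A B) = act V A (\<psi> B) - scl V (sg d e) (act V B (\<psi> A)))"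

lemma der_add: "der \<psi> \<Longrightarrow> A \<in> sl m n \<Longrightarrow> B \<in> sl m n \<Longrightarrow> \<psi> (A + B) = \<psi> A + \<psi> B"
  and der_smult: "der \<psi> \<Longrightarrow> A \<in> sl m n \<Longrightarrow> \<psi> (c \<cdot>\<^sub>m A) = scl V c (\<psi> A)"
  and der_brk: "der \<psi> \<Longrightarrow> A \<in> gdeg d \<Longrightarrow> A \<in> sl m n \<Longrightarrow> B \<in> gdeg e \<Longrightarrow> B \<in> sl m n \<Longrightarrow>
    \<psi> (brk d e A B) = act V A (\<psi> B) - scl V (sg d e) (act V B (\<psi> A))"
  by (auto simp: der_def)

lemma der_zero: "der \<psi> \<Longrightarrow> \<psi> (0\<^sub>m N N) = 0"
  using der_smult[of \<psi> "0\<^sub>m N N" 0] by auto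

lemma der_inner: "der (\<lambda>x. act V x v)"
  unfolding der_def
proof (intro conjI ballI allI)
  fix d e A B assume "A \<in> gdeg d \<inter> sl m n" "B \<in> gdeg e \<inter> sl m n"
  then show "act V (brk d e A B) v = act V A (act V B v) - scl V (sg d e) (act V B (act V A v))"
    using actV_rel[of A d B e v] by simp
qed (simp_all add: actV_mat_add actV_mat_scale)

lemma der_diff: "der \<psi> \<Longrightarrow> der \<phi> \<Longrightarrow> der (\<lambda>x. \<psi> x - \<phi> x)"
  unfolding der_def by (auto simp: act_diff Vv.scale_right_diff_distrib)

lemma der_scale: "der \<psi> \<Longrightarrow> der (\<lambda>x. scl V c (\<psi> x))"
  unfolding der_def by (auto simp: actV_scale Vv.scale_right_diff_distrib Vv.scale_right_distrib mult.commute)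

lemma der_minus_inner:
  assumes "der \<psi>" shows "\<exists>v. \<forall>A\<in>gdeg (-1). \<psi> A = act V A v"
proof (rule koszul_gm)
  fix A B assume A: "A \<in> gdeg (-1)" and B: "B \<in> gdeg (-1)"
  have "brk (-1) (-1) A B = 0\<^sub>m N N" using gdeg_trivial[OF brk_gdeg[OF A B]] by simp
  then show "act V A (\<psi> B) + act V B (\<psi> A) = 0"
    using der_brk[OF assms A gdeg_minus1_sl[OF A] B gdeg_minus1_sl[OF B]] der_zero[OF assms] by (simp add: sg_def)
qed (simp_all add: der_add[OF assms] der_smult[OF assms] gdeg_minus1_sl)

text \<open>For y in g_-1 the bracket with A is again in g_-1, where the derivation vanishes; the
  Leibniz rule then says that y kills its value at A.\<close>

lemma der_yker_0:
  assumes d: "der \<psi>" and z: "\<forall>A\<in>gdeg (-1). \<psi> A = 0" and A: "A \<in> gdeg 0" "A \<in> sl m n"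
  shows "yker (\<psi> A)"
  unfolding yker_def
proof
  fix B assume B: "B \<in> gdeg (-1)"
  have "brk 0 (-1) A B \<in> gdeg (-1)" using brk_gdeg[OF A(1) B] by simp
  then show "act V B (\<psi> A) = 0"
    using der_brk[OF d A B gdeg_minus1_sl[OF B]] z B by (simp add: sg_def act_zero A)
qed

lemma der_yker_1:
  assumes d: "der \<psi>" and z: "\<forall>A\<in>gdeg (-1). \<psi> A = 0" "\<forall>A\<in>gdeg 0 \<inter> sl m n. \<psi> A = 0" and A: "A \<in> gdeg 1"
  shows "yker (\<psi> A)"
  unfolding yker_def
proof
  fix B assume B: "B \<in> gdeg (-1)"
  have "brk 1 (-1) A B \<in> gdeg 0 \<inter> sl m n" using brk_gdeg[OF A B] brk_sl[OF A B] by simp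
  then show "act V B (\<psi> A) = 0"
    using der_brk[OF d A gdeg_1_sl[OF A] B gdeg_minus1_sl[OF B]] z B by (simp add: sg_def act_zero A gdeg_1_sl)
qed

lemma der_eq_zero:
  assumes d: "der \<psi>" and z: "\<forall>A\<in>gdeg (-1). \<psi> A = 0" "\<forall>A\<in>gdeg 0 \<inter> sl m n. \<psi> A = 0" "\<forall>A\<in>gdeg 1. \<psi> A = 0"
    and x: "x \<in> sl m n"
  shows "\<psi> x = 0"
  by (rule cut_induct[of \<psi>, OF der_add[OF d] _ x]) (use z cut_sl[OF x] in auto)

lemma der_top_0:
  assumes d: "der \<psi>" and A: "A \<in> gdeg 0" "A \<in> sl m n" and B: "B \<in> gdeg 0" "B \<in> sl m n"
  shows "top (\<psi> (brk 0 0 A B)) = tw A (top (\<psi> B)) - tw B (top (\<psi> A))"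
  by (simp add: der_brk[OF d A B] sg_def additive.diff[OF top_additive] top_0 A B)

text \<open>
  On \<open>g\<^sub>+\<^sub>1\<close> the derivation is \<open>u + f\<close>, where \<open>u x\<close> is determined by \<open>y (u x) = D [x, y]\<close> for \<open>y \<in> g\<^sub>-\<^sub>1\<close> and by
  \<open>top (u x) = 0\<close>. All identities are checked after applying \<open>g\<^sub>-\<^sub>1\<close> and \<open>top\<close>.
\<close>

lemma der_construct:
  fixes D f :: "complex mat \<Rightarrow> 'l"
  assumes D_add: "\<And>A B. A \<in> gdeg 0 \<Longrightarrow> A \<in> sl m n \<Longrightarrow> B \<in> gdeg 0 \<Longrightarrow> B \<in> sl m n \<Longrightarrow> D (A + B) = D A + D B"
    and D_smult: "\<And>A c. A \<in> gdeg 0 \<Longrightarrow> A \<in> sl m n \<Longrightarrow> D (c \<cdot>\<^sub>m A) = scl L c (D A)"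
    and D_brk: "\<And>A B. A \<in> gdeg 0 \<Longrightarrow> A \<in> sl m n \<Longrightarrow> B \<in> gdeg 0 \<Longrightarrow> B \<in> sl m n \<Longrightarrow>
      D (brk 0 0 A B) = tw A (D B) - tw B (D A)"
    and f_add: "\<And>A B. A \<in> gdeg 1 \<Longrightarrow> B \<in> gdeg 1 \<Longrightarrow> f (A + B) = f A + f B"
    and f_smult: "\<And>A c. A \<in> gdeg 1 \<Longrightarrow> f (c \<cdot>\<^sub>m A) = scl L c (f A)"
    and f_brk: "\<And>h A. h \<in> gdeg 0 \<Longrightarrow> h \<in> sl m n \<Longrightarrow> A \<in> gdeg 1 \<Longrightarrow> f (brk 0 1 h A) = tw h (f A)"
  shows "\<exists>\<psi>. der \<psi> \<and> (\<forall>A\<in>gdeg (-1). \<psi> A = 0) \<and> (\<forall>A\<in>gdeg 0 \<inter> sl m n. \<psi> A = bot (D A)) \<and>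
    (\<forall>A\<in>gdeg 1. top (\<psi> A) = f A)"
proof -
  have b0: "brk 1 (-1) A B \<in> gdeg 0 \<and> brk 1 (-1) A B \<in> sl m n" if "A \<in> gdeg 1" "B \<in> gdeg (-1)" for A B
    using brk_gdeg[OF that] brk_sl[OF that] by simp
  have ex: "\<exists>v. top v = 0 \<and> (\<forall>B\<in>gdeg (-1). act V B v = bot (D (brk 1 (-1) A B)))" if A: "A \<in> gdeg 1" for A
  proof -
    \<comment> \<open>The compatibility condition is immediate: the prescribed values are
      invariants, so both of its terms vanish.\<close>
    have "\<exists>v. \<forall>B\<in>gdeg (-1). bot (D (brk 1 (-1) A B)) = act V B v"
      by (rule koszul_gm)
        (simp_all add: brk_add_right[OF A] brk_smult_right[OF A] D_add D_smult b0 A bot_add bot_scale bot_y)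
    then obtain v where v: "\<And>B. B \<in> gdeg (-1) \<Longrightarrow> act V B v = bot (D (brk 1 (-1) A B))" by metis
    \<comment> \<open>Subtracting an invariant normalises the top component and leaves the images
      under g_-1 unchanged.\<close>
    then show ?thesis
      by (intro exI[of _ "v - bot (top v)"]) (simp add: additive.diff[OF top_additive] bot act_diff gdeg_minus1_sl bot_y)
  qed
  define u where "u A = (SOME v. top v = 0 \<and> (\<forall>B\<in>gdeg (-1). act V B v = bot (D (brk 1 (-1) A B))))" for A
  have u: "top (u A) = 0" "\<And>B. B \<in> gdeg (-1) \<Longrightarrow> act V B (u A) = bot (D (brk 1 (-1) A B))" if "A \<in> gdeg 1" for A
    using someI_ex[OF ex[OF that]] by (auto simp: u_def)
  have u_add: "u (A + B) = u A + u B" if "A \<in> gdeg 1" "B \<in> gdeg 1" for A B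
    by (rule eqI_top) (use that in \<open>auto simp: u gdeg_add top_add actV_add gdeg_minus1_sl brk_add_left D_add b0 bot_add\<close>)
  have u_smult: "u (c \<cdot>\<^sub>m A) = scl V c (u A)" if "A \<in> gdeg 1" for A c
    by (rule eqI_top) (use that in \<open>auto simp: u gdeg_smult top_scale actV_scale gdeg_minus1_sl brk_smult_left D_smult b0 bot_scale\<close>)
  have u_brk: "u (brk 0 1 h x) = act V h (u x) - act V x (bot (D h))"
    if h: "h \<in> gdeg 0" "h \<in> sl m n" and x: "x \<in> gdeg 1" for h x
  proof (rule eqI_top)
    have hx: "brk 0 1 h x \<in> gdeg 1" by (rule brk_0_gdeg[OF h(1) x])
    show "top (u (brk 0 1 h x)) = top (act V h (u x) - act V x (bot (D h)))"
      by (simp add: u hx additive.diff[OF top_additive] top_0 top_1 h x additive.zero[OF tw.h0_additive])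
    fix B assume B: "B \<in> gdeg (-1)"
    have hB: "brk 0 (-1) h B \<in> gdeg (-1)" by (rule brk_0_gdeg[OF h(1) B])
    have "act V B (act V h (u x)) = act V h (act V B (u x)) - act V (brk 0 (-1) h B) (u x)"
      using actV_rel[OF h B gdeg_minus1_sl[OF B], of "u x"] by (simp add: sg_def)
    also have "\<dots> = bot (tw h (D (brk 1 (-1) x B)) - D (brk 1 (-1) x (brk 0 (-1) h B)))"
      by (simp add: u x B hB bot_0 h additive.diff[OF bot_additive])
    finally have 1: "act V B (act V h (u x)) = \<dots>" .
    have "act V B (act V x (bot (D h))) = act V (brk 1 (-1) x B) (bot (D h)) - act V x (act V B (bot (D h)))"
      using actV_rel[OF x gdeg_1_sl[OF x] B gdeg_minus1_sl[OF B], of "bot (D h)"] by (simp add: sg_def)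
    also have "\<dots> = bot (tw (brk 1 (-1) x B) (D h))"
      using b0[OF x B] by (simp add: bot_y B act_zero gdeg_1_sl x bot_0)
    finally have 2: "act V B (act V x (bot (D h))) = \<dots>" .
    \<comment> \<open>The Jacobi identity for h, x, B; applying the derivation D to it gives the
      wanted identity after g_-1 has acted.\<close>
    have "brk 1 (-1) (brk 0 1 h x) B + brk 1 (-1) x (brk 0 (-1) h B) = brk 0 0 h (brk 1 (-1) x B)"
      using jacobi[OF h(1) x B] gdeg_dim[OF brk_0_gdeg[OF h(1) conjunct1[OF b0[OF x B]]]]
       gdeg_dim[OF conjunct1[OF b0[OF x hB]]]
      by (intro eq_matI) (auto simp: sg_def)
    then have "D (brk 1 (-1) (brk 0 1 h x) B) + D (brk 1 (-1) x (brk 0 (-1) h B)) =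
        tw h (D (brk 1 (-1) x B)) - tw (brk 1 (-1) x B) (D h)"
      using D_brk[OF h, of "brk 1 (-1) x B"] D_add[of "brk 1 (-1) (brk 0 1 h x) B" "brk 1 (-1) x (brk 0 (-1) h B)"]
        b0[OF x B] b0[OF hx B] b0[OF x hB] by simp
    then have "D (brk 1 (-1) (brk 0 1 h x) B) =
        tw h (D (brk 1 (-1) x B)) - D (brk 1 (-1) x (brk 0 (-1) h B)) - tw (brk 1 (-1) x B) (D h)"
      by (simp add: algebra_simps)
    then show "act V B (u (brk 0 1 h x)) = act V B (act V h (u x) - act V x (bot (D h)))"
      by (simp add: u hx B act_diff gdeg_minus1_sl 1 2 additive.diff[OF bot_additive])
  qed
  define g where "g x = u x + bot (f x)" for x
  have g_brk: "g (brk 0 1 h x) = act V h (g x) - act V x (bot (D h))"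
    if h: "h \<in> gdeg 0" "h \<in> sl m n" and x: "x \<in> gdeg 1" for h x
    by (simp add: g_def u_brk[OF that] f_brk[OF that] bot_0[OF h, symmetric] actV_add h)
  have g_y: "act V B (g x) = bot (D (brk 1 (-1) x B))" if "x \<in> gdeg 1" "B \<in> gdeg (-1)" for x B
    using that by (simp add: g_def actV_add gdeg_minus1_sl u bot_y)
  have g_add: "g (A + B) = g A + g B" if "A \<in> gdeg 1" "B \<in> gdeg 1" for A B
    using that by (simp add: g_def u_add f_add bot_add)
  have g_smult: "g (c \<cdot>\<^sub>m A) = scl V c (g A)" if "A \<in> gdeg 1" for A c
    using that by (simp add: g_def u_smult f_smult bot_scale Vv.scale_right_distrib)
  have g_zero: "g (0\<^sub>m N N) = 0" using g_smult[of "0\<^sub>m N N" 0] by auto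
  have g_11: "act V x (g x') + act V x' (g x) = 0" if x: "x \<in> gdeg 1" and x': "x' \<in> gdeg 1" for x x'
  proof (rule eqI_top)
    show "top (act V x (g x') + act V x' (g x)) = top 0"
      by (simp add: top_add top_1 x x' additive.zero[OF top_additive])
    fix B assume B: "B \<in> gdeg (-1)"
    have y: "act V B (act V x (g x')) = g (brk 0 1 (brk 1 (-1) x B) x') + act V x' (bot (D (brk 1 (-1) x B)))
        - act V x (bot (D (brk 1 (-1) x' B)))" if x: "x \<in> gdeg 1" and x': "x' \<in> gdeg 1" for x x'
    proof -
      have "act V B (act V x (g x')) = act V (brk 1 (-1) x B) (g x') - act V x (act V B (g x'))"
        using actV_rel[OF x gdeg_1_sl[OF x] B gdeg_minus1_sl[OF B], of "g x'"] by (simp add: sg_def)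
      then show ?thesis using g_brk[of "brk 1 (-1) x B" x'] b0[OF x B] x' by (simp add: g_y B)
    qed
    have G: "brk 0 1 (brk 1 (-1) x B) x' \<in> gdeg 1" "brk 0 1 (brk 1 (-1) x' B) x \<in> gdeg 1"
      using brk_0_gdeg b0[OF x B] b0[OF x' B] x x' by auto
    \<comment> \<open>Two elements of g_+1 have zero bracket, so the Jacobi identity makes [[x, B],
      x'] antisymmetric in x and x'.\<close>
    have "brk (1 + 1) (-1) (brk 1 1 x x') B = 0\<^sub>m N N"
      using gdeg_trivial[OF brk_gdeg[OF x x']] brk_zero_left[OF B] by simp
    then have "0\<^sub>m N N = brk 1 0 x (brk 1 (-1) x' B) - sg 1 1 \<cdot>\<^sub>m brk 1 0 x' (brk 1 (-1) x B)"
      using jacobi[OF x x' B] by simp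
    then have eq: "0\<^sub>m N N = - sg 1 0 \<cdot>\<^sub>m brk 0 1 (brk 1 (-1) x' B) x - sg 1 1 \<cdot>\<^sub>m (- sg 1 0 \<cdot>\<^sub>m brk 0 1 (brk 1 (-1) x B) x')"
      using brk_antisym[OF x conjunct1[OF b0[OF x' B]]] brk_antisym[OF x' conjunct1[OF b0[OF x B]]] by simp
    have "brk 0 1 (brk 1 (-1) x B) x' $$ (i, j) + brk 0 1 (brk 1 (-1) x' B) x $$ (i, j) = 0"
      if "i < N" "j < N" for i j
      using arg_cong[OF eq, of "\<lambda>M. M $$ (i, j)"] that gdeg_dim[OF G(1)] gdeg_dim[OF G(2)]
      by (simp add: sg_def add_eq_0_iff2)
    then have "brk 0 1 (brk 1 (-1) x B) x' + brk 0 1 (brk 1 (-1) x' B) x = 0\<^sub>m N N"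
      using gdeg_dim[OF G(1)] gdeg_dim[OF G(2)] by (intro eq_matI) simp_all
    then have "g (brk 0 1 (brk 1 (-1) x B) x') + g (brk 0 1 (brk 1 (-1) x' B) x) = 0"
      using g_add[OF G] g_zero by simp
    then show "act V B (act V x (g x') + act V x' (g x)) = act V B 0"
      by (simp add: actV_add gdeg_minus1_sl B y[OF x x'] y[OF x' x] act_zero algebra_simps)
  qed
  define \<psi> where "\<psi> x = bot (D (cut 0 x)) + g (cut 1 x)" for x
  have cut_add: "cut d (A + B) = cut d A + cut d B" "cut d (c \<cdot>\<^sub>m A) = c \<cdot>\<^sub>m cut d A"
    if "A \<in> carrier_mat N N" "B \<in> carrier_mat N N" for d A B c
    using that by (intro eq_matI; auto simp: cut_def)+
  have cut_id: "cut d A = A" "e \<noteq> d \<Longrightarrow> cut e A = 0\<^sub>m N N" if "A \<in> gdeg d" for d e A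
    using that gdegD[OF that] by (intro eq_matI; auto simp: cut_def)+
  have D_zero: "D (0\<^sub>m N N) = 0" using D_smult[of "0\<^sub>m N N" 0] by auto
  have psi_m: "\<psi> A = 0" if "A \<in> gdeg (-1)" for A
    using that by (simp add: \<psi>_def cut_id D_zero g_zero additive.zero[OF bot_additive])
  have psi_0: "\<psi> A = bot (D A)" if "A \<in> gdeg 0" for A
    using that by (simp add: \<psi>_def cut_id g_zero)
  have psi_1: "\<psi> A = g A" if "A \<in> gdeg 1" for A
    using that by (simp add: \<psi>_def cut_id D_zero additive.zero[OF bot_additive])
  have psi_add: "\<psi> (A + B) = \<psi> A + \<psi> B" if "A \<in> sl m n" "B \<in> sl m n" for A B
    using that by (simp add: \<psi>_def cut_add sl_carrier D_add cut_sl g_add bot_add)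
  have psi_smult: "\<psi> (c \<cdot>\<^sub>m A) = scl V c (\<psi> A)" if "A \<in> sl m n" for A c
    using that cut_add(2)[OF sl_carrier sl_carrier, OF that that]
    by (simp add: \<psi>_def D_smult cut_sl g_smult bot_scale Vv.scale_right_distrib)
  define P where "P d e A B \<longleftrightarrow> \<psi> (brk d e A B) = act V A (\<psi> B) - scl V (sg d e) (act V B (\<psi> A))" for d e A B
  have psi_zero: "\<psi> (0\<^sub>m N N) = 0" using psi_smult[of "0\<^sub>m N N" 0] by auto
  \<comment> \<open>Supersymmetry of the bracket halves the number of pairs of degrees to be
    checked.\<close>
  have sym: "P e d B A" if "A \<in> gdeg d" "B \<in> gdeg e" "P d e A B" for d e A B
    using that(3) psi_smult[OF brk_sl[OF that(1,2)]] brk_antisym[OF that(2,1)]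
    by (simp add: P_def Vv.scale_right_diff_distrib sg_simps)
  have P0: "P d e A B" if "A = 0\<^sub>m N N" "B \<in> gdeg e" "B \<in> sl m n" for d e A B
    using that by (simp add: P_def brk_zero_left psi_zero act_zero_mat act_zero)
  have Pmm: "P (-1) (-1) A B" if "A \<in> gdeg (-1)" "B \<in> gdeg (-1)" for A B
    using that gdeg_trivial[OF brk_gdeg[OF that]] by (simp add: P_def psi_zero psi_m act_zero gdeg_minus1_sl)
  have P0m: "P 0 (-1) A B" if "A \<in> gdeg 0" "A \<in> sl m n" "B \<in> gdeg (-1)" for A B
    using that brk_0_gdeg[of A B "-1"] by (simp add: P_def psi_0 psi_m act_zero bot_y)
  have P1m: "P 1 (-1) A B" if "A \<in> gdeg 1" "B \<in> gdeg (-1)" for A B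
    using that b0[OF that] by (simp add: P_def psi_0 psi_1 psi_m act_zero gdeg_1_sl g_y sg_def)
  have P00: "P 0 0 A B" if "A \<in> gdeg 0" "A \<in> sl m n" "B \<in> gdeg 0" "B \<in> sl m n" for A B
    using that brk_0_gdeg[of A B 0] by (simp add: P_def psi_0 D_brk sg_def bot_0 additive.diff[OF bot_additive])
  have P01: "P 0 1 A B" if "A \<in> gdeg 0" "A \<in> sl m n" "B \<in> gdeg 1" for A B
    using that brk_0_gdeg[of A B 1] by (simp add: P_def psi_0 psi_1 g_brk sg_def)
  have P11: "P 1 1 A B" if "A \<in> gdeg 1" "B \<in> gdeg 1" for A B
    using that gdeg_trivial[OF brk_gdeg[OF that]] g_11[OF that] by (simp add: P_def psi_zero psi_1 sg_def)
  have P: "P d e A B" if A: "A \<in> gdeg d" "A \<in> sl m n" and B: "B \<in> gdeg e" "B \<in> sl m n" for d e A B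
  proof -
    consider "A = 0\<^sub>m N N" | "B = 0\<^sub>m N N" | "d = -1" "e = -1" | "d = -1" "e = 0" | "d = -1" "e = 1"
      | "d = 0" "e = -1" | "d = 0" "e = 0" | "d = 0" "e = 1" | "d = 1" "e = -1" | "d = 1" "e = 0" | "d = 1" "e = 1"
      using gdeg_trivial[OF A(1)] gdeg_trivial[OF B(1)] by blast
    then show ?thesis
    proof cases
      case 1 with P0 B show ?thesis by blast
    next
      case 2 with P0 A sym[OF B(1) A(1)] show ?thesis by blast
    next
      case 3 with Pmm A B show ?thesis by blast
    next
      case 4 with P0m A B sym show ?thesis by blast
    next
      case 5 with P1m A B sym show ?thesis by blast
    next
      case 6 with P0m A B show ?thesis by blast
    next
      case 7 with P00 A B show ?thesis by blast
    next
      case 8 with P01 A B show ?thesis by blast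
    next
      case 9 with P1m A B show ?thesis by blast
    next
      case 10 with P01 A B sym show ?thesis by blast
    next
      case 11 with P11 A B show ?thesis by blast
    qed
  qed
  have "der \<psi>" unfolding der_def using psi_add psi_smult P by (auto simp: P_def)
  moreover have "top (\<psi> A) = f A" if "A \<in> gdeg 1" for A
    using that by (simp add: psi_1 g_def top_add u bot)
  ultimately show ?thesis using psi_m psi_0 by blast
qed

end

section \<open>Cocycles as derivations\<close>

context kac_setup begin

lemma evp_add: "evp V (u + v) = evp V u + evp V v" and evp_scale: "evp V (scl V c v) = scl V c (evp V v)"
  and evp_idem [simp]: "evp V (evp V v) = evp V v"
  using V_mod by (simp_all add: supermodule_def)

lemma evp_additive: "additive (evp V)" by (simp add: additive_def evp_add)

lemmas evp_simps = evp_add additive.zero[OF evp_additive] additive.diff[OF evp_additive]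
  additive.minus[OF evp_additive]

text \<open>The parity automorphism, 1 on the even part and -1 on the odd part.\<close>

definition sigma :: "'v \<Rightarrow> 'v" where
  "sigma v = evp V v - (v - evp V v)"

lemma sigma_simps: "sigma (u + v) = sigma u + sigma v" "sigma (u - v) = sigma u - sigma v"
  "sigma (scl V c v) = scl V c (sigma v)" "sigma 0 = 0" "sigma (- v) = - sigma v" "sigma (sigma v) = v"
  by (simp_all add: sigma_def evp_simps evp_scale Vv.scale_right_diff_distrib algebra_simps)

lemma vpart_simps: "even b \<Longrightarrow> vpart V b v = evp V v" "odd b \<Longrightarrow> vpart V b v = v - evp V v"
  "vpart V b 0 = 0"
  by (simp_all add: vpart_def evp_simps)

lemma act_vpart:
  assumes x: "x \<in> sl m n" "mat_homog m a x" and v: "vpart V b v = v"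
  shows "vpart V (a + b) (act V x v) = act V x v"
  using V_mod x v unfolding supermodule_def by blast

lemma evp_act:
  assumes x: "x \<in> sl m n" "mat_homog m a x"
  shows "evp V (act V x v) = act V x (vpart V a v)"
proof -
  let ?e = "evp V v" and ?o = "v - evp V v"
  have v: "act V x v = act V x ?e + act V x ?o" using actV_add[OF x(1), of ?e ?o] by simp
  have "vpart V (a + 0) (act V x ?e) = act V x ?e" by (rule act_vpart[OF x]) (simp add: vpart_def)
  moreover have "vpart V (a + 1) (act V x ?o) = act V x ?o"
    by (rule act_vpart[OF x]) (simp add: vpart_def evp_simps)
  ultimately show ?thesis
    by (cases "even a") (simp_all add: vpart_def v evp_simps)
qed

lemma sigma_act:
  assumes x: "x \<in> sl m n" "mat_homog m a x"
  shows "sigma (act V x v) = (if even a then act V x (sigma v) else - act V x (sigma v))"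
  by (auto simp: sigma_def evp_act[OF x] vpart_def act_diff[OF x(1)])

lemma mat_part_sl: "x \<in> sl m n \<Longrightarrow> mat_part m b x \<in> sl m n"
  by (cases "even b") (auto simp: mat_part_def sl_def supertrace_def)

lemma mat_part_homog: "mat_homog m b (mat_part m b x)"
  by (auto simp: mat_homog_def mat_part_def intro!: eq_matI)

lemma mat_part_id: "x \<in> sl m n \<Longrightarrow> mat_homog m a x \<Longrightarrow>
    mat_part m b x = (if even (a + b) then x else 0\<^sub>m N N)"
proof -
  assume x: "x \<in> sl m n" and h: "mat_homog m a x"
  have "mat_part m b (mat_part m a x) = (if even (a + b) then mat_part m a x else 0\<^sub>m N N)"
    using sl_carrier[OF x] by (auto simp: mat_part_def intro!: eq_matI)
  then show ?thesis using h by (simp add: mat_homog_def)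
qed

lemma mat_part_sum: "x \<in> sl m n \<Longrightarrow> mat_part m 0 x + mat_part m 1 x = x"
  using sl_carrier[of x] by (auto simp: mat_part_def intro!: eq_matI)

lemma mat_part_linear: "x \<in> sl m n \<Longrightarrow> y \<in> sl m n \<Longrightarrow> mat_part m b (x + y) = mat_part m b x + mat_part m b y"
  "x \<in> sl m n \<Longrightarrow> mat_part m b (c \<cdot>\<^sub>m x) = c \<cdot>\<^sub>m mat_part m b x"
  using sl_carrier[of x] sl_carrier[of y] by (auto simp: mat_part_def intro!: eq_matI)

lemma sbracket_homog:
  assumes x: "x \<in> sl m n" "mat_homog m a x" and y: "y \<in> sl m n" "mat_homog m b y"
  shows "mat_homog m (a + b) (sbracket m x y)"
proof -
  define T where "T x y = mat_part m (a + b) (sbracket m x y)" for x y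
  have even_case: "mat_homog m c (A * B)" if A: "A \<in> sl m n" "mat_homog m a A" and B: "B \<in> sl m n" "mat_homog m b B"
    and c: "even (a + b + c)" for A B a b c
  proof -
    have cA: "A \<in> carrier_mat N N" "B \<in> carrier_mat N N" using A B sl_carrier by auto
    have zA: "A $$ (i, k) = 0" if "i < N" "k < N" "odd (ipar m i + ipar m k + a)" for i k
      using arg_cong[OF A(2)[unfolded mat_homog_def], of "\<lambda>M. M $$ (i, k)"] that cA by (simp add: mat_part_def)
    have zB: "B $$ (i, k) = 0" if "i < N" "k < N" "odd (ipar m i + ipar m k + b)" for i k
      using arg_cong[OF B(2)[unfolded mat_homog_def], of "\<lambda>M. M $$ (i, k)"] that cA by (simp add: mat_part_def)
    have "(A * B) $$ (i, j) = 0" if "i < N" "j < N" "odd (ipar m i + ipar m j + c)" for i j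
    proof -
      have "A $$ (i, k) * B $$ (k, j) = 0" if "k < N" for k
        using zA[of i k] zB[of k j] that \<open>i < N\<close> \<open>j < N\<close> \<open>odd (ipar m i + ipar m j + c)\<close> c by auto
      then have "(\<Sum>k<N. A $$ (i, k) * B $$ (k, j)) = 0" by (intro sum.neutral) auto
      then show ?thesis using mult_index[OF cA that(1,2)] by simp
    qed
    then show ?thesis using cA unfolding mat_homog_def
      by (intro eq_matI) (auto simp: mat_part_def simp del: index_mult_mat(1))
  qed
  have lin: "mat_homog m c (A + B)" "mat_homog m c (A - B)"
    if "mat_homog m c A" "mat_homog m c B" "A \<in> carrier_mat N N" "B \<in> carrier_mat N N" for A B c
  proof -
    have "mat_part m c (A + B) = mat_part m c A + mat_part m c B"
      using that(3,4) by (intro eq_matI) (auto simp: mat_part_def)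
    moreover have "mat_part m c (A - B) = mat_part m c A - mat_part m c B"
      using that(3,4) by (intro eq_matI) (auto simp: mat_part_def)
    ultimately have "mat_part m c (A + B) = A + B" "mat_part m c (A - B) = A - B"
      using that(1,2) unfolding mat_homog_def by metis+
    then show "mat_homog m c (A + B)" "mat_homog m c (A - B)" unfolding mat_homog_def by blast+
  qed
  have XY: "mat_homog m (a + b) (x * y)" "mat_homog m (a + b) (y * x)"
    using even_case[OF x y, of "a + b"] even_case[OF y x, of "a + b"] by auto
  note c = x(1)[THEN sl_carrier] y(1)[THEN sl_carrier]
  have cc: "x * y \<in> carrier_mat N N" "y * x \<in> carrier_mat N N" using c by auto
  have dims: "dim_row x = N" "dim_col x = N" "dim_row y = N" "dim_col y = N" using c by auto
  have part: "mat_part m 0 x = (if even a then x else 0\<^sub>m N N)" "mat_part m 1 x = (if odd a then x else 0\<^sub>m N N)"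
    "mat_part m 0 y = (if even b then y else 0\<^sub>m N N)" "mat_part m 1 y = (if odd b then y else 0\<^sub>m N N)"
    unfolding mat_part_id[OF x] mat_part_id[OF y] by auto
  have zm: "0\<^sub>m N N * z = 0\<^sub>m N N" "z * 0\<^sub>m N N = 0\<^sub>m N N" if "z \<in> carrier_mat N N" for z :: "complex mat"
    using that by auto
  have "sbracket m x y = (if odd a \<and> odd b then x * y + y * x else x * y - y * x)"
  proof (cases "even a")
    case True
    show ?thesis
    proof (cases "even b")
      case True
      with \<open>even a\<close> show ?thesis unfolding sbracket_def Let_def part
        by (simp add: zm c) (intro eq_matI; simp add: dims del: index_mult_mat(1))
    next
      case False
      with \<open>even a\<close> show ?thesis unfolding sbracket_def Let_def part
        by (simp add: zm c) (intro eq_matI; simp add: dims del: index_mult_mat(1))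
    qed
  next
    case False
    show ?thesis
    proof (cases "even b")
      case True
      with \<open>odd a\<close> show ?thesis unfolding sbracket_def Let_def part
        by (simp add: zm c) (intro eq_matI; simp add: dims del: index_mult_mat(1))
    next
      case False
      with \<open>odd a\<close> show ?thesis unfolding sbracket_def Let_def part
        by (simp add: zm c) (intro eq_matI; simp add: dims del: index_mult_mat(1))
    qed
  qed
  then show ?thesis using lin[OF XY cc] by simp
qed

text \<open>The differential of an even 1-cochain at arguments of parities a and b.\<close>

definition Delta :: "(complex mat \<Rightarrow> 'v) \<Rightarrow> nat \<Rightarrow> nat \<Rightarrow> complex mat \<Rightarrow> complex mat \<Rightarrow> 'v" where
  "Delta \<psi> a b x y = act V x (\<psi> y) - scl V ((-1) ^ (a * b)) (act V y (\<psi> x)) - \<psi> (sbracket m x y)"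

text \<open>Passes between the \<int>-grading of \<open>der\<close> and the parities of the cochain
  complex: x and y are split into their components, those of the wrong parity being zero.\<close>

lemma der_iff_Delta:
  assumes add: "\<And>A B. A \<in> sl m n \<Longrightarrow> B \<in> sl m n \<Longrightarrow> \<psi> (A + B) = \<psi> A + \<psi> B"
    and smult: "\<And>A c. A \<in> sl m n \<Longrightarrow> \<psi> (c \<cdot>\<^sub>m A) = scl V c (\<psi> A)"
  shows "der \<psi> \<longleftrightarrow> (\<forall>a\<in>{0,1}. \<forall>b\<in>{0,1}. \<forall>x\<in>sl m n. \<forall>y\<in>sl m n. mat_homog m a x \<longrightarrow> mat_homog m b y \<longrightarrow>
    Delta \<psi> a b x y = 0)"
proof (intro iffI ballI impI)
  assume R: "\<forall>a\<in>{0,1}. \<forall>b\<in>{0,1}. \<forall>x\<in>sl m n. \<forall>y\<in>sl m n. mat_homog m a x \<longrightarrow> mat_homog m b y \<longrightarrow>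
    Delta \<psi> a b x y = 0"
  have "\<psi> (brk d e A B) = act V A (\<psi> B) - scl V (sg d e) (act V B (\<psi> A))"
    if A: "A \<in> gdeg d" "A \<in> sl m n" and B: "B \<in> gdeg e" "B \<in> sl m n" for d e A B
  proof -
    define a where "a = (if even d then 0 else 1 :: nat)"
    define b where "b = (if even e then 0 else 1 :: nat)"
    have "mat_homog m a A" "mat_homog m b B"
      unfolding mat_homog_def mat_part_gdeg[OF A(1)] mat_part_gdeg[OF B(1)] by (auto simp: a_def b_def)
    then have "Delta \<psi> a b A B = 0" using R A B by (auto simp: a_def b_def)
    moreover have "sg d e = (-1) ^ (a * b)" by (rule sg_parity) (auto simp: a_def b_def)
    ultimately show ?thesis by (simp add: Delta_def sbracket_brk[OF A(1) B(1)] algebra_simps)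
  qed
  then show "der \<psi>" by (auto simp: der_def add smult)
next
  fix a b :: nat and x y
  assume d: "der \<psi>" and x: "x \<in> sl m n" "mat_homog m a x" and y: "y \<in> sl m n" "mat_homog m b y"
  note car = x(1)[THEN sl_carrier] y(1)[THEN sl_carrier]
  show "Delta \<psi> a b x y = 0"
  proof (rule biadd_cut[where T = "Delta \<psi> a b", OF _ _ _ x(1) y(1)])
    fix d' e'
    show "Delta \<psi> a b (cut d' x) (cut e' y) = 0"
    proof (cases "even (d' + int a) \<and> even (e' + int b)")
      case True
      then show ?thesis
        using der_brk[OF d cut_gdeg cut_sl[OF x(1)] cut_gdeg cut_sl[OF y(1)], of d' e']
        by (simp add: Delta_def sbracket_brk[OF cut_gdeg cut_gdeg] sg_parity)
    next
      case False
      then have z: "cut d' x = 0\<^sub>m N N \<or> cut e' y = 0\<^sub>m N N"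
        using cut_zero[OF x(2) car(1)] cut_zero[OF y(2) car(2)] by blast
      then have "brk d' e' (cut d' x) (cut e' y) = 0\<^sub>m N N"
        by (auto simp: brk_zero_left brk_zero_right)
      then show ?thesis using z x y
        by (auto simp: Delta_def sbracket_brk[OF cut_gdeg cut_gdeg] der_zero[OF d] act_zero_mat act_zero cut_sl)
    qed
  qed (simp_all add: Delta_def sbracket_add_left sbracket_add_right sl_carrier add sbracket_sl actV_add
      actV_mat_add sl_add Vv.scale_right_distrib algebra_simps)
qed

section \<open>1-cochains, 1-cocycles and the parity twist\<close>

lemma cochains_1:
  "\<phi> \<in> cochains m n V 1 \<longleftrightarrow> (\<forall>xs. \<not> (length xs = 1 \<and> xs \<in> lists (sl m n)) \<longrightarrow> \<phi> xs = 0) \<and>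
    (\<forall>x\<in>sl m n. \<forall>y\<in>sl m n. \<phi> [x + y] = \<phi> [x] + \<phi> [y]) \<and>
    (\<forall>c. \<forall>x\<in>sl m n. \<phi> [c \<cdot>\<^sub>m x] = scl V c (\<phi> [x]))" (is "_ \<longleftrightarrow> ?Z \<and> ?A \<and> ?S")
proof
  assume \<phi>: "\<phi> \<in> cochains m n V 1"
  then have "?Z" by (simp add: cochains_def)
  moreover have "\<And>xs ys x y. xs @ [x] @ ys \<in> lists (sl m n) \<and> y \<in> sl m n \<Longrightarrow>
        \<phi> (xs @ [x + y] @ ys) = \<phi> (xs @ [x] @ ys) + \<phi> (xs @ [y] @ ys)"
    using \<phi> unfolding cochains_def by blast
  from this[of "[]" _ "[]"] have "?A" by simp
  moreover have "\<And>xs ys x c. xs @ [x] @ ys \<in> lists (sl m n) \<Longrightarrow>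
        \<phi> (xs @ [c \<cdot>\<^sub>m x] @ ys) = scl V c (\<phi> (xs @ [x] @ ys))"
    using \<phi> unfolding cochains_def by blast
  from this[of "[]" _ "[]"] have "?S" by simp
  ultimately show "?Z \<and> ?A \<and> ?S" by blast
next
  assume h: "?Z \<and> ?A \<and> ?S"
  have z: "\<phi> xs = 0" if "length xs \<noteq> 1" for xs using h that by blast
  have c1: "\<phi> (xs @ [x + y] @ ys) = \<phi> (xs @ [x] @ ys) + \<phi> (xs @ [y] @ ys)"
    if "xs @ [x] @ ys \<in> lists (sl m n) \<and> y \<in> sl m n" for xs ys x y
    using h that by (cases "xs = [] \<and> ys = []") (auto simp: z)
  have c2: "\<phi> (xs @ [c \<cdot>\<^sub>m x] @ ys) = scl V c (\<phi> (xs @ [x] @ ys))"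
    if "xs @ [x] @ ys \<in> lists (sl m n)" for xs ys x c
    using h that by (cases "xs = [] \<and> ys = []") (auto simp: z)
  \<comment> \<open>Both lists have at least two entries, so both sides are zero.\<close>
  have c3: "\<phi> (xs @ [x, y] @ ys) = - scl V ((-1) ^ (a * b)) (\<phi> (xs @ [y, x] @ ys))" for xs ys x y a b
    by (simp add: z)
  show "\<phi> \<in> cochains m n V 1" unfolding cochains_def mem_Collect_eq
    by (intro conjI allI impI c1 c2 c3) (use h in blast)+
qed

text \<open>
  On the component of parity \<open>c\<close> this is multiplication by \<open>(-1)\<^bsup>c[x]\<^esup>\<close>, which removes the parity of the
  cochain from the signs of the differential.
\<close>

definition toder :: "'v cochain \<Rightarrow> complex mat \<Rightarrow> 'v" where
  "toder \<phi> x = \<phi> [mat_part m 0 x] - sigma (\<phi> [mat_part m 1 x])"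

text \<open>The formula of \<open>toder\<close> once more: the twist is multiplication by a sign on
  each parity component, hence its own inverse.\<close>

definition fromder :: "(complex mat \<Rightarrow> 'v) \<Rightarrow> 'v cochain" where
  "fromder \<psi> xs = (if length xs = 1 \<and> xs \<in> lists (sl m n)
    then \<psi> (mat_part m 0 (hd xs)) - sigma (\<psi> (mat_part m 1 (hd xs))) else 0)"

lemma cochain_zero_mat: "\<phi> \<in> cochains m n V 1 \<Longrightarrow> \<phi> [0\<^sub>m N N] = 0"
proof -
  assume "\<phi> \<in> cochains m n V 1"
  then have "\<phi> [0 \<cdot>\<^sub>m 0\<^sub>m N N] = scl V 0 (\<phi> [0\<^sub>m N N])" unfolding cochains_1 by blast
  then show ?thesis by simp
qed

lemma toder_linear:
  assumes \<phi>: "\<phi> \<in> cochains m n V 1"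
  shows "x \<in> sl m n \<Longrightarrow> y \<in> sl m n \<Longrightarrow> toder \<phi> (x + y) = toder \<phi> x + toder \<phi> y"
    "x \<in> sl m n \<Longrightarrow> toder \<phi> (c \<cdot>\<^sub>m x) = scl V c (toder \<phi> x)"
  using \<phi> by (simp_all add: toder_def mat_part_linear cochains_1 mat_part_sl sigma_simps
    Vv.scale_right_diff_distrib del: One_nat_def)

lemma toder_homog:
  assumes \<phi>: "\<phi> \<in> cochains m n V 1" and x: "x \<in> sl m n" "mat_homog m a x"
  shows "toder \<phi> x = (if even a then \<phi> [x] else - sigma (\<phi> [x]))"
  unfolding toder_def mat_part_id[OF x] using cochain_zero_mat[OF \<phi>] by (simp add: sigma_simps)

lemma fromder_cochain:
  assumes add: "\<And>A B. A \<in> sl m n \<Longrightarrow> B \<in> sl m n \<Longrightarrow> \<psi> (A + B) = \<psi> A + \<psi> B"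
    and smult: "\<And>A c. A \<in> sl m n \<Longrightarrow> \<psi> (c \<cdot>\<^sub>m A) = scl V c (\<psi> A)"
  shows "fromder \<psi> \<in> cochains m n V 1"
  unfolding cochains_1
  by (auto simp: fromder_def mat_part_linear add smult mat_part_sl sl_add sl_smult sigma_simps
    Vv.scale_right_diff_distrib)

lemma toder_fromder:
  assumes add: "\<And>A B. A \<in> sl m n \<Longrightarrow> B \<in> sl m n \<Longrightarrow> \<psi> (A + B) = \<psi> A + \<psi> B"
    and smult: "\<And>A c. A \<in> sl m n \<Longrightarrow> \<psi> (c \<cdot>\<^sub>m A) = scl V c (\<psi> A)"
    and x: "x \<in> sl m n"
  shows "toder (fromder \<psi>) x = \<psi> x"
proof -
  have z: "\<psi> (0\<^sub>m N N) = 0" using smult[of "0\<^sub>m N N" 0] by auto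
  have "toder (fromder \<psi>) x = \<psi> (mat_part m 0 x) + \<psi> (mat_part m 1 x)"
    using x mat_part_sl[OF x]
      mat_part_id[OF mat_part_sl[OF x] mat_part_homog, of 0 0] mat_part_id[OF mat_part_sl[OF x] mat_part_homog, of 0 1]
      mat_part_id[OF mat_part_sl[OF x] mat_part_homog, of 1 0] mat_part_id[OF mat_part_sl[OF x] mat_part_homog, of 1 1]
    by (simp add: toder_def fromder_def z sigma_simps)
  then show ?thesis using add[OF mat_part_sl[OF x] mat_part_sl[OF x], of 0 1] mat_part_sum[OF x] by simp
qed

lemma cochain_eqI:
  assumes "\<phi> \<in> cochains m n V 1" "\<phi>' \<in> cochains m n V 1" and eq: "\<And>x. x \<in> sl m n \<Longrightarrow> toder \<phi> x = toder \<phi>' x"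
  shows "\<phi> = \<phi>'"
proof
  fix xs
  have hom: "\<phi> [x] = \<phi>' [x]" if x: "x \<in> sl m n" "mat_homog m a x" for x a
    using eq[OF x(1)] toder_homog[OF assms(1) x] toder_homog[OF assms(2) x] sigma_simps(6)
    by (metis neg_equal_iff_equal)
  show "\<phi> xs = \<phi>' xs"
  proof (cases "length xs = 1 \<and> xs \<in> lists (sl m n)")
    case True
    then obtain x where xs: "xs = [x]" and x: "x \<in> sl m n" by (cases xs) auto
    have "\<phi> [mat_part m 0 x + mat_part m 1 x] = \<phi>' [mat_part m 0 x + mat_part m 1 x]"
      using assms(1,2) mat_part_sl[OF x] hom[OF mat_part_sl[OF x] mat_part_homog]
      by (simp add: cochains_1 del: One_nat_def)
    then show ?thesis using mat_part_sum[OF x] xs by simp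
  next
    case False
    then show ?thesis using assms(1,2) unfolding cochains_1 by metis
  qed
qed

lemma parities_simps: "parities 0 = {[]}" "parities (Suc 0) = {[0], [1]}"
  "parities (Suc (Suc 0)) = {[0, 0], [0, 1], [1, 0], [1, 1]}"
  by (auto simp: parities_def length_Suc_conv)

lemma parts_simps: "parts m [] [] = []" "parts m (b # bs) (x # xs) = mat_part m b x # parts m bs xs"
  by (simp_all add: parts_def)

lemma length_parts: "bs \<in> parities (length xs) \<Longrightarrow> length (parts m bs xs) = length xs"
  by (simp add: parts_def parities_def)

lemma nth_parts_sl: "bs \<in> parities (length xs) \<Longrightarrow> xs \<in> lists (sl m n) \<Longrightarrow> i < length xs \<Longrightarrow> parts m bs xs ! i \<in> sl m n"
  by (auto simp: parts_def parities_def intro!: mat_part_sl)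

lemma cochain_part_zero:
  assumes "\<And>xs. length xs = k \<Longrightarrow> \<phi> xs = 0" "length xs = k"
  shows "cochain_part m V c \<phi> xs = 0"
  unfolding cochain_part_def using assms by (auto simp: vpart_simps length_parts intro!: sum.neutral)

text \<open>Equality of cochains is equality on all lists, so the differential must also be known to
  vanish on lists of the wrong length.\<close>

lemma differential_zero:
  assumes z: "\<And>xs. length xs \<noteq> p \<Longrightarrow> \<phi> xs = 0" and l: "length xs \<noteq> Suc p"
  shows "differential m n V \<phi> xs = 0"
proof (cases "xs \<in> lists (sl m n)")
  case True
  have zz: "cochain_part m V c \<phi> ys = 0" if "Suc (length ys) = length xs" for ys c
    by (rule cochain_part_zero[of "length ys"]) (use that l z in auto)
  have "diff_homog m V c bs (cochain_part m V c \<phi>) (parts m bs xs) = 0" if bs: "bs \<in> parities (length xs)" for c bs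
  proof -
    have "cochain_part m V c \<phi> (take i (parts m bs xs) @ drop (Suc i) (parts m bs xs)) = 0"
      if "i < length xs" for i
      by (rule zz) (use that length_parts[OF bs] in auto)
    moreover have "cochain_part m V c \<phi> ((take j (parts m bs xs) @ drop (Suc j) (parts m bs xs))[i := w]) = 0"
      if "j < length xs" for i j w
      by (rule zz) (use that length_parts[OF bs] in auto)
    ultimately show ?thesis
      unfolding diff_homog_def length_parts[OF bs]
      by (auto simp: act_zero nth_parts_sl[OF bs True] intro!: sum.neutral)
  qed
  then show ?thesis using True by (simp add: differential_def)
qed (simp add: differential_def)

lemma cochain_part_homog:
  assumes \<phi>: "\<phi> \<in> cochains m n V 1" and z: "z \<in> sl m n" "mat_homog m a z"
  shows "cochain_part m V c \<phi> [z] = vpart V (c + a) (\<phi> [z])"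
proof -
  have "cochain_part m V c \<phi> [z] = vpart V c (\<phi> [mat_part m 0 z]) + vpart V (c + 1) (\<phi> [mat_part m 1 z])"
    by (simp add: cochain_part_def parities_simps parts_simps)
  then show ?thesis unfolding mat_part_id[OF z] using cochain_zero_mat[OF \<phi>]
    by (auto simp: vpart_def evp_simps)
qed

definition dd :: "'v cochain \<Rightarrow> nat \<Rightarrow> nat \<Rightarrow> complex mat \<Rightarrow> complex mat \<Rightarrow> 'v" where
  "dd \<phi> a b x y = diff_homog m V 0 [a, b] (cochain_part m V 0 \<phi>) [x, y] +
     diff_homog m V 1 [a, b] (cochain_part m V 1 \<phi>) [x, y]"

text \<open>On the component of parity c the two sides differ by the sign (-1)^(c (a + b)), the
  twist on 2-cochains. For a + b odd the values have parity c + 1, and there \<open>- sigma\<close>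
  is this sign.\<close>

lemma dd_Delta:
  assumes \<phi>: "\<phi> \<in> cochains m n V 1" and ab: "a \<in> {0, 1}" "b \<in> {0, 1}"
    and x: "x \<in> sl m n" "mat_homog m a x" and y: "y \<in> sl m n" "mat_homog m b y"
  shows "dd \<phi> a b x y = (if a = b then Delta (toder \<phi>) a b x y else - sigma (Delta (toder \<phi>) a b x y))"
proof -
  note z = sbracket_sl[OF x(1) y(1)] sbracket_homog[OF x y]
  have dh: "diff_homog m V c [a, b] (cochain_part m V c \<phi>) [x, y] =
      scl V ((-1) ^ (a * c)) (act V x (vpart V (c + b) (\<phi> [y])))
      - scl V ((-1) ^ (b * (c + a))) (act V y (vpart V (c + a) (\<phi> [x])))
      - vpart V (c + (a + b)) (\<phi> [sbracket m x y])" for c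
    by (simp add: diff_homog_def numeral_2_eq_2 lessThan_Suc cochain_part_homog[OF \<phi> x] cochain_part_homog[OF \<phi> y]
      cochain_part_homog[OF \<phi> z])
  have t: "toder \<phi> x = (if even a then \<phi> [x] else - sigma (\<phi> [x]))"
    "toder \<phi> y = (if even b then \<phi> [y] else - sigma (\<phi> [y]))"
    "toder \<phi> (sbracket m x y) = (if even (a + b) then \<phi> [sbracket m x y] else - sigma (\<phi> [sbracket m x y]))"
    using toder_homog[OF \<phi> x] toder_homog[OF \<phi> y] toder_homog[OF \<phi> z] by auto
  note sm = vpart_def sigma_simps sigma_act[OF x] sigma_act[OF y] act_diff x y additive.minus[OF actV_additive]
  consider "a = 0" "b = 0" | "a = 0" "b = 1" | "a = 1" "b = 0" | "a = 1" "b = 1" using ab by auto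
  then show ?thesis
  proof cases
    case 1 then show ?thesis unfolding dd_def dh Delta_def t by (simp add: sm)
  next
    case 2 then show ?thesis unfolding dd_def dh Delta_def t by (simp add: sm) (simp add: sigma_def act_diff x y)
  next
    case 3 then show ?thesis unfolding dd_def dh Delta_def t by (simp add: sm) (simp add: sigma_def act_diff x y)
  next
    case 4 then show ?thesis unfolding dd_def dh Delta_def t by (simp add: sm) (simp add: sigma_def act_diff x y)
  qed
qed

lemma cocycle_iff:
  assumes \<phi>: "\<phi> \<in> cochains m n V 1"
  shows "\<phi> \<in> cocycles m n V 1 \<longleftrightarrow> der (toder \<phi>)"
proof -
  have z: "\<phi> xs = 0" if "length xs \<noteq> 1" for xs using \<phi> that unfolding cochains_1 by blast
  have d2: "differential m n V \<phi> [x, y] = dd \<phi> 0 0 (mat_part m 0 x) (mat_part m 0 y) + dd \<phi> 0 1 (mat_part m 0 x) (mat_part m 1 y)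
      + dd \<phi> 1 0 (mat_part m 1 x) (mat_part m 0 y) + dd \<phi> 1 1 (mat_part m 1 x) (mat_part m 1 y)"
    if "x \<in> sl m n" "y \<in> sl m n" for x y
    using that by (simp add: differential_def parities_simps parts_simps dd_def)
  note lin = toder_linear[OF \<phi>]
  have D0: "Delta (toder \<phi>) a b (0\<^sub>m N N) y = 0" "Delta (toder \<phi>) a b y (0\<^sub>m N N) = 0" if "y \<in> sl m n" for a b y
  proof -
    have t0: "toder \<phi> (0\<^sub>m N N) = 0" using lin(2)[of "0\<^sub>m N N" 0] by auto
    have "sbracket m (0\<^sub>m N N) y = sbracket m (0\<^sub>m N N) y + sbracket m (0\<^sub>m N N) y"
      "sbracket m y (0\<^sub>m N N) = sbracket m y (0\<^sub>m N N) + sbracket m y (0\<^sub>m N N)"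
      using sbracket_add_left[OF zero_carrier_mat zero_carrier_mat sl_carrier[OF that]]
        sbracket_add_right[OF sl_carrier[OF that] zero_carrier_mat zero_carrier_mat] by simp_all
    then have "toder \<phi> (sbracket m (0\<^sub>m N N) y) = toder \<phi> (sbracket m (0\<^sub>m N N) y) + toder \<phi> (sbracket m (0\<^sub>m N N) y)"
      "toder \<phi> (sbracket m y (0\<^sub>m N N)) = toder \<phi> (sbracket m y (0\<^sub>m N N)) + toder \<phi> (sbracket m y (0\<^sub>m N N))"
      using lin(1)[OF sbracket_sl sbracket_sl, OF sl_zero_mat that sl_zero_mat that]
        lin(1)[OF sbracket_sl sbracket_sl, OF that sl_zero_mat that sl_zero_mat] by metis+
    then have "toder \<phi> (sbracket m (0\<^sub>m N N) y) = 0" "toder \<phi> (sbracket m y (0\<^sub>m N N)) = 0"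
      by (metis add_cancel_right_right)+
    then show "Delta (toder \<phi>) a b (0\<^sub>m N N) y = 0" "Delta (toder \<phi>) a b y (0\<^sub>m N N) = 0"
      using that by (simp_all add: Delta_def act_zero_mat t0 act_zero)
  qed
  have "\<phi> \<in> cocycles m n V 1 \<longleftrightarrow> (\<forall>x\<in>sl m n. \<forall>y\<in>sl m n. differential m n V \<phi> [x, y] = 0)"
  proof
    assume "\<forall>x\<in>sl m n. \<forall>y\<in>sl m n. differential m n V \<phi> [x, y] = 0"
    then have "differential m n V \<phi> xs = 0" for xs
    proof (cases "length xs = 2 \<and> xs \<in> lists (sl m n)")
      case True
      then obtain x y where "xs = [x, y]" by (auto simp: numeral_2_eq_2 length_Suc_conv)
      then show ?thesis using True \<open>\<forall>x\<in>sl m n. \<forall>y\<in>sl m n. differential m n V \<phi> [x, y] = 0\<close> by auto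
    next
      case False
      then show ?thesis using differential_zero[of 1 \<phi> xs, OF z]
        by (cases "xs \<in> lists (sl m n)") (simp, simp add: differential_def)
    qed
    then show "\<phi> \<in> cocycles m n V 1" using \<phi> by (auto simp: cocycles_def)
  qed (simp add: cocycles_def)
  also have "\<dots> \<longleftrightarrow> (\<forall>a\<in>{0,1}. \<forall>b\<in>{0,1}. \<forall>x\<in>sl m n. \<forall>y\<in>sl m n. mat_homog m a x \<longrightarrow> mat_homog m b y \<longrightarrow>
    Delta (toder \<phi>) a b x y = 0)" (is "?L \<longleftrightarrow> ?R")
  proof
    assume R: ?R
    have "dd \<phi> a b (mat_part m a x) (mat_part m b y) = 0" if "a \<in> {0,1}" "b \<in> {0,1}" "x \<in> sl m n" "y \<in> sl m n" for a b x y
    proof -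
      have "Delta (toder \<phi>) a b (mat_part m a x) (mat_part m b y) = 0"
        using R that mat_part_sl mat_part_homog by blast
      then show ?thesis
        unfolding dd_Delta[OF \<phi> that(1,2) mat_part_sl[OF that(3)] mat_part_homog mat_part_sl[OF that(4)] mat_part_homog]
        by (simp only: sigma_simps minus_zero if_cancel)
    qed
    then show ?L by (auto simp: d2)
  next
    assume L: ?L
    show ?R
    proof (intro ballI impI)
      fix a b :: nat and x y
      assume ab: "a \<in> {0, 1}" "b \<in> {0, 1}" and x: "x \<in> sl m n" "mat_homog m a x" and y: "y \<in> sl m n" "mat_homog m b y"
      \<comment> \<open>Of the four summands of the differential at homogeneous x and y only the one
        with their own parities survives.\<close>
      have dd0: "dd \<phi> a' b' (mat_part m a' x) (mat_part m b' y) = (if a' = a \<and> b' = b then dd \<phi> a b x y else 0)"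
        if "a' \<in> {0, 1}" "b' \<in> {0, 1}" for a' b'
      proof (cases "a' = a \<and> b' = b")
        case True
        then show ?thesis using mat_part_id[OF x, of a] mat_part_id[OF y, of b] by simp
      next
        case False
        then have "mat_part m a' x = 0\<^sub>m N N \<or> mat_part m b' y = 0\<^sub>m N N"
          using that ab mat_part_id[OF x, of a'] mat_part_id[OF y, of b'] by auto
        then have "Delta (toder \<phi>) a' b' (mat_part m a' x) (mat_part m b' y) = 0"
          using D0 mat_part_sl x y by auto
        then show ?thesis using False
          by (auto simp: dd_Delta[OF \<phi> that mat_part_sl mat_part_homog mat_part_sl mat_part_homog, OF x(1) y(1)] sigma_simps)
      qed
      have "dd \<phi> a b x y = 0"
        using L x y ab d2[OF x(1) y(1)] dd0[of 0 0] dd0[of 0 1] dd0[of 1 0] dd0[of 1 1] by auto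
      then have "Delta (toder \<phi>) a b x y = 0 \<or> sigma (Delta (toder \<phi>) a b x y) = 0"
        using dd_Delta[OF \<phi> ab x y] by (auto split: if_splits)
      then show "Delta (toder \<phi>) a b x y = 0" using sigma_simps(4,6) by metis
    qed
  qed
  also have "\<dots> \<longleftrightarrow> der (toder \<phi>)" using der_iff_Delta[of "toder \<phi>", OF lin] by simp
  finally show ?thesis .
qed

lemma differential_0:
  assumes z: "\<And>xs. xs \<noteq> [] \<Longrightarrow> \<phi> xs = 0"
  shows "differential m n V \<phi> = fromder (\<lambda>x. act V x (\<phi> []))"
proof
  fix xs
  show "differential m n V \<phi> xs = fromder (\<lambda>x. act V x (\<phi> [])) xs"
  proof (cases "length xs = 1 \<and> xs \<in> lists (sl m n)")
    case False
    then show ?thesis using differential_zero[of 0 \<phi> xs] z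
      by (cases "xs \<in> lists (sl m n)") (simp add: fromder_def, simp add: fromder_def differential_def)
  next
    case True
    then obtain x where xs: "xs = [x]" and x: "x \<in> sl m n" by (cases xs) auto
    note x1 = mat_part_sl[OF x, of 1] mat_part_homog[of 1 x]
    have "differential m n V \<phi> [x] = act V (mat_part m 0 x) (\<phi> []) + act V (mat_part m 1 x) (sigma (\<phi> []))"
      using x mat_part_sl[OF x]
      by (simp add: differential_def parities_simps parts_simps diff_homog_def cochain_part_def vpart_def
        act_diff sigma_def)
    then show ?thesis using xs x sigma_act[OF x1] by (simp add: fromder_def sigma_simps)
  qed
qed

lemma coboundary_iff:
  assumes \<phi>: "\<phi> \<in> cochains m n V 1"
  shows "\<phi> \<in> coboundaries m n V 1 \<longleftrightarrow> (\<exists>v. \<forall>x\<in>sl m n. toder \<phi> x = act V x v)"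
proof
  assume "\<phi> \<in> coboundaries m n V 1"
  then obtain \<phi>0 where p: "\<phi>0 \<in> cochains m n V 0" "\<phi> = differential m n V \<phi>0" by (auto simp: coboundaries_def)
  then have "\<phi> = fromder (\<lambda>x. act V x (\<phi>0 []))"
    using differential_0[of \<phi>0] by (auto simp: cochains_def)
  then show "\<exists>v. \<forall>x\<in>sl m n. toder \<phi> x = act V x v"
    using toder_fromder[of "\<lambda>x. act V x (\<phi>0 [])"] actV_mat_add actV_mat_scale by auto
next
  assume "\<exists>v. \<forall>x\<in>sl m n. toder \<phi> x = act V x v"
  then obtain v where v: "\<And>x. x \<in> sl m n \<Longrightarrow> toder \<phi> x = act V x v" by blast
  define \<phi>0 where "\<phi>0 xs = (if xs = [] then v else 0)" for xs :: "complex mat list"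
  have "\<phi>0 \<in> cochains m n V 0" by (auto simp: cochains_def \<phi>0_def)
  moreover have "\<phi> = differential m n V \<phi>0"
  proof (rule cochain_eqI[OF \<phi>])
    have d: "differential m n V \<phi>0 = fromder (\<lambda>x. act V x v)"
      using differential_0[of \<phi>0] by (simp add: \<phi>0_def)
    show "differential m n V \<phi>0 \<in> cochains m n V 1" unfolding d
      by (rule fromder_cochain) (simp_all add: actV_mat_add actV_mat_scale)
    fix x assume x: "x \<in> sl m n"
    show "toder \<phi> x = toder (differential m n V \<phi>0) x"
      unfolding d v[OF x] by (rule toder_fromder[symmetric]) (simp_all add: actV_mat_add actV_mat_scale x)
  qed
  ultimately show "\<phi> \<in> coboundaries m n V 1" by (auto simp: coboundaries_def)
qed

lemma toder_comb:
  "toder (\<lambda>xs. \<phi> xs - \<psi> xs) x = toder \<phi> x - toder \<psi> x"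
  "toder (\<lambda>xs. \<phi> xs + \<psi> xs) x = toder \<phi> x + toder \<psi> x"
  "toder (\<lambda>xs. scl V c (\<phi> xs)) x = scl V c (toder \<phi> x)"
  by (simp_all add: toder_def sigma_simps Vv.scale_right_diff_distrib)

lemma cochains_comb:
  assumes "\<phi> \<in> cochains m n V 1" "\<psi> \<in> cochains m n V 1"
  shows "(\<lambda>xs. \<phi> xs - \<psi> xs) \<in> cochains m n V 1" "(\<lambda>xs. \<phi> xs + \<psi> xs) \<in> cochains m n V 1"
    "(\<lambda>xs. scl V c (\<phi> xs)) \<in> cochains m n V 1"
  using assms unfolding cochains_1
  by (simp_all add: Vv.scale_right_diff_distrib Vv.scale_right_distrib mult.commute)

lemma cocycleD: "\<phi> \<in> cocycles m n V 1 \<Longrightarrow> \<phi> \<in> cochains m n V 1" "\<phi> \<in> cocycles m n V 1 \<Longrightarrow> der (toder \<phi>)"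
  using cocycle_iff by (auto simp: cocycles_def)

lemma der_cong: "der \<psi> \<Longrightarrow> (\<And>x. x \<in> sl m n \<Longrightarrow> \<phi> x = \<psi> x) \<Longrightarrow> der \<phi>"
  unfolding der_def using brk_sl by (simp add: sl_add sl_smult)

lemma fromder_cocycle: "der \<psi> \<Longrightarrow> fromder \<psi> \<in> cocycles m n V 1 \<and> (\<forall>x\<in>sl m n. toder (fromder \<psi>) x = \<psi> x)"
proof -
  assume d: "der \<psi>"
  have "fromder \<psi> \<in> cochains m n V 1"
    by (rule fromder_cochain) (simp_all add: der_add[OF d] der_smult[OF d])
  moreover have t: "toder (fromder \<psi>) x = \<psi> x" if "x \<in> sl m n" for x
    by (rule toder_fromder) (simp_all add: der_add[OF d] der_smult[OF d] that)
  ultimately show ?thesis using cocycle_iff der_cong[OF d t] by blast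
qed

lemma coh_rel_iff:
  "(\<phi>, \<psi>) \<in> coh_rel m n V 1 \<longleftrightarrow> \<phi> \<in> cocycles m n V 1 \<and> \<psi> \<in> cocycles m n V 1 \<and>
    (\<exists>v. \<forall>x\<in>sl m n. toder \<phi> x - toder \<psi> x = act V x v)"
  unfolding coh_rel_def using coboundary_iff[OF cochains_comb(1)] cocycleD
  by (auto simp: toder_comb)

lemma cohomology_iso_zero:
  assumes "\<And>\<psi>. der \<psi> \<Longrightarrow> \<exists>v. \<forall>x\<in>sl m n. \<psi> x = act V x v"
  shows "cohomology_iso m n V 1 {0}"
proof -
  note One_nat_def [simp del]
  have all: "(\<phi>, \<psi>) \<in> coh_rel m n V 1" if "\<phi> \<in> cocycles m n V 1" "\<psi> \<in> cocycles m n V 1" for \<phi> \<psi>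
    using that assms[OF der_diff[OF cocycleD(2) cocycleD(2)]] by (auto simp: coh_rel_iff)
  have "coh_rel m n V 1 `` {\<phi>} = cocycles m n V 1" if "\<phi> \<in> cocycles m n V 1" for \<phi>
    using all[OF that] by (auto simp: coh_rel_iff)
  moreover have "fromder (\<lambda>x. act V x 0) \<in> cocycles m n V 1" using fromder_cocycle[OF der_inner] by blast
  ultimately have "cohomology m n V 1 = {cocycles m n V 1}"
    by (auto simp: cohomology_def quotient_def)
  then show ?thesis unfolding cohomology_iso_def
    by (intro exI[of _ "\<lambda>_. 0"]) (auto simp: bij_betw_def)
qed

text \<open>A class is sent to the coefficient of \<psi>0 in its derivation modulo inner ones. The
  coefficient is unique because \<psi>0 is not inner.\<close>

lemma cohomology_iso_line:
  assumes d0: "der \<psi>0" and ni: "\<not> (\<exists>v. \<forall>x\<in>sl m n. \<psi>0 x = act V x v)"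
    and ex: "\<And>\<psi>. der \<psi> \<Longrightarrow> \<exists>c v. \<forall>x\<in>sl m n. \<psi> x = scl V c (\<psi>0 x) + act V x v"
  shows "cohomology_iso m n V 1 UNIV"
proof -
  note One_nat_def [simp del]
  define R where "R \<psi> c \<longleftrightarrow> (\<exists>v. \<forall>x\<in>sl m n. \<psi> x = scl V c (\<psi>0 x) + act V x v)" for \<psi> c
  have R0: "c = 0" if R: "R \<psi> c" and inner: "\<And>x. x \<in> sl m n \<Longrightarrow> \<psi> x = act V x w" for \<psi> c w
  proof (rule ccontr)
    assume c: "c \<noteq> 0"
    obtain v where v: "\<And>x. x \<in> sl m n \<Longrightarrow> \<psi> x = scl V c (\<psi>0 x) + act V x v" using R by (auto simp: R_def)
    have "\<psi>0 x = act V x (scl V (inverse c) (w - v))" if x: "x \<in> sl m n" for x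
    proof -
      have "scl V c (\<psi>0 x) = act V x (w - v)" using v[OF x] inner[OF x] x
        by (simp add: act_diff)
      then have "scl V (inverse c) (scl V c (\<psi>0 x)) = act V x (scl V (inverse c) (w - v))"
        using x by (simp add: actV_scale)
      then show ?thesis using c by simp
    qed
    then show False using ni by blast
  qed
  have Rdiff: "R (\<lambda>x. \<psi> x - \<phi> x) (c - d)" if R: "R \<psi> c" "R \<phi> d" for \<psi> \<phi> c d
  proof -
    obtain v w where "\<forall>x\<in>sl m n. \<psi> x = scl V c (\<psi>0 x) + act V x v" "\<forall>x\<in>sl m n. \<phi> x = scl V d (\<psi>0 x) + act V x w"
      using R unfolding R_def by blast
    then show ?thesis unfolding R_def
      by (intro exI[of _ "v - w"]) (simp add: act_diff Vv.scale_left_diff_distrib)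
  qed
  have Radd: "R (\<lambda>x. \<psi> x + \<phi> x) (c + d)" if R: "R \<psi> c" "R \<phi> d" for \<psi> \<phi> c d
  proof -
    obtain v w where "\<forall>x\<in>sl m n. \<psi> x = scl V c (\<psi>0 x) + act V x v" "\<forall>x\<in>sl m n. \<phi> x = scl V d (\<psi>0 x) + act V x w"
      using R unfolding R_def by blast
    then show ?thesis unfolding R_def
      by (intro exI[of _ "v + w"]) (simp add: actV_add Vv.scale_left_distrib)
  qed
  have Rscale: "R (\<lambda>x. scl V d (\<psi> x)) (d * c)" if R: "R \<psi> c" for \<psi> c d
  proof -
    obtain v where "\<forall>x\<in>sl m n. \<psi> x = scl V c (\<psi>0 x) + act V x v" using R unfolding R_def by blast
    then show ?thesis unfolding R_def
      by (intro exI[of _ "scl V d v"]) (simp add: actV_scale Vv.scale_right_distrib)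
  qed
  have Runique: "c = d" if "R \<psi> c" "R \<psi> d" for \<psi> c d
    using R0[OF Rdiff[OF that], of 0] by (simp add: act_zero)
  define G where "G \<phi> = (THE c. R (toder \<phi>) c)" for \<phi>
  have G: "R (toder \<phi>) (G \<phi>)" if "\<phi> \<in> cocycles m n V 1" for \<phi>
  proof -
    have "\<exists>c. R (toder \<phi>) c" using ex[OF cocycleD(2)[OF that]] by (auto simp: R_def)
    then show ?thesis unfolding G_def using Runique by (metis theI')
  qed
  have GI: "G \<phi> = c" if "R (toder \<phi>) c" for \<phi> c
    unfolding G_def using that Runique by blast
  have rel: "(\<phi>, \<psi>) \<in> coh_rel m n V 1 \<longleftrightarrow> \<phi> \<in> cocycles m n V 1 \<and> \<psi> \<in> cocycles m n V 1 \<and> G \<phi> = G \<psi>" for \<phi> \<psi>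
  proof (cases "\<phi> \<in> cocycles m n V 1 \<and> \<psi> \<in> cocycles m n V 1")
    case True
    then have "R (\<lambda>x. toder \<phi> x - toder \<psi> x) (G \<phi> - G \<psi>)" by (intro Rdiff G) auto
    then have "(\<exists>v. \<forall>x\<in>sl m n. toder \<phi> x - toder \<psi> x = act V x v) \<longleftrightarrow> G \<phi> - G \<psi> = 0"
      using R0[of "\<lambda>x. toder \<phi> x - toder \<psi> x" "G \<phi> - G \<psi>"] unfolding R_def
      by (metis (mono_tags, lifting) Vv.scale_zero_left add_0)
    then show ?thesis using True by (simp add: coh_rel_iff)
  next
    case False
    then show ?thesis using coh_rel_iff by blast
  qed
  \<comment> \<open>A representative is chosen; by \<open>rel\<close> the coefficient is constant on
    classes and separates them.\<close>
  define F where "F C = G (SOME \<phi>. \<phi> \<in> C)" for C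
  have cls: "coh_class m n V 1 \<phi> = {\<psi> \<in> cocycles m n V 1. G \<psi> = G \<phi>}" if "\<phi> \<in> cocycles m n V 1" for \<phi>
    using that by (auto simp: coh_class_def rel)
  have F: "F (coh_class m n V 1 \<phi>) = G \<phi>" if "\<phi> \<in> cocycles m n V 1" for \<phi>
    using someI[of "\<lambda>\<psi>. \<psi> \<in> coh_class m n V 1 \<phi>" \<phi>] that by (simp add: F_def cls)
  have coh: "cohomology m n V 1 = coh_class m n V 1 ` cocycles m n V 1"
    by (auto simp: cohomology_def quotient_def coh_class_def)
  have "bij_betw F (cohomology m n V 1) UNIV"
    unfolding bij_betw_def
  proof
    show "inj_on F (cohomology m n V 1)"
    proof (rule inj_onI)
      fix C C' assume "C \<in> cohomology m n V 1" "C' \<in> cohomology m n V 1" and eq: "F C = F C'"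
      then obtain \<phi> \<psi> where C: "C = coh_class m n V 1 \<phi>" "\<phi> \<in> cocycles m n V 1"
        "C' = coh_class m n V 1 \<psi>" "\<psi> \<in> cocycles m n V 1" unfolding coh by blast
      then have "G \<phi> = G \<psi>" using eq F by simp
      then show "C = C'" using C cls by simp
    qed
    have "c \<in> F ` cohomology m n V 1" for c
    proof -
      have d: "der (\<lambda>x. scl V c (\<psi>0 x))" by (rule der_scale[OF d0])
      have "R (toder (fromder (\<lambda>x. scl V c (\<psi>0 x)))) c"
        unfolding R_def using fromder_cocycle[OF d] by (intro exI[of _ 0]) (simp add: act_zero)
      then have "F (coh_class m n V 1 (fromder (\<lambda>x. scl V c (\<psi>0 x)))) = c"
        using F GI fromder_cocycle[OF d] by simp
      then show ?thesis unfolding coh using fromder_cocycle[OF d] by (metis imageI)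
    qed
    then show "F ` cohomology m n V 1 = UNIV" by blast
  qed
  moreover have comb: "(\<lambda>xs. \<phi> xs + \<psi> xs) \<in> cocycles m n V 1" "(\<lambda>xs. scl V c (\<phi> xs)) \<in> cocycles m n V 1"
    if "\<phi> \<in> cocycles m n V 1" "\<psi> \<in> cocycles m n V 1" for \<phi> \<psi> c
  proof -
    note ch = cocycleD(1)[OF that(1)] cocycleD(1)[OF that(2)] and dr = cocycleD(2)[OF that(1)] cocycleD(2)[OF that(2)]
    have "der (\<lambda>x. toder \<phi> x - scl V (-1) (toder \<psi> x))" by (intro der_diff der_scale dr)
    then show "(\<lambda>xs. \<phi> xs + \<psi> xs) \<in> cocycles m n V 1"
      unfolding cocycle_iff[OF cochains_comb(2)[OF ch]] by (rule der_cong) (simp add: toder_comb)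
    show "(\<lambda>xs. scl V c (\<phi> xs)) \<in> cocycles m n V 1"
      unfolding cocycle_iff[OF cochains_comb(3)[OF ch]] by (rule der_cong[OF der_scale[OF dr(1), of c]]) (simp add: toder_comb)
  qed
  moreover have "G (\<lambda>xs. \<phi> xs + \<psi> xs) = G \<phi> + G \<psi>" if "\<phi> \<in> cocycles m n V 1" "\<psi> \<in> cocycles m n V 1" for \<phi> \<psi>
    using Radd[OF G[OF that(1)] G[OF that(2)]] by (intro GI) (simp add: R_def toder_comb)
  moreover have "G (\<lambda>xs. scl V c (\<phi> xs)) = c * G \<phi>" if "\<phi> \<in> cocycles m n V 1" for \<phi> c
    using Rscale[OF G[OF that(1)], of c] by (intro GI) (simp add: R_def toder_comb)
  ultimately show ?thesis unfolding cohomology_iso_def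
    by (intro exI[of _ F]) (simp add: F)
qed

end

section \<open>The cohomology\<close>

context block_dims_pos begin

lemma two_rho1_eq: "c < N \<Longrightarrow> two_rho1 m n c = (if c < m then of_nat n else - of_nat m)"
  by (simp add: two_rho1_def wroot_def eps_def sum_subtractf sum_distrib_left[symmetric])

text \<open>Makes the trace of the upper block a character of g_0; this character is the source of
  the class for \<mu> = 0.\<close>

lemma trace_block_commutator:
  assumes A: "A \<in> gdeg 0" and B: "B \<in> gdeg 0"
  shows "(\<Sum>i<m. brk 0 0 A B $$ (i, i)) = 0"
proof -
  have e: "(A * B) $$ (i, i) = (\<Sum>k<m. A $$ (i, k) * B $$ (k, i))"
    if A: "A \<in> gdeg 0" and B: "B \<in> gdeg 0" and i: "i < m" for i A B
  proof -
    have "(A * B) $$ (i, i) = (\<Sum>k<N. A $$ (i, k) * B $$ (k, i))"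
      using i by (intro mult_index gdeg_carrier[OF A] gdeg_carrier[OF B]) auto
    also have "\<dots> = (\<Sum>k<m. A $$ (i, k) * B $$ (k, i))"
      using i gdegD[OF A, of i] by (intro sum.mono_neutral_right) (auto simp: blk_def)
    finally show ?thesis .
  qed
  have "(\<Sum>i<m. brk 0 0 A B $$ (i, i)) = (\<Sum>i<m. (A * B) $$ (i, i)) - (\<Sum>i<m. (B * A) $$ (i, i))"
    unfolding sum_subtractf[symmetric]
    using A B by (intro sum.cong) (auto simp: brk_def sg_def simp del: index_mult_mat(1))
  also have "\<dots> = (\<Sum>i<m. \<Sum>k<m. A $$ (i, k) * B $$ (k, i)) - (\<Sum>i<m. \<Sum>k<m. B $$ (i, k) * A $$ (k, i))"
    by (simp add: e A B del: index_mult_mat(1))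
  also have "(\<Sum>i<m. \<Sum>k<m. B $$ (i, k) * A $$ (k, i)) = (\<Sum>i<m. \<Sum>k<m. A $$ (i, k) * B $$ (k, i))"
    by (subst sum.swap) (simp add: mult.commute)
  finally show ?thesis by simp
qed

lemma supertrace_blocks: "supertrace m n A = (\<Sum>i<m. A $$ (i, i)) - (\<Sum>i\<in>{m..<N}. A $$ (i, i))"
proof -
  have "{..<N} = {..<m} \<union> {m..<N}" by auto
  then have "supertrace m n A = (\<Sum>i<m. (-1) ^ ipar m i * A $$ (i, i)) + (\<Sum>i\<in>{m..<N}. (-1) ^ ipar m i * A $$ (i, i))"
    unfolding supertrace_def by (simp add: sum.union_disjoint ivl_disj_int)
  then show ?thesis by (simp add: ipar_def sum_negf)
qed

end

locale kac_full = kac_setup m n L V \<iota> + block_dims_both m n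
  for m n :: nat and L :: "('l::ab_group_add) smodule" and V :: "('v::ab_group_add) smodule" and \<iota> +
  fixes \<Lambda> :: weight
  assumes m_gt_1: "1 < m"
    and integral: "integral_weight m n \<Lambda>" and dominant: "dominant_weight m n \<Lambda>"
    and L_irred: "irreducible_under (sl_zero m n) L"
    and L_hw: "has_highest_weight m n \<Lambda> L"
begin

definition mu :: weight where
  "mu = (\<lambda>a. \<Lambda> a - two_rho1 m n a)"

lemma weight_eval_mu: "weight_eval m n mu H = weight_eval m n \<Lambda> H - weight_eval m n (two_rho1 m n) H"
  by (simp add: weight_eval_def mu_def left_diff_distrib sum_subtractf)

lemma tw_eq: "tw A l = act L A l - scl L (weight_eval m n (two_rho1 m n) A) l"
proof -
  have "(\<Sum>a<N. (if a < m then - of_nat n else of_nat m) * A $$ (a, a)) = - weight_eval m n (two_rho1 m n) A"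
    unfolding weight_eval_def sum_negf[symmetric] by (intro sum.cong) (auto simp: two_rho1_eq)
  then show ?thesis by (simp add: tw_def)
qed

lemma hw_ex: "\<exists>v0. v0 \<noteq> 0 \<and> (\<forall>H\<in>cartan m n. act L H v0 = scl L (weight_eval m n \<Lambda> H) v0) \<and>
        (\<forall>(a, b)\<in>pos_even_pairs m n. act L (E a b) v0 = 0)"
  using L_hw by (simp add: has_highest_weight_def)

definition v0 :: 'l where
  "v0 = (SOME v0. v0 \<noteq> 0 \<and> (\<forall>H\<in>cartan m n. act L H v0 = scl L (weight_eval m n \<Lambda> H) v0) \<and>
        (\<forall>(a, b)\<in>pos_even_pairs m n. act L (E a b) v0 = 0))"

lemma v0: "v0 \<noteq> 0" "\<And>H. H \<in> cartan m n \<Longrightarrow> act L H v0 = scl L (weight_eval m n \<Lambda> H) v0"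
  "\<And>a b. (a, b) \<in> pos_even_pairs m n \<Longrightarrow> act L (E a b) v0 = 0"
  using someI_ex[OF hw_ex] unfolding v0_def[symmetric] by auto

sublocale R: hw_rep_both m n "scl L" tw mu v0
proof
  fix W assume W: "Lv.subspace W" and st: "\<And>x w. x \<in> gdeg 0 \<Longrightarrow> x \<in> sl m n \<Longrightarrow> w \<in> W \<Longrightarrow> tw x w \<in> W"
  \<comment> \<open>The two actions of x differ by a scalar, so they have the same invariant
    subspaces.\<close>
  have "act L x w \<in> W" if "x \<in> sl_zero m n" "w \<in> W" for x w
  proof -
    have "act L x w = tw x w + scl L (weight_eval m n (two_rho1 m n) x) w" by (simp add: tw_eq)
    then show ?thesis using that st W by (auto simp: G0_zero intro!: Lv.subspace_add Lv.subspace_scale)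
  qed
  then show "W = {0} \<or> W = UNIV" using L_irred W unfolding irreducible_under_def by blast
next
  show "v0 \<noteq> 0" by (rule v0)
  fix H assume "H \<in> cartan m n"
  then show "tw H v0 = scl L (weight_eval m n mu H) v0"
    by (simp add: tw_eq v0 weight_eval_mu Lv.scale_left_diff_distrib)
next
  fix a b assume ab: "(a, b) \<in> pos_even_pairs m n"
  then have "weight_eval m n (two_rho1 m n) (E a b) = 0"
    by (auto simp: weight_eval_def pos_even_IX IX_def intro!: sum.neutral)
  then show "tw (E a b) v0 = 0" using ab by (simp add: tw_eq v0)
qed

lemma E_diff_sl: "(a, b) \<in> IX 0 \<Longrightarrow> pr (E a a) - pr (E b b) = E a a - E b b"
proof -
  assume ab: "(a, b) \<in> IX 0"
  have st: "supertrace m n (E a a) = (-1) ^ ipar m a" if "a < N" for a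
    using that by (simp add: supertrace_def if_distrib[of "\<lambda>x. _ * x"] cong: if_cong)
  have "supertrace m n (E a a) = supertrace m n (E b b)"
    using ab by (auto simp: st IX_def blk_def ipar_def split: if_splits)
  then show ?thesis by (intro eq_matI) (auto simp: pr_def)
qed

lemma weight_eval_E_diff:
  "(a, b) \<in> IX 0 \<Longrightarrow> weight_eval m n \<nu> (pr (E a a)) - weight_eval m n \<nu> (pr (E b b)) = \<nu> a - \<nu> b"
proof -
  assume ab: "(a, b) \<in> IX 0"
  then have lt: "a < N" "b < N" by (auto simp: IX_def)
  have "weight_eval m n \<nu> (pr (E a a)) - weight_eval m n \<nu> (pr (E b b)) = weight_eval m n \<nu> (pr (E a a) - pr (E b b))"
    using gdeg_dim[OF pr_gdeg[OF unit_gdeg[of a a]]] gdeg_dim[OF pr_gdeg[OF unit_gdeg[of b b]]]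
    by (simp add: weight_eval_def sum_subtractf right_diff_distrib)
  also have "\<dots> = \<nu> a - \<nu> b"
    unfolding E_diff_sl[OF ab]
    using lt by (simp add: weight_eval_def right_diff_distrib sum_subtractf if_distrib[of "\<lambda>x. _ * x"] cong: if_cong)
  finally show ?thesis .
qed

lemma weight_form_root: "a < N \<Longrightarrow> b < N \<Longrightarrow>
    weight_form m n \<nu> (wroot a b) = (-1) ^ ipar m a * \<nu> a - (-1) ^ ipar m b * \<nu> b"
proof -
  assume ab: "a < N" "b < N"
  have "weight_form m n \<nu> (wroot a b) = (\<Sum>c<N. if a = c then (-1) ^ ipar m c * \<nu> c else 0) -
      (\<Sum>c<N. if b = c then (-1) ^ ipar m c * \<nu> c else 0)"
    unfolding weight_form_def sum_subtractf[symmetric]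
    by (rule sum.cong) (auto simp: wroot_def eps_def algebra_simps)
  then show ?thesis using ab by simp
qed

text \<open>2\<rho>_1 is constant on each block, so subtracting it changes no difference within a
  block; the minus sign of the form on the second block cancels in the quotient.\<close>

lemma tt_dominant:
  assumes "(a, b) \<in> pos_even_pairs m n"
  shows "R.tt a - R.tt b \<in> \<real>\<^sub>\<ge>\<^sub>0"
proof -
  have ab: "(a, b) \<in> IX 0" "a < b" using assms by (auto simp: pos_even_IX)
  then have lt: "a < N" "b < N" and i: "ipar m a = ipar m b" "a < m \<longleftrightarrow> b < m"
    by (auto simp: IX_def blk_def ipar_def split: if_splits)
  have "R.tt a - R.tt b = \<Lambda> a - \<Lambda> b"
    unfolding R.tt_def weight_eval_E_diff[OF ab(1)] using lt i(2) by (auto simp: mu_def two_rho1_eq)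
  moreover have "weight_form m n \<Lambda> (wroot a b) = (-1) ^ ipar m b * (\<Lambda> a - \<Lambda> b)"
    using lt i by (simp add: weight_form_root right_diff_distrib)
  moreover have "weight_form m n (wroot a b) (wroot a b) = (-1) ^ ipar m b * 2"
    using lt i ab(2) by (subst weight_form_root) (simp_all add: wroot_def eps_def)
  ultimately have "R.tt a - R.tt b = 2 * weight_form m n \<Lambda> (wroot a b) / weight_form m n (wroot a b) (wroot a b)"
    by simp
  then show ?thesis using dominant assms by (auto simp: dominant_weight_def)
qed

text \<open>Integrality controls only pairings with roots, so a single coordinate of \<Lambda> may
  fail to be real. On matrices of supertrace zero the evaluation involves only the controlled
  differences.\<close>

lemma tt_real:
  assumes a: "a < N" shows "R.tt a \<in> \<real>"
proof -
  define H where "H = pr (E a a)"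
  have g: "E a a \<in> gdeg 0" by auto
  have Hreal: "H $$ (b, b) \<in> \<real>" if "b < N" for b
  proof -
    have "supertrace m n (E a a) \<in> \<real>"
      unfolding supertrace_def using a by (intro sum_in_Reals) (auto intro!: Reals_mult Reals_power)
    then show ?thesis using that a
      by (auto simp: H_def pr_def Dm_def intro!: Reals_diff Reals_mult Reals_divide Reals_add)
  qed
  have st: "(\<Sum>b<N. (-1) ^ ipar m b * H $$ (b, b)) = 0"
    using pr_sl[OF g] by (simp add: H_def sl_def supertrace_def)
  have int: "(-1) ^ ipar m b * \<Lambda> b - \<Lambda> 0 \<in> \<real>" if b: "b < N" for b
  proof (cases "b = 0")
    case True
    then show ?thesis using m_pos by (simp add: ipar_def)
  next
    case False
    then have "weight_form m n \<Lambda> (wroot b 0) \<in> \<int>"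
      using integral b N_pos by (auto simp: integral_weight_def)
    then show ?thesis using b N_pos m_pos
      by (auto simp: weight_form_root ipar_def elim!: Ints_cases)
  qed
  \<comment> \<open>The subtracted term is a multiple of the supertrace of H, which is zero.\<close>
  have "weight_eval m n \<Lambda> H = (\<Sum>b<N. \<Lambda> b * H $$ (b, b)) - \<Lambda> 0 * (\<Sum>b<N. (-1) ^ ipar m b * H $$ (b, b))"
    by (simp add: st weight_eval_def)
  also have "\<dots> = (\<Sum>b<N. (-1) ^ ipar m b * ((-1) ^ ipar m b * \<Lambda> b - \<Lambda> 0) * H $$ (b, b))"
    unfolding sum_distrib_left sum_subtractf[symmetric]
    by (intro sum.cong) (auto simp: ipar_def algebra_simps)
  also have "\<dots> \<in> \<real>"
    using int Hreal by (intro sum_in_Reals Reals_mult) (auto intro!: Reals_power)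
  finally have "weight_eval m n \<Lambda> H \<in> \<real>" .
  moreover have "weight_eval m n (two_rho1 m n) H \<in> \<real>"
    unfolding weight_eval_def using Hreal by (intro sum_in_Reals Reals_mult) (auto simp: two_rho1_eq)
  ultimately show ?thesis unfolding R.tt_def H_def[symmetric] weight_eval_mu by (rule Reals_diff)
qed

lemma normalize_minus:
  assumes "der \<psi>"
  shows "\<exists>v \<phi>. der \<phi> \<and> (\<forall>A\<in>gdeg (-1). \<phi> A = 0) \<and> (\<forall>x. \<psi> x = \<phi> x + act V x v)"
proof -
  obtain v where "\<forall>A\<in>gdeg (-1). \<psi> A = act V A v" using der_minus_inner[OF assms] by blast
  then show ?thesis
    by (intro exI[of _ v] exI[of _ "\<lambda>x. \<psi> x - act V x v"]) (auto intro: der_diff assms der_inner)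
qed

lemma normalize_zero:
  assumes d: "der \<psi>" and nontriv: "\<not> (\<forall>H\<in>cartan m n. weight_eval m n mu H = 0)"
  shows "\<exists>v \<phi>. der \<phi> \<and> (\<forall>A\<in>gdeg (-1). \<phi> A = 0) \<and> (\<forall>A\<in>gdeg 0 \<inter> sl m n. \<phi> A = 0) \<and>
    (\<forall>x\<in>sl m n. \<psi> x = \<phi> x + act V x v)"
proof -
  obtain v \<phi> where p: "der \<phi>" "\<forall>A\<in>gdeg (-1). \<phi> A = 0" "\<forall>x. \<psi> x = \<phi> x + act V x v"
    using normalize_minus[OF d] by blast
  have "\<exists>w. \<forall>x. x \<in> gdeg 0 \<longrightarrow> x \<in> sl m n \<longrightarrow> top (\<phi> x) = tw x w"
    by (rule R.derivation_inner[OF tt_real tt_dominant nontriv])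
      (simp_all add: der_add[OF p(1)] der_smult[OF p(1)] top_add top_scale der_top_0[OF p(1)])
  then obtain w where w: "\<And>x. x \<in> gdeg 0 \<Longrightarrow> x \<in> sl m n \<Longrightarrow> top (\<phi> x) = tw x w" by blast
  define \<phi>' where "\<phi>' x = \<phi> x - act V x (bot w)" for x
  have "der \<phi>'" unfolding \<phi>'_def by (intro der_diff p der_inner)
  moreover have "\<forall>A\<in>gdeg (-1). \<phi>' A = 0" by (simp add: \<phi>'_def p bot_y)
  moreover have "\<phi>' A = 0" if A: "A \<in> gdeg 0" "A \<in> sl m n" for A
    using bot_top[OF der_yker_0[OF p(1,2) A]] w[OF A] bot_0[OF A, of w] by (simp add: \<phi>'_def)
  moreover have "\<psi> x = \<phi>' x + act V x (bot w + v)" if "x \<in> sl m n" for x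
    using p(3) that by (simp add: \<phi>'_def actV_add)
  ultimately show ?thesis by blast
qed

lemma der_top_1:
  assumes d: "der \<psi>" and z: "\<forall>A\<in>gdeg 0 \<inter> sl m n. \<psi> A = 0"
  shows "A \<in> gdeg 1 \<Longrightarrow> B \<in> gdeg 1 \<Longrightarrow> top (\<psi> (A + B)) = top (\<psi> A) + top (\<psi> B)"
    "A \<in> gdeg 1 \<Longrightarrow> top (\<psi> (c \<cdot>\<^sub>m A)) = scl L c (top (\<psi> A))"
    "h \<in> gdeg 0 \<Longrightarrow> h \<in> sl m n \<Longrightarrow> A \<in> gdeg 1 \<Longrightarrow> top (\<psi> (brk 0 1 h A)) = tw h (top (\<psi> A))"
proof -
  assume h: "h \<in> gdeg 0" "h \<in> sl m n" and A: "A \<in> gdeg 1"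
  have "\<psi> (brk 0 1 h A) = act V h (\<psi> A)"
    using der_brk[OF d h A gdeg_1_sl[OF A]] z h A by (simp add: act_zero gdeg_1_sl)
  then show "top (\<psi> (brk 0 1 h A)) = tw h (top (\<psi> A))" by (simp add: top_0 h)
qed (simp_all add: der_add[OF d] der_smult[OF d] gdeg_1_sl top_add top_scale)

text \<open>Once g_-1 and g_0 are killed, the derivation is a homomorphism from g_+1 to M, hence
  determined by its value at \<open>top1\<close>.\<close>

lemma der_vanish:
  assumes d: "der \<psi>" and z: "\<forall>A\<in>gdeg (-1). \<psi> A = 0" "\<forall>A\<in>gdeg 0 \<inter> sl m n. \<psi> A = 0"
    and t: "top (\<psi> top1) = 0" and x: "x \<in> sl m n"
  shows "\<psi> x = 0"
proof (rule der_eq_zero[OF d z _ x], intro ballI)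
  fix A assume A: "A \<in> gdeg 1"
  have "top (\<psi> A) = 0"
    by (rule R.equivariant_zero[of "\<lambda>A. top (\<psi> A)", OF _ _ _ t A]) (simp_all add: der_top_1[OF d z(2)])
  then show "\<psi> A = 0" using bot_top[OF der_yker_1[OF d z A]] by (simp add: additive.zero[OF bot_additive])
qed

lemma der_alpha_max:
  assumes d: "der \<psi>" and z: "\<forall>A\<in>gdeg 0 \<inter> sl m n. \<psi> A = 0" and t: "top (\<psi> top1) \<noteq> 0"
  shows "weight_eq m n mu (alpha_max m n)" "\<exists>c. top (\<psi> top1) = scl L c v0"
  using R.equivariant_top[of "\<lambda>A. top (\<psi> A)", OF der_top_1[OF d z] t] by blast+

text \<open>With two rows in the upper block, E_11 - E_22 is in h and alpha_max has the value 1 on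
  it. This separates the two exceptional weights.\<close>

lemma alpha_max_nontrivial: "\<exists>H\<in>cartan m n. weight_eval m n (alpha_max m n) H \<noteq> 0"
proof -
  have ix: "(0, 1) \<in> IX 0" using m_gt_1 by (auto simp: IX_def blk_def)
  have "weight_eval m n (alpha_max m n) (pr (E 0 0)) - weight_eval m n (alpha_max m n) (pr (E 1 1)) = 1"
    unfolding weight_eval_E_diff[OF ix] using m_gt_1 n_pos by (auto simp: alpha_max_def wroot_def eps_def)
  then have "weight_eval m n (alpha_max m n) (pr (E 0 0)) \<noteq> 0 \<or> weight_eval m n (alpha_max m n) (pr (E 1 1)) \<noteq> 0"
    by (metis diff_0_right zero_neq_one)
  moreover have "pr (E 0 0) \<in> cartan m n" "pr (E 1 1) \<in> cartan m n"
    using m_gt_1 pr_unit_cartan[of 0] pr_unit_cartan[of 1] by auto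
  ultimately show ?thesis by blast
qed

lemma cohomology_other_weight:
  assumes "\<not> weight_eq m n mu (alpha_max m n)" and "\<not> (\<forall>H\<in>cartan m n. weight_eval m n mu H = 0)"
  shows "cohomology_iso m n V 1 {0}"
proof (rule cohomology_iso_zero)
  fix \<psi> assume "der \<psi>"
  then obtain v \<phi> where p: "der \<phi>" "\<forall>A\<in>gdeg (-1). \<phi> A = 0" "\<forall>A\<in>gdeg 0 \<inter> sl m n. \<phi> A = 0"
    "\<forall>x\<in>sl m n. \<psi> x = \<phi> x + act V x v"
    using normalize_zero assms by blast
  then have "top (\<phi> top1) = 0" using der_alpha_max(1) assms(1) by blast
  then have "\<forall>x\<in>sl m n. \<psi> x = act V x v" using p der_vanish[OF p(1-3)] by simp
  then show "\<exists>v. \<forall>x\<in>sl m n. \<psi> x = act V x v" by blast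
qed

lemma cohomology_alpha_max:
  assumes \<mu>: "weight_eq m n mu (alpha_max m n)"
  shows "cohomology_iso m n V 1 UNIV"
proof -
  have nontriv: "\<not> (\<forall>H\<in>cartan m n. weight_eval m n mu H = 0)"
    using \<mu> alpha_max_nontrivial by (auto simp: weight_eq_def)
  obtain f where f: "\<And>A B. A \<in> gdeg 1 \<Longrightarrow> B \<in> gdeg 1 \<Longrightarrow> f (A + B) = f A + f B"
    "\<And>A c. A \<in> gdeg 1 \<Longrightarrow> f (c \<cdot>\<^sub>m A) = scl L c (f A)"
    "\<And>h A. h \<in> gdeg 0 \<Longrightarrow> h \<in> sl m n \<Longrightarrow> A \<in> gdeg 1 \<Longrightarrow> f (brk 0 1 h A) = tw h (f A)" "f top1 = v0"
    using R.equivariant_exists[OF \<mu>] by blast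
  have tz: "tw A 0 = 0" if "A \<in> gdeg 0" "A \<in> sl m n" for A
    using that by (simp add: additive.zero[OF tw.h0_additive])
  obtain \<psi>0 where p0: "der \<psi>0" "\<forall>A\<in>gdeg (-1). \<psi>0 A = 0" "\<forall>A\<in>gdeg 0 \<inter> sl m n. \<psi>0 A = bot 0"
    "\<forall>A\<in>gdeg 1. top (\<psi>0 A) = f A"
    using der_construct[of "\<lambda>_. 0" f, OF _ _ _ f(1-3)] tz by auto
  have p00: "\<forall>A\<in>gdeg 0 \<inter> sl m n. \<psi>0 A = 0" using p0(3) by (simp add: additive.zero[OF bot_additive])
  have top0: "top (\<psi>0 top1) = v0" using p0(4) top1_gdeg f(4) by simp
  show ?thesis
  proof (rule cohomology_iso_line[OF p0(1)])
    show "\<not> (\<exists>v. \<forall>x\<in>sl m n. \<psi>0 x = act V x v)"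
    proof
      assume "\<exists>v. \<forall>x\<in>sl m n. \<psi>0 x = act V x v"
      then obtain v where v: "\<And>x. x \<in> sl m n \<Longrightarrow> \<psi>0 x = act V x v" by blast
      \<comment> \<open>An inner derivation maps g_+1 into vectors without top component.\<close>
      have "v0 = 0" using top0 v[OF gdeg_1_sl[OF top1_gdeg]] top_1[OF top1_gdeg, of v] by simp
      then show False using v0(1) by simp
    qed
    fix \<psi> assume "der \<psi>"
    then obtain v \<phi> where p: "der \<phi>" "\<forall>A\<in>gdeg (-1). \<phi> A = 0" "\<forall>A\<in>gdeg 0 \<inter> sl m n. \<phi> A = 0"
      "\<forall>x\<in>sl m n. \<psi> x = \<phi> x + act V x v"
      using normalize_zero nontriv by blast
    have "\<exists>c. top (\<phi> top1) = scl L c v0"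
    proof (cases "top (\<phi> top1) = 0")
      case True
      then show ?thesis by (intro exI[of _ 0]) simp
    next
      case False
      then show ?thesis using der_alpha_max(2)[OF p(1,3)] by blast
    qed
    then obtain c where c: "top (\<phi> top1) = scl L c v0" by blast
    have "\<phi> x - scl V c (\<psi>0 x) = 0" if x: "x \<in> sl m n" for x
    proof (rule der_vanish[of "\<lambda>x. \<phi> x - scl V c (\<psi>0 x)"])
      show "der (\<lambda>x. \<phi> x - scl V c (\<psi>0 x))" by (intro der_diff der_scale p p0)
      show "top (\<phi> top1 - scl V c (\<psi>0 top1)) = 0"
        by (simp add: additive.diff[OF top_additive] top_scale top0 c)
    qed (use p p0 p00 x in auto)
    then show "\<exists>c v. \<forall>x\<in>sl m n. \<psi> x = scl V c (\<psi>0 x) + act V x v"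
      using p(4) by (intro exI[of _ c] exI[of _ v]) auto
  qed
qed

lemma cohomology_trivial_weight:
  assumes \<mu>: "\<forall>H\<in>cartan m n. weight_eval m n mu H = 0"
  shows "cohomology_iso m n V 1 UNIV"
proof -
  have tz: "tw A l = 0" if "A \<in> gdeg 0" "A \<in> sl m n" for A l
    using R.trivial_weight[OF _ that] \<mu> by blast
  \<comment> \<open>As g_0 acts by zero, every subspace is a submodule, and irreducibility makes M
    the line of \<open>v0\<close>.\<close>
  define W where "W = range (\<lambda>c. scl L c v0)"
  have "Lv.subspace W"
    unfolding W_def Lv.subspace_def
  proof (intro conjI ballI allI)
    show "0 \<in> range (\<lambda>c. scl L c v0)" by (rule range_eqI[of _ _ 0]) simp
    fix x y assume "x \<in> range (\<lambda>c. scl L c v0)" "y \<in> range (\<lambda>c. scl L c v0)"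
    then show "x + y \<in> range (\<lambda>c. scl L c v0)" by (auto simp: Lv.scale_left_distrib[symmetric])
  qed auto
  moreover have "tw x w \<in> W" if "x \<in> gdeg 0" "x \<in> sl m n" for x w
    using tz[OF that] Lv.subspace_0[OF \<open>Lv.subspace W\<close>] by simp
  moreover have "v0 \<in> W" unfolding W_def by (rule range_eqI[of _ _ 1]) simp
  ultimately have W: "W = UNIV" using R.irred[of W] v0(1) by blast
  define \<chi> where "\<chi> A = (\<Sum>i<m. A $$ (i, i))" for A :: "complex mat"
  have chi: "\<chi> (A + B) = \<chi> A + \<chi> B" "\<chi> (c \<cdot>\<^sub>m A) = c * \<chi> A" if "A \<in> gdeg 0" "B \<in> gdeg 0" for A B c
    using that by (simp_all add: \<chi>_def sum.distrib sum_distrib_left)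
  have chi_brk: "\<chi> (brk 0 0 A B) = 0" if "A \<in> gdeg 0" "B \<in> gdeg 0" for A B
    unfolding \<chi>_def by (rule trace_block_commutator[OF that])
  obtain \<psi>0 where p0: "der \<psi>0" "\<forall>A\<in>gdeg (-1). \<psi>0 A = 0"
    "\<forall>A\<in>gdeg 0 \<inter> sl m n. \<psi>0 A = bot (scl L (\<chi> A) v0)"
    using der_construct[of "\<lambda>A. scl L (\<chi> A) v0" "\<lambda>_. 0"] tz
    by (auto simp: chi chi_brk Lv.scale_left_distrib)
  \<comment> \<open>An element of g_0 with upper block trace 1: the two diagonal units have opposite
    supertraces. On it inner derivations have zero top component, but \<psi>0 does not.\<close>
  define z where "z = E 0 0 + E m m"
  have mN: "m < N" "0 < N" using n_pos by auto
  have zg: "z \<in> gdeg 0" unfolding z_def by (intro gdeg_add unit_gdeg) simp_all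
  have zs: "z \<in> sl m n"
    using gdeg_carrier[OF zg] mN m_pos
    by (simp add: sl_def supertrace_def) (simp add: z_def distrib_left sum.distrib if_distrib[of "\<lambda>x. _ * x"] ipar_def cong: if_cong)
  have zc: "\<chi> z = 1"
    using mN m_pos by (simp add: \<chi>_def z_def sum.distrib)
  show ?thesis
  proof (rule cohomology_iso_line[OF p0(1)])
    show "\<not> (\<exists>v. \<forall>x\<in>sl m n. \<psi>0 x = act V x v)"
    proof
      assume "\<exists>v. \<forall>x\<in>sl m n. \<psi>0 x = act V x v"
      then obtain v where v: "\<And>x. x \<in> sl m n \<Longrightarrow> \<psi>0 x = act V x v" by blast
      have "top (bot (scl L (\<chi> z) v0)) = tw z (top v)"
        using p0(3) zg zs v[OF zs] top_0[OF zg zs, of v] by auto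
      then show False using tz[OF zg zs] v0(1) by (simp add: bot zc)
    qed
    fix \<psi> assume "der \<psi>"
    then obtain v \<phi> where p: "der \<phi>" "\<forall>A\<in>gdeg (-1). \<phi> A = 0" "\<forall>x. \<psi> x = \<phi> x + act V x v"
      using normalize_minus by blast
    define D where "D x = top (\<phi> x)" for x
    have D_brk: "D (brk 0 0 A B) = 0" if "A \<in> gdeg 0" "A \<in> sl m n" "B \<in> gdeg 0" "B \<in> sl m n" for A B
      using that by (simp add: D_def der_top_0[OF p(1)] tz)
    have D_add: "D (A + B) = D A + D B" if "A \<in> sl m n" "B \<in> sl m n" for A B
      using that by (simp add: D_def der_add[OF p(1)] top_add)
    have D_smult: "D (c \<cdot>\<^sub>m A) = scl L c (D A)" if "A \<in> sl m n" for A c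
      using that by (simp add: D_def der_smult[OF p(1)] top_scale)
    have off: "D (pr (E a b)) = 0" if ab: "(a, b) \<in> IX 0" "a \<noteq> b" for a b
    proof -
      have g: "E a b \<in> gdeg 0" using ab by (auto simp: IX_def)
      \<comment> \<open>D kills commutators, and an off-diagonal unit is an eigenvector of the
        bracket with the height element, with eigenvalue b - a.\<close>
      have "scl L (of_nat b - of_nat a) (D (pr (E a b))) = 0"
        using D_brk[OF pr_gdeg[OF Ht_gdeg] pr_sl[OF Ht_gdeg] pr_gdeg[OF g] pr_sl[OF g]]
        by (simp add: Ht_brk[OF ab(1)] D_smult pr_sl[OF g])
      moreover have "of_nat b - of_nat a \<noteq> (0 :: complex)" using ab(2) by simp
      ultimately show ?thesis by simp
    qed
    have diag: "D (pr (E a a)) = D (pr (E b b))" if ab: "(a, b) \<in> IX 0" for a b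
    proof (cases "a = b")
      case False
      have g: "E a b \<in> gdeg 0" "E b a \<in> gdeg 0" "E a a \<in> gdeg 0" "E b b \<in> gdeg 0" using ab by (auto simp: IX_def)
      have s: "pr (E a a) \<in> sl m n" "pr (E b b) \<in> sl m n" using g by (auto intro: pr_sl)
      have "brk 0 0 (pr (E a b)) (pr (E b a)) = E a a - E b b"
        unfolding brk_pr[OF g(1,2)] using ab by (auto simp: brk_units IX_def sg_def intro!: eq_matI)
      moreover have "pr (E a a) = E a a - E b b + pr (E b b)"
        unfolding E_diff_sl[OF ab, symmetric]
        using gdeg_dim[OF pr_gdeg[OF g(3)]] gdeg_dim[OF pr_gdeg[OF g(4)]]
        by (intro eq_matI) auto
      ultimately have e: "pr (E a a) = brk 0 0 (pr (E a b)) (pr (E b a)) + pr (E b b)" by (simp only:)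
      show ?thesis
        unfolding e D_add[OF brk_sl s(2), OF pr_gdeg[OF g(1)] pr_gdeg[OF g(2)]]
          D_brk[OF pr_gdeg[OF g(1)] pr_sl[OF g(1)] pr_gdeg[OF g(2)] pr_sl[OF g(2)]]
        by (rule add_0)
    qed simp
    \<comment> \<open>D is constant on the projected diagonal units of each block, so one unit from
      each block determines it; w collects the two values.\<close>
    define w where "w = D (pr (E 0 0)) + D (pr (E m m))"
    have Dx: "D x = scl L (\<chi> x) w" if x: "x \<in> gdeg 0" "x \<in> sl m n" for x
    proof -
      have "D (pr x) = (\<Sum>(a, b)\<in>IX 0. scl L (x $$ (a, b)) (D (pr (E a b))))"
        by (rule mat_sum_units[of 0 "\<lambda>x. D (pr x)" "scl L"])
          (simp_all add: pr_add pr_smult D_add D_smult pr_sl x)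
      also have "\<dots> = (\<Sum>(a, b)\<in>(\<lambda>a. (a, a)) ` {..<N}. scl L (x $$ (a, b)) (D (pr (E a b))))"
        by (rule sum.mono_neutral_right[OF finite_IX]) (auto simp: IX_def image_iff off)
      also have "\<dots> = (\<Sum>a<N. scl L (x $$ (a, a)) (D (pr (E a a))))"
        by (subst sum.reindex) (auto simp: inj_on_def)
      also have "\<dots> = (\<Sum>a<m. scl L (x $$ (a, a)) (D (pr (E 0 0)))) + (\<Sum>a\<in>{m..<N}. scl L (x $$ (a, a)) (D (pr (E m m))))"
      proof -
        have "{..<N} = {..<m} \<union> {m..<N}" by auto
        then have "(\<Sum>a<N. scl L (x $$ (a, a)) (D (pr (E a a)))) =
          (\<Sum>a<m. scl L (x $$ (a, a)) (D (pr (E a a)))) + (\<Sum>a\<in>{m..<N}. scl L (x $$ (a, a)) (D (pr (E a a))))"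
          by (simp add: sum.union_disjoint ivl_disj_int)
        also have "(\<Sum>a<m. scl L (x $$ (a, a)) (D (pr (E a a)))) = (\<Sum>a<m. scl L (x $$ (a, a)) (D (pr (E 0 0))))"
          by (intro sum.cong refl arg_cong[of _ _ "scl L _"] diag) (auto simp: IX_def blk_def)
        also have "(\<Sum>a\<in>{m..<N}. scl L (x $$ (a, a)) (D (pr (E a a)))) =
            (\<Sum>a\<in>{m..<N}. scl L (x $$ (a, a)) (D (pr (E m m))))"
          by (intro sum.cong refl arg_cong[of _ _ "scl L _"] diag) (auto simp: IX_def blk_def)
        finally show ?thesis .
      qed
      also have "\<dots> = scl L (\<chi> x) (D (pr (E 0 0))) + scl L (\<Sum>a\<in>{m..<N}. x $$ (a, a)) (D (pr (E m m)))"
        by (simp add: \<chi>_def Lv.scale_sum_left)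
      \<comment> \<open>Supertrace zero means that the traces of the two blocks agree.\<close>
      also have "(\<Sum>a\<in>{m..<N}. x $$ (a, a)) = \<chi> x"
        using x(2) by (simp add: sl_def supertrace_blocks \<chi>_def)
      finally show ?thesis using x by (simp add: pr_id w_def Lv.scale_right_distrib)
    qed
    obtain c where c: "w = scl L c v0" using W by (auto simp: W_def)
    have "\<phi> x - scl V c (\<psi>0 x) = 0" if x: "x \<in> sl m n" for x
    proof (rule der_vanish[of "\<lambda>x. \<phi> x - scl V c (\<psi>0 x)"])
      show d: "der (\<lambda>x. \<phi> x - scl V c (\<psi>0 x))" by (intro der_diff der_scale p p0)
      show z0: "\<forall>A\<in>gdeg 0 \<inter> sl m n. \<phi> A - scl V c (\<psi>0 A) = 0"
      proof
        fix A assume A: "A \<in> gdeg 0 \<inter> sl m n"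
        then have "\<phi> A = bot (D A)" using bot_top[OF der_yker_0[OF p(1,2)]] by (simp add: D_def)
        also have "\<dots> = scl V c (\<psi>0 A)" using A p0(3) Dx[of A] by (simp add: c bot_scale[symmetric] mult.commute)
        finally show "\<phi> A - scl V c (\<psi>0 A) = 0" by simp
      qed
      \<comment> \<open>There is no nonzero homomorphism from g_+1 to M when \<mu> = 0, because
        alpha_max does not vanish on h.\<close>
      have "\<not> weight_eq m n mu (alpha_max m n)"
        using \<mu> alpha_max_nontrivial by (auto simp: weight_eq_def)
      then show "top (\<phi> top1 - scl V c (\<psi>0 top1)) = 0"
        using der_alpha_max(1)[OF d z0] by blast
    qed (use p p0 x in auto)
    then show "\<exists>c v. \<forall>x\<in>sl m n. \<psi> x = scl V c (\<psi>0 x) + act V x v"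
      using p(3) by (intro exI[of _ c] exI[of _ v]) auto
  qed
qed

end

theorem theorem3p1:
  fixes m n :: nat
    and \<Lambda> :: weight
    and L :: "('l::ab_group_add) smodule"
    and V :: "('v::ab_group_add) smodule"
    and \<iota> :: "'l \<Rightarrow> 'v"
  assumes "1 \<le> n" and "n \<le> m"
    and "(m, n) \<noteq> (1, 1)"
    and "is_weight m n \<Lambda>" and "integral_weight m n \<Lambda>" and "dominant_weight m n \<Lambda>"
    and "kac_module m n \<Lambda> L V \<iota>"
  shows "cohomology_iso m n V 1
    (if weight_eq m n \<Lambda> (\<lambda>a. two_rho1 m n a + alpha_max m n a) then UNIV
     else if weight_eq m n \<Lambda> (two_rho1 m n) then UNIV
     else {0})"
proof -
  \<comment> \<open>The condition 1 < m comes from n \<le> m, since m = 1 would force n = 1.\<close>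
  interpret kac_full m n L V \<iota> \<Lambda>
    by unfold_locales (use assms in \<open>auto simp: kac_module_def level0_module_def\<close>)
  have "weight_eq m n \<Lambda> (\<lambda>a. two_rho1 m n a + alpha_max m n a) \<longleftrightarrow> weight_eq m n mu (alpha_max m n)"
    by (auto simp: weight_eq_def weight_eval_def mu_def algebra_simps sum.distrib sum_subtractf)
  moreover have "weight_eq m n \<Lambda> (two_rho1 m n) \<longleftrightarrow> (\<forall>H\<in>cartan m n. weight_eval m n mu H = 0)"
    by (auto simp: weight_eq_def weight_eval_mu)
  ultimately show ?thesis
    using cohomology_alpha_max cohomology_trivial_weight cohomology_other_weight by auto
qed

end
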